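(* Let $(H\to N,\Gamma^\infty,\nabla)$ be a smooth field of Hilbert spaces, where $N$ is a connected finite-dimensional manifold. Assume that for every $\lambda\in N$ there are an open neighborhood $U$ of $\lambda$ and a family $\{A(X)\}_{X\in\operatorname{Vect}(U)}$ of $\Gamma^\infty(U)$-smooth fields of operators such that: a) for all $X,Y\in\operatorname{Vect}(U)$, $a\in C^\infty(U)$ and $\varphi,\psi\in\Gamma^\infty(U)$: $A(X+Y)=A(X)+A(Y)$, $A(aX)=aA(X)$, and $\langle A(X)\varphi,\psi\rangle=\langle\varphi,-A(\overline X)\psi\rangle$; b) $A(X):\Gamma^\infty(U)\to\Gamma^\infty(U)$ is continuous with respect to the topology induced by $\Gamma^n(U)$, for every $X\in\operatorname{Vect}(U)$ and $n\in\mathbb N$; c) through every point in $H|_U$ there passes a section $\varphi\in\Gamma^\infty(U)$ such that $\nabla_X\varphi=A(X)\varphi$ for every $X\in\operatorname{Vect}(U)$. Then $(H\to N,\Gamma^\infty,\nabla)$ admits a smooth local trivialization.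
   Context: $C^\infty(N)$ denotes the smooth complex functions, $\operatorname{Vect}(N)$ the complexified smooth vector fields. A field of Hilbert spaces is a surjective map $p:H\to N$ whose fibers $\mathcal H(\lambda)=p^{-1}(\lambda)$ are complex Hilbert spaces (inner products antilinear in the second variable); $H|_U=p^{-1}(U)$; for sections $\varphi,\psi$, $h(\varphi,\psi)(\lambda)=\langle\varphi,\psi\rangle(\lambda)=\langle\varphi(\lambda),\psi(\lambda)\rangle_\lambda$. Smooth field of Hilbert spaces $(H\to N,\Gamma^\infty,\nabla)$: $\Gamma^\infty$ is a set of sections closed under addition and multiplication by $C^\infty(N)$, and $\nabla:\operatorname{Vect}(N)\times\Gamma^\infty\to\Gamma^\infty$ satisfies (i) $\nabla_{X+Y}=\nabla_X+\nabla_Y$, $\nabla_{aX}=a\nabla_X$, $\nabla_X(a\varphi)=X(a)\varphi+a\nabla_X\varphi$; (ii) $h(\varphi,\psi)\in C^\infty(N)$, $Xh(\varphi,\psi)=h(\nabla_X\varphi,\psi)+h(\varphi,\nabla_{\overline X}\psi)$; (iii) $\{\varphi(\lambda)\mid\varphi\in\Gamma^\infty\}$ is dense in $\mathcal H(\lambda)$ for all $\lambda$. Spaces $\Gamma^n(U)$, $U\subseteq N$ open: $\nabla$ induces a connection on restrictions $\Gamma^\infty|_U$. $\Gamma^0(U)$: sections over $U$ that are locally uniform limits of sequences in $\Gamma^\infty$. $\Gamma^1(U)$: those $\varphi\in\Gamma^0(U)$ for which there is a sequence $\varphi_j\in\Gamma^\infty$ with $\varphi_j\to\varphi$ and $\nabla_X\varphi_j$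 convergent, locally uniformly on $U$, for all $X\in\operatorname{Vect}(U)$; then $\nabla_X\varphi:=\lim\nabla_X\varphi_j$. Inductively $\varphi\in\Gamma^n(U)$ if $\varphi,\nabla_X\varphi\in\Gamma^{n-1}(U)$ for all $X\in\operatorname{Vect}(U)$; $\Gamma^\infty(U)=\bigcap_n\Gamma^n(U)$. $\Gamma^n(U)$ has the topology given by the seminorms $\sup_{\lambda\in C}\|\nabla_{X_1}\cdots\nabla_{X_m}\varphi(\lambda)\|$, $C\subseteq U$ compact, $X_1,\dots,X_m\in\operatorname{Vect}(U)$, $m\le n$. A $\Gamma^\infty(U)$-smooth field of operators is a field $A=\{A(\lambda)\}_{\lambda\in U}$ of operators in $\mathcal H(\lambda)$ such that $\{\varphi(\lambda):\varphi\in\Gamma^\infty(U)\}$ is contained in the domains of $A(\lambda)$ and $A^*(\lambda)$ for every $\lambda\in U$, and $A$ and $A^*$ map $\Gamma^\infty(U)$ into itself, where $(A\varphi)(\lambda)=A(\lambda)\varphi(\lambda)$. A smooth local trivialization is a family $(U_i,\mathcal H_i,T_i)_{i\in I}$ where $\{U_i\}$ is an open cover of $N$, $\mathcal H_i$ are Hilbert spaces and $T_i(\lambda):\mathcal H(\lambda)\to\mathcal H_i$, $\lambda\in U_i$, are unitary operators such that $T_i(\Gamma^\infty(U_i))=C^\infty(U_i,\mathcal H_i)$ for each $i\in I$. *)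

theory Defs
  imports "HOL-Analysis.Analysis"
begin

section \<open>Complex Hilbert spaces on a carrier set\<close>

text \<open>The fibres of a field of Hilbert spaces vary with the base point, so a Hilbert space is
  a record and not a type class.\<close>

record 'v hilbert =
  hcarrier :: "'v set"
  hadd :: "'v \<Rightarrow> 'v \<Rightarrow> 'v"
  hzero :: "'v"
  hscale :: "complex \<Rightarrow> 'v \<Rightarrow> 'v"
  hinner :: "'v \<Rightarrow> 'v \<Rightarrow> complex"

definition hsub :: "'v hilbert \<Rightarrow> 'v \<Rightarrow> 'v \<Rightarrow> 'v" where
  "hsub V x y = hadd V x (hscale V (-1) y)"

definition hnorm :: "'v hilbert \<Rightarrow> 'v \<Rightarrow> real" where
  "hnorm V x = sqrt (Re (hinner V x x))"

text \<open>The value 0 off the carrier is there because the locale \<open>Metric_space\<close> requires symmetry and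
  nonnegativity everywhere.\<close>

definition hdist :: "'v hilbert \<Rightarrow> 'v \<Rightarrow> 'v \<Rightarrow> real" where
  "hdist V x y = (if x \<in> hcarrier V \<and> y \<in> hcarrier V then hnorm V (hsub V x y) else 0)"

definition htopology :: "'v hilbert \<Rightarrow> 'v topology" where
  "htopology V = Metric_space.mtopology (hcarrier V) (hdist V)"

locale complex_hilbert_space =
  fixes V :: "'v hilbert"
  assumes add_closed: "x \<in> hcarrier V \<Longrightarrow> y \<in> hcarrier V \<Longrightarrow> hadd V x y \<in> hcarrier V"
    and add_assoc: "x \<in> hcarrier V \<Longrightarrow> y \<in> hcarrier V \<Longrightarrow> z \<in> hcarrier V \<Longrightarrow>
          hadd V (hadd V x y) z = hadd V x (hadd V y z)"
    and add_commute: "x \<in> hcarrier V \<Longrightarrow> y \<in> hcarrier V \<Longrightarrow> hadd V x y = hadd V y x"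
    and zero_closed: "hzero V \<in> hcarrier V"
    and add_zero: "x \<in> hcarrier V \<Longrightarrow> hadd V x (hzero V) = x"
    and add_inverse: "x \<in> hcarrier V \<Longrightarrow> \<exists>y\<in>hcarrier V. hadd V x y = hzero V"
    and scale_closed: "x \<in> hcarrier V \<Longrightarrow> hscale V a x \<in> hcarrier V"
    and scale_add_right: "x \<in> hcarrier V \<Longrightarrow> y \<in> hcarrier V \<Longrightarrow>
          hscale V a (hadd V x y) = hadd V (hscale V a x) (hscale V a y)"
    and scale_add_left: "x \<in> hcarrier V \<Longrightarrow>
          hscale V (a + b) x = hadd V (hscale V a x) (hscale V b x)"
    and scale_scale: "x \<in> hcarrier V \<Longrightarrow> hscale V a (hscale V b x) = hscale V (a * b) x"
    and scale_one: "x \<in> hcarrier V \<Longrightarrow> hscale V 1 x = x"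
    and inner_add: "x \<in> hcarrier V \<Longrightarrow> y \<in> hcarrier V \<Longrightarrow> z \<in> hcarrier V \<Longrightarrow>
          hinner V (hadd V x y) z = hinner V x z + hinner V y z"
    and inner_scale: "x \<in> hcarrier V \<Longrightarrow> y \<in> hcarrier V \<Longrightarrow>
          hinner V (hscale V a x) y = a * hinner V x y"
    and inner_cnj: "x \<in> hcarrier V \<Longrightarrow> y \<in> hcarrier V \<Longrightarrow> hinner V y x = cnj (hinner V x y)"
    and inner_nonneg: "x \<in> hcarrier V \<Longrightarrow> 0 \<le> Re (hinner V x x)"
    and inner_definite: "x \<in> hcarrier V \<Longrightarrow> hinner V x x = 0 \<Longrightarrow> x = hzero V"
    and complete: "Metric_space.mcomplete (hcarrier V) (hdist V)"

definition unitary_map :: "'v hilbert \<Rightarrow> 'w hilbert \<Rightarrow> ('v \<Rightarrow> 'w) \<Rightarrow> bool" where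
  "unitary_map V W T \<longleftrightarrow>
     T ` hcarrier V = hcarrier W \<and>
     (\<forall>x\<in>hcarrier V. \<forall>y\<in>hcarrier V. T (hadd V x y) = hadd W (T x) (T y)) \<and>
     (\<forall>a. \<forall>x\<in>hcarrier V. T (hscale V a x) = hscale W a (T x)) \<and>
     (\<forall>x\<in>hcarrier V. \<forall>y\<in>hcarrier V. hinner W (T x) (T y) = hinner V x y)"

subsection \<open>Unbounded operators\<close>

record 'v operator =
  odom :: "'v set"
  oact :: "'v \<Rightarrow> 'v"

definition linear_operator :: "'v hilbert \<Rightarrow> 'v operator \<Rightarrow> bool" where
  "linear_operator V A \<longleftrightarrow>
     odom A \<subseteq> hcarrier V \<and> hzero V \<in> odom A \<and>
     (\<forall>x\<in>odom A. oact A x \<in> hcarrier V) \<and>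
     (\<forall>x\<in>odom A. \<forall>y\<in>odom A.
        hadd V x y \<in> odom A \<and> oact A (hadd V x y) = hadd V (oact A x) (oact A y)) \<and>
     (\<forall>a. \<forall>x\<in>odom A. hscale V a x \<in> odom A \<and> oact A (hscale V a x) = hscale V a (oact A x))"

text \<open>The value of the adjoint is unique when the domain of \<open>A\<close> is dense, which is the case
  wherever the adjoint is used below.\<close>

definition adjoint_operator :: "'v hilbert \<Rightarrow> 'v operator \<Rightarrow> 'v operator" where
  "adjoint_operator V A =
     \<lparr>odom = {y\<in>hcarrier V. \<exists>z\<in>hcarrier V. \<forall>x\<in>odom A. hinner V (oact A x) y = hinner V x z},
      oact = (\<lambda>y. THE z. z \<in> hcarrier V \<and> (\<forall>x\<in>odom A. hinner V (oact A x) y = hinner V x z))\<rparr>"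


section \<open>Smooth maps between vector spaces\<close>

text \<open>On an open subset of a finite-dimensional space, having continuous iterated directional
  derivatives up to order \<open>k\<close> is the usual notion of a \<open>C\<^sup>k\<close> map. The second version is for
  maps into a Hilbert space given by a record.\<close>

primrec Ck_on :: "nat \<Rightarrow> 'a::real_normed_vector set \<Rightarrow> ('a \<Rightarrow> 'b::real_normed_vector) \<Rightarrow> bool"
where
  "Ck_on 0 V f \<longleftrightarrow> continuous_on V f"
| "Ck_on (Suc k) V f \<longleftrightarrow> continuous_on V f \<and>
     (\<forall>v. \<exists>g. Ck_on k V g \<and>
        (\<forall>x\<in>V. ((\<lambda>t. f (x + t *\<^sub>R v)) has_vector_derivative g x) (at 0)))"

primrec hilbert_Ck_on ::
  "nat \<Rightarrow> 'a::real_normed_vector set \<Rightarrow> 'v hilbert \<Rightarrow> ('a \<Rightarrow> 'v) \<Rightarrow> bool"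
where
  "hilbert_Ck_on 0 V K f \<longleftrightarrow> continuous_map (top_of_set V) (htopology K) f"
| "hilbert_Ck_on (Suc k) V K f \<longleftrightarrow> continuous_map (top_of_set V) (htopology K) f \<and>
     (\<forall>v. \<exists>g. hilbert_Ck_on k V K g \<and>
        (\<forall>x\<in>V. limitin (htopology K)
           (\<lambda>t. hscale K (complex_of_real (1 / t)) (hsub K (f (x + t *\<^sub>R v)) (f x))) (g x) (at 0)))"


section \<open>Smooth manifolds\<close>

text \<open>The manifold is the whole type \<open>'n\<close>, and a chart is a pair of its domain and its
  coordinate map. The model space is a finite-dimensional real inner product space and not a
  type of class \<open>euclidean_space\<close>, because that class excludes dimension 0.\<close>

type_synonym ('n, 'e) atlas = "('n set \<times> ('n \<Rightarrow> 'e)) set"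

definition smooth_manifold ::
  "('n::{t2_space,second_countable_topology}, 'e::real_inner) atlas \<Rightarrow> bool" where
  "smooth_manifold M \<longleftrightarrow>
     (\<exists>B::'e set. finite B \<and> span B = UNIV) \<and>
     (\<Union>(D, c)\<in>M. D) = UNIV \<and>
     (\<forall>(D, c)\<in>M. open D \<and> open (c ` D) \<and> homeomorphism D (c ` D) c (inv_into D c)) \<and>
     (\<forall>(D, c)\<in>M. \<forall>(D', c')\<in>M. \<forall>k. Ck_on k (c ` (D \<inter> D')) (c' \<circ> inv_into D c))"

text \<open>\<open>C\<^sup>\<infinity>(U)\<close>; the values outside \<open>U\<close> of its members are immaterial.\<close>

definition Cinf :: "('n, 'e::real_inner) atlas \<Rightarrow> 'n set \<Rightarrow> ('n \<Rightarrow> complex) set" where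
  "Cinf M U = {f. \<forall>(D, c)\<in>M. \<forall>k. Ck_on k (c ` (D \<inter> U)) (f \<circ> inv_into D c)}"

definition hilbert_Cinf ::
  "('n, 'e::real_inner) atlas \<Rightarrow> 'n set \<Rightarrow> 'v hilbert \<Rightarrow> ('n \<Rightarrow> 'v) set" where
  "hilbert_Cinf M U K = {f \<in> U \<rightarrow>\<^sub>E hcarrier K.
     \<forall>(D, c)\<in>M. \<forall>k. hilbert_Ck_on k (c ` (D \<inter> U)) K (f \<circ> inv_into D c)}"

text \<open>Elements of the complexified tangent space at \<open>x\<close> are the complex-linear derivations at \<open>x\<close>
  of the algebra of smooth complex functions. So that a tangent vector and a vector field on \<open>U\<close>
  have only one representation, tangent vectors are 0 on non-smooth functions and vector fields
  are 0 outside \<open>U\<close>.\<close>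

type_synonym 'n vfield = "'n \<Rightarrow> ('n \<Rightarrow> complex) \<Rightarrow> complex"

definition ctangent ::
  "('n, 'e::real_inner) atlas \<Rightarrow> 'n \<Rightarrow> (('n \<Rightarrow> complex) \<Rightarrow> complex) set" where
  "ctangent M x = {v.
     (\<forall>f\<in>Cinf M UNIV. \<forall>g\<in>Cinf M UNIV. v (\<lambda>y. f y + g y) = v f + v g) \<and>
     (\<forall>a. \<forall>f\<in>Cinf M UNIV. v (\<lambda>y. a * f y) = a * v f) \<and>
     (\<forall>f\<in>Cinf M UNIV. \<forall>g\<in>Cinf M UNIV. v (\<lambda>y. f y * g y) = f x * v g + g x * v f) \<and>
     (\<forall>f. f \<notin> Cinf M UNIV \<longrightarrow> v f = 0)}"

definition Vect :: "('n, 'e::real_inner) atlas \<Rightarrow> 'n set \<Rightarrow> 'n vfield set" where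
  "Vect M U = {X.
     (\<forall>x\<in>U. X x \<in> ctangent M x) \<and>
     (\<forall>x. x \<notin> U \<longrightarrow> X x = (\<lambda>f. 0)) \<and>
     (\<forall>f\<in>Cinf M UNIV. (\<lambda>x. X x f) \<in> Cinf M U)}"

definition vf_add :: "'n vfield \<Rightarrow> 'n vfield \<Rightarrow> 'n vfield" where
  "vf_add X Y = (\<lambda>x f. X x f + Y x f)"

definition vf_scale :: "('n \<Rightarrow> complex) \<Rightarrow> 'n vfield \<Rightarrow> 'n vfield" where
  "vf_scale a X = (\<lambda>x f. a x * X x f)"

definition vf_cnj :: "'n vfield \<Rightarrow> 'n vfield" where
  "vf_cnj X = (\<lambda>x f. cnj (X x (\<lambda>y. cnj (f y))))"


section \<open>Smooth fields of Hilbert spaces\<close>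

text \<open>The total space \<open>H\<close> is the whole type \<open>'h\<close>.\<close>

record ('n, 'h) hilbert_field =
  proj :: "'h \<Rightarrow> 'n"
  fibre :: "'n \<Rightarrow> 'h hilbert"
  smooth_sections :: "('n \<Rightarrow> 'h) set"
  nabla :: "'n vfield \<Rightarrow> ('n \<Rightarrow> 'h) \<Rightarrow> ('n \<Rightarrow> 'h)"

definition field_of_hilbert_spaces :: "('n, 'h) hilbert_field \<Rightarrow> bool" where
  "field_of_hilbert_spaces F \<longleftrightarrow> surj (proj F) \<and>
     (\<forall>x. hcarrier (fibre F x) = proj F -` {x} \<and> complex_hilbert_space (fibre F x))"

definition sections :: "('n, 'h) hilbert_field \<Rightarrow> 'n set \<Rightarrow> ('n \<Rightarrow> 'h) set" where
  "sections F U = (\<Pi>\<^sub>E x\<in>U. hcarrier (fibre F x))"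

definition sec_add ::
  "('n, 'h) hilbert_field \<Rightarrow> 'n set \<Rightarrow> ('n \<Rightarrow> 'h) \<Rightarrow> ('n \<Rightarrow> 'h) \<Rightarrow> ('n \<Rightarrow> 'h)" where
  "sec_add F U \<phi> \<psi> = (\<lambda>x\<in>U. hadd (fibre F x) (\<phi> x) (\<psi> x))"

definition sec_sub ::
  "('n, 'h) hilbert_field \<Rightarrow> 'n set \<Rightarrow> ('n \<Rightarrow> 'h) \<Rightarrow> ('n \<Rightarrow> 'h) \<Rightarrow> ('n \<Rightarrow> 'h)" where
  "sec_sub F U \<phi> \<psi> = (\<lambda>x\<in>U. hsub (fibre F x) (\<phi> x) (\<psi> x))"

definition sec_scale ::
  "('n, 'h) hilbert_field \<Rightarrow> 'n set \<Rightarrow> ('n \<Rightarrow> complex) \<Rightarrow> ('n \<Rightarrow> 'h) \<Rightarrow> ('n \<Rightarrow> 'h)" where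
  "sec_scale F U a \<phi> = (\<lambda>x\<in>U. hscale (fibre F x) (a x) (\<phi> x))"

definition sec_inner ::
  "('n, 'h) hilbert_field \<Rightarrow> ('n \<Rightarrow> 'h) \<Rightarrow> ('n \<Rightarrow> 'h) \<Rightarrow> ('n \<Rightarrow> complex)" where
  "sec_inner F \<phi> \<psi> = (\<lambda>x. hinner (fibre F x) (\<phi> x) (\<psi> x))"

definition smooth_hilbert_field ::
  "('n, 'e::real_inner) atlas \<Rightarrow> ('n, 'h) hilbert_field \<Rightarrow> bool" where
  "smooth_hilbert_field M F \<longleftrightarrow>
     field_of_hilbert_spaces F \<and>
     smooth_sections F \<subseteq> sections F UNIV \<and>
     (\<forall>\<phi>\<in>smooth_sections F. \<forall>\<psi>\<in>smooth_sections F. sec_add F UNIV \<phi> \<psi> \<in> smooth_sections F) \<and>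
     (\<forall>a\<in>Cinf M UNIV. \<forall>\<phi>\<in>smooth_sections F. sec_scale F UNIV a \<phi> \<in> smooth_sections F) \<and>
     (\<forall>X\<in>Vect M UNIV. \<forall>\<phi>\<in>smooth_sections F. nabla F X \<phi> \<in> smooth_sections F) \<and>
     (\<forall>X\<in>Vect M UNIV. \<forall>Y\<in>Vect M UNIV. \<forall>\<phi>\<in>smooth_sections F.
        nabla F (vf_add X Y) \<phi> = sec_add F UNIV (nabla F X \<phi>) (nabla F Y \<phi>)) \<and>
     (\<forall>a\<in>Cinf M UNIV. \<forall>X\<in>Vect M UNIV. \<forall>\<phi>\<in>smooth_sections F.
        nabla F (vf_scale a X) \<phi> = sec_scale F UNIV a (nabla F X \<phi>)) \<and>
     (\<forall>a\<in>Cinf M UNIV. \<forall>X\<in>Vect M UNIV. \<forall>\<phi>\<in>smooth_sections F.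
        nabla F X (sec_scale F UNIV a \<phi>) =
          sec_add F UNIV (sec_scale F UNIV (\<lambda>x. X x a) \<phi>) (sec_scale F UNIV a (nabla F X \<phi>))) \<and>
     (\<forall>\<phi>\<in>smooth_sections F. \<forall>\<psi>\<in>smooth_sections F. sec_inner F \<phi> \<psi> \<in> Cinf M UNIV) \<and>
     (\<forall>X\<in>Vect M UNIV. \<forall>\<phi>\<in>smooth_sections F. \<forall>\<psi>\<in>smooth_sections F. \<forall>x.
        X x (sec_inner F \<phi> \<psi>) =
          sec_inner F (nabla F X \<phi>) \<psi> x + sec_inner F \<phi> (nabla F (vf_cnj X) \<psi>) x) \<and>
     (\<forall>x. htopology (fibre F x) closure_of ((\<lambda>\<phi>. \<phi> x) ` smooth_sections F) = hcarrier (fibre F x))"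

subsection \<open>The spaces \<open>\<Gamma>\<^sup>n(U)\<close>\<close>

text \<open>The connection induced on restrictions to \<open>U\<close> of smooth sections. The value at \<open>x\<close> does not
  depend on the chosen global vector field, since \<open>nabla\<close> is linear over smooth functions in the
  vector field.\<close>

definition nabla_restr ::
  "('n, 'e::real_inner) atlas \<Rightarrow> ('n, 'h) hilbert_field \<Rightarrow> 'n set \<Rightarrow> 'n vfield \<Rightarrow>
     ('n \<Rightarrow> 'h) \<Rightarrow> ('n \<Rightarrow> 'h)" where
  "nabla_restr M F U X \<phi> = (\<lambda>x\<in>U. nabla F (SOME Y. Y \<in> Vect M UNIV \<and> Y x = X x) \<phi> x)"

definition loc_unif_conv ::
  "('n::topological_space, 'h) hilbert_field \<Rightarrow> 'n set \<Rightarrow> (nat \<Rightarrow> 'n \<Rightarrow> 'h) \<Rightarrow> ('n \<Rightarrow> 'h) \<Rightarrow> bool"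
where
  "loc_unif_conv F U s \<phi> \<longleftrightarrow>
     (\<forall>x\<in>U. \<exists>W. open W \<and> x \<in> W \<and> W \<subseteq> U \<and>
        uniform_limit W (\<lambda>j y. hdist (fibre F y) (s j y) (\<phi> y)) (\<lambda>y. 0) sequentially)"

definition Gamma0 :: "('n::topological_space, 'h) hilbert_field \<Rightarrow> 'n set \<Rightarrow> ('n \<Rightarrow> 'h) set" where
  "Gamma0 F U = {\<phi> \<in> sections F U.
     \<exists>s. (\<forall>j. s j \<in> smooth_sections F) \<and> loc_unif_conv F U s \<phi>}"

definition C1_approx ::
  "('n::topological_space, 'e::real_inner) atlas \<Rightarrow> ('n, 'h) hilbert_field \<Rightarrow> 'n set \<Rightarrow>
     (nat \<Rightarrow> 'n \<Rightarrow> 'h) \<Rightarrow> ('n \<Rightarrow> 'h) \<Rightarrow> bool" where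
  "C1_approx M F U s \<phi> \<longleftrightarrow>
     (\<forall>j. s j \<in> smooth_sections F) \<and> loc_unif_conv F U s \<phi> \<and>
     (\<forall>X\<in>Vect M U. \<exists>\<omega>\<in>sections F U. loc_unif_conv F U (\<lambda>j. nabla_restr M F U X (s j)) \<omega>)"

text \<open>The limit does not depend on the approximating sequence, because of the compatibility of
  \<open>nabla\<close> with the inner products and the density of the smooth sections.\<close>

definition nabla_on ::
  "('n::topological_space, 'e::real_inner) atlas \<Rightarrow> ('n, 'h) hilbert_field \<Rightarrow> 'n set \<Rightarrow>
     'n vfield \<Rightarrow> ('n \<Rightarrow> 'h) \<Rightarrow> ('n \<Rightarrow> 'h)" where
  "nabla_on M F U X \<phi> = (\<lambda>x\<in>U. THE v. \<exists>s. C1_approx M F U s \<phi> \<and>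
     limitin (htopology (fibre F x)) (\<lambda>j. nabla_restr M F U X (s j) x) v sequentially)"

fun Gamma ::
  "('n::topological_space, 'e::real_inner) atlas \<Rightarrow> ('n, 'h) hilbert_field \<Rightarrow> 'n set \<Rightarrow> nat \<Rightarrow>
     ('n \<Rightarrow> 'h) set" where
  "Gamma M F U 0 = Gamma0 F U"
| "Gamma M F U (Suc 0) = {\<phi> \<in> Gamma0 F U. \<exists>s. C1_approx M F U s \<phi>}"
| "Gamma M F U (Suc (Suc n)) = {\<phi> \<in> Gamma M F U (Suc n).
     \<forall>X\<in>Vect M U. nabla_on M F U X \<phi> \<in> Gamma M F U (Suc n)}"

definition Gamma_inf ::
  "('n::topological_space, 'e::real_inner) atlas \<Rightarrow> ('n, 'h) hilbert_field \<Rightarrow> 'n set \<Rightarrow>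
     ('n \<Rightarrow> 'h) set" where
  "Gamma_inf M F U = (\<Inter>n. Gamma M F U n)"

text \<open>The supremum over \<open>C\<close>; inserting 0 only matters when \<open>C\<close> is empty.\<close>

definition Gamma_seminorm ::
  "('n::topological_space, 'e::real_inner) atlas \<Rightarrow> ('n, 'h) hilbert_field \<Rightarrow> 'n set \<Rightarrow>
     'n set \<Rightarrow> 'n vfield list \<Rightarrow> ('n \<Rightarrow> 'h) \<Rightarrow> real" where
  "Gamma_seminorm M F U C Xs \<phi> =
     Sup (insert 0 ((\<lambda>x. hnorm (fibre F x) (foldr (nabla_on M F U) Xs \<phi> x)) ` C))"

definition Gamma_topology ::
  "('n::topological_space, 'e::real_inner) atlas \<Rightarrow> ('n, 'h) hilbert_field \<Rightarrow> 'n set \<Rightarrow> nat \<Rightarrow>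
     ('n \<Rightarrow> 'h) topology" where
  "Gamma_topology M F U n = topology_generated_by
     {{\<psi> \<in> Gamma M F U n. Gamma_seminorm M F U C Xs (sec_sub F U \<psi> \<phi>) < e} | \<phi> C Xs e.
        \<phi> \<in> Gamma M F U n \<and> compact C \<and> C \<subseteq> U \<and> set Xs \<subseteq> Vect M U \<and> length Xs \<le> n \<and> 0 < e}"

subsection \<open>Smooth fields of operators and local trivializations\<close>

definition op_apply :: "'n set \<Rightarrow> ('n \<Rightarrow> 'h operator) \<Rightarrow> ('n \<Rightarrow> 'h) \<Rightarrow> ('n \<Rightarrow> 'h)" where
  "op_apply U A \<phi> = (\<lambda>x\<in>U. oact (A x) (\<phi> x))"

definition smooth_operator_field ::
  "('n::topological_space, 'e::real_inner) atlas \<Rightarrow> ('n, 'h) hilbert_field \<Rightarrow> 'n set \<Rightarrow>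
     ('n \<Rightarrow> 'h operator) \<Rightarrow> bool" where
  "smooth_operator_field M F U A \<longleftrightarrow>
     (\<forall>x\<in>U. linear_operator (fibre F x) (A x)) \<and>
     (\<forall>x\<in>U. \<forall>\<phi>\<in>Gamma_inf M F U.
        \<phi> x \<in> odom (A x) \<and> \<phi> x \<in> odom (adjoint_operator (fibre F x) (A x))) \<and>
     (\<forall>\<phi>\<in>Gamma_inf M F U. op_apply U A \<phi> \<in> Gamma_inf M F U \<and>
        op_apply U (\<lambda>x. adjoint_operator (fibre F x) (A x)) \<phi> \<in> Gamma_inf M F U)"

definition smooth_local_trivialization ::
  "('n::topological_space, 'e::real_inner) atlas \<Rightarrow> ('n, 'h) hilbert_field \<Rightarrow> 'i set \<Rightarrow>
     ('i \<Rightarrow> 'n set) \<Rightarrow> ('i \<Rightarrow> 'k hilbert) \<Rightarrow> ('i \<Rightarrow> 'n \<Rightarrow> 'h \<Rightarrow> 'k) \<Rightarrow> bool" where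
  "smooth_local_trivialization M F I U K T \<longleftrightarrow>
     (\<forall>i\<in>I. open (U i)) \<and> (\<Union>i\<in>I. U i) = UNIV \<and>
     (\<forall>i\<in>I. complex_hilbert_space (K i)) \<and>
     (\<forall>i\<in>I. \<forall>x\<in>U i. unitary_map (fibre F x) (K i) (T i x)) \<and>
     (\<forall>i\<in>I. (\<lambda>\<phi>. \<lambda>x\<in>U i. T i x (\<phi> x)) ` Gamma_inf M F (U i) = hilbert_Cinf M (U i) (K i))"

text \<open>Unitarity makes \<open>K i\<close> isomorphic to the fibres over \<open>U i\<close>, and a cover can be reindexed by
  the points of the base, so fixing the types \<open>'h\<close> and \<open>'n\<close> for the model spaces and the index set
  loses no generality.\<close>

definition admits_smooth_local_trivialization ::
  "('n::topological_space, 'e::real_inner) atlas \<Rightarrow> ('n, 'h) hilbert_field \<Rightarrow> bool" where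
  "admits_smooth_local_trivialization M F \<longleftrightarrow>
     (\<exists>(I :: 'n set) U (K :: 'n \<Rightarrow> 'h hilbert) T. smooth_local_trivialization M F I U K T)"

end

theory Submission
  imports Defs "HOL-Computational_Algebra.Polynomial" "HOL-Probability.Discrete_Topology"
begin

text \<open>
  The operators \<open>A(X)\<close> turn the given connection \<open>\<nabla>\<close> into a second
  one, \<open>\<nabla> - A\<close>, which by assumption has a parallel (horizontal) section through
  every point. Since the operators are skew, the inner product of two horizontal sections has
  derivative 0 and is constant on a coordinate ball \<open>V\<close>. Parallel transport to the
  centre of the ball is therefore well defined and unitary (\<open>T_Hor\<close>,
  \<open>T_unitary\<close>). This is the trivialization. What has to be shown is that it maps
  \<open>\<Gamma>\<^sup>\<infinity>(V)\<close> onto the smooth maps from \<open>V\<close> to the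
  fibre \<open>K\<close> at the centre (\<open>trivializes\<close>).

  In the trivialization \<open>\<nabla>\<close> becomes \<open>\<partial> + A\<close>, where the
  \<open>A(v)\<close> along the coordinate fields are families of operators on \<open>K\<close>.
  Each of these operators is skew and defined everywhere, because a horizontal section passes
  through every point and its values lie in the domain. So the uniform boundedness principle bounds
  them uniformly on compact sets (\<open>skew_uniformly_bounded\<close>), and the same holds for all
  derivatives of the family, which are skew and everywhere defined as well. Hence if
  \<open>A(v)u\<close> is \<open>C\<^sup>n\<close> for every fixed vector \<open>u\<close>, then
  \<open>A(v)f\<close> is \<open>C\<^sup>n\<close> for every \<open>C\<^sup>n\<close> map
  \<open>f\<close> (\<open>Ck_on_apply_family\<close>).

  Smooth sections give smooth maps (\<open>Gamma_tr_Ck\<close>): pairing with horizontal sections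
  shows that \<open>\<partial>\<phi> = \<nabla>\<phi> - A\<phi>\<close>, first weakly and then, the
  right-hand side being continuous, in norm. This is iterated, where the smoothness of order
  \<open>n\<close> of \<open>A(v)u\<close> comes from the induction hypothesis for the section
  \<open>A(v)\<psi>\<close> with \<open>\<psi>\<close> horizontal.

  Smooth maps \<open>f\<close> come from smooth sections (\<open>lift_Gamma\<close>): since
  \<open>\<nabla>f = \<partial>f + Af\<close> is again a smooth map, induction leaves only
  \<open>\<Gamma>\<^sup>1\<close>, that is, the approximation of \<open>f\<close> by global smooth
  sections together with the first covariant derivatives (\<open>approximable_smooth\<close>).
  Orthogonal projections of finite rank reduce this to maps with values in a line, which are
  multiples of horizontal sections.

  Two devices keep the analysis elementary. The fibres are Hilbert spaces on carrier sets, and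
  \<open>embed\<close> maps \<open>K\<close> isometrically to a closed subspace of a Banach space,
  where the calculus of vector-valued functions is available. Vector fields are derivations of the
  algebra of global smooth functions; Hadamard's lemma expresses them through cut-off coordinate
  fields (\<open>ctangent_expansion\<close>), which makes the connection tensorial
  (\<open>nabla_expansion\<close>) and the derivatives of limit sections unique
  (\<open>C1_lim_unique\<close>).
\<close>

section \<open>Iterated directional derivatives\<close>

abbreviation has_ddir ::
  "('a::real_normed_vector \<Rightarrow> 'b::real_normed_vector) \<Rightarrow> 'a \<Rightarrow> 'b \<Rightarrow> 'a \<Rightarrow> bool" where
  "has_ddir f v g x \<equiv> ((\<lambda>t. f (x + t *\<^sub>R v)) has_vector_derivative g) (at 0)"

text \<open>The directional derivative, where it exists; it serves as a canonical choice of the functions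
  \<open>g\<close> whose existence \<^const>\<open>Ck_on\<close> asks for.\<close>

definition ddir ::
  "('a::real_normed_vector \<Rightarrow> 'b::real_normed_vector) \<Rightarrow> 'a \<Rightarrow> 'a \<Rightarrow> 'b" where
  "ddir f v x = vector_derivative (\<lambda>t. f (x + t *\<^sub>R v)) (at 0)"

lemma has_ddir_imp_ddir: "has_ddir f v g x \<Longrightarrow> ddir f v x = g"
  unfolding ddir_def by (rule vector_derivative_at)

lemma has_ddir_unique: "has_ddir f v g x \<Longrightarrow> has_ddir f v g' x \<Longrightarrow> g = g'"
  by (metis has_ddir_imp_ddir)

lemma eventually_line_in_open:
  fixes x v :: "'a::real_normed_vector"
  assumes "open V" "x \<in> V"
  shows "eventually (\<lambda>t. x + t *\<^sub>R v \<in> V) (nhds (0::real))"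
proof -
  have "((\<lambda>t. x + t *\<^sub>R v) \<longlongrightarrow> x + 0 *\<^sub>R v) (nhds (0::real))"
    by (intro tendsto_intros filterlim_ident)
  then show ?thesis using assms by (auto simp: tendsto_def)
qed

lemma line_in_open:
  fixes x v :: "'a::real_normed_vector"
  assumes "open V" "x \<in> V"
  obtains d where "d > 0" "\<And>t. \<bar>t\<bar> \<le> d \<Longrightarrow> x + t *\<^sub>R v \<in> V"
proof -
  obtain d where "d > 0" "\<forall>t. dist t 0 < d \<longrightarrow> x + t *\<^sub>R v \<in> V"
    using eventually_line_in_open[OF assms, of v] unfolding eventually_nhds_metric by blast
  then show ?thesis by (intro that[of "d/2"]) auto
qed

lemma has_ddir_cong:
  assumes "open V" "x \<in> V" "\<And>y. y \<in> V \<Longrightarrow> f y = g y"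
  shows "has_ddir f v d x \<longleftrightarrow> has_ddir g v d x"
proof (rule has_vector_derivative_cong_ev)
  show "\<forall>\<^sub>F t in nhds 0. t \<in> UNIV \<longrightarrow> f (x + t *\<^sub>R v) = g (x + t *\<^sub>R v)"
    using eventually_line_in_open[OF assms(1,2), of v] by eventually_elim (use assms in auto)
qed (use assms in auto)

lemma has_ddir_line:
  assumes "has_ddir f v g (x + s *\<^sub>R v)"
  shows "((\<lambda>t. f (x + t *\<^sub>R v)) has_vector_derivative g) (at s within S)"
proof -
  have "((\<lambda>t. f (x + s *\<^sub>R v + t *\<^sub>R v)) \<circ> (\<lambda>t. t - s) has_vector_derivative (1::real) *\<^sub>R g) (at s)"
    by (rule vector_diff_chain_at) (auto intro!: derivative_eq_intros assms)
  then have "((\<lambda>t. f (x + t *\<^sub>R v)) has_vector_derivative g) (at s)"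
    by (simp add: o_def scaleR_diff_left)
  then show ?thesis by (rule has_vector_derivative_at_within)
qed

lemma Ck_on_continuous: "Ck_on k V f \<Longrightarrow> continuous_on V f"
  by (cases k) auto

lemma Ck_on_cong:
  assumes "open V" "\<And>x. x \<in> V \<Longrightarrow> f x = g x"
  shows "Ck_on k V f \<longleftrightarrow> Ck_on k V g"
proof (cases k)
  case 0 then show ?thesis using assms by (simp cong: continuous_on_cong)
next
  case (Suc k')
  have "continuous_on V f = continuous_on V g" using assms by (simp cong: continuous_on_cong)
  then show ?thesis unfolding Suc Ck_on.simps using has_ddir_cong[OF assms(1), of _ f g] assms(2) by metis
qed

lemma Ck_on_Suc_iff:
  assumes "open V"
  shows "Ck_on (Suc k) V f \<longleftrightarrow> continuous_on V f \<and>
    (\<forall>v. Ck_on k V (ddir f v) \<and> (\<forall>x\<in>V. has_ddir f v (ddir f v x) x))" (is "_ = ?R")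
proof
  assume L: "Ck_on (Suc k) V f"
  have "Ck_on k V (ddir f v) \<and> (\<forall>x\<in>V. has_ddir f v (ddir f v x) x)" for v
  proof -
    obtain g where g: "Ck_on k V g" "\<forall>x\<in>V. has_ddir f v (g x) x" using L by auto
    then have "\<forall>x\<in>V. ddir f v x = g x" by (auto simp: has_ddir_imp_ddir)
    with g show ?thesis using Ck_on_cong[OF assms, of g "ddir f v" k] by auto
  qed
  with L show ?R by auto
next
  assume ?R then show "Ck_on (Suc k) V f" by auto
qed

lemma Ck_on_SucI:
  assumes "continuous_on V f" "\<And>v. Ck_on k V (g v)" "\<And>v x. x \<in> V \<Longrightarrow> has_ddir f v (g v x) x"
  shows "Ck_on (Suc k) V f"
  using assms by auto

lemma Ck_on_SucE:
  assumes "Ck_on (Suc k) V f"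
  obtains g where "\<And>v. Ck_on k V (g v)" "\<And>v x. x \<in> V \<Longrightarrow> has_ddir f v (g v x) x"
  using assms unfolding Ck_on.simps by metis

lemma Ck_on_SucD: "Ck_on (Suc k) V f \<Longrightarrow> Ck_on k V f"
proof (induction k arbitrary: f)
  case (Suc k)
  have "\<exists>g. Ck_on k V g \<and> (\<forall>x\<in>V. has_ddir f v (g x) x)" for v
  proof -
    obtain g where "Ck_on (Suc k) V g" "\<forall>x\<in>V. has_ddir f v (g x) x"
      using Suc.prems unfolding Ck_on.simps(2)[of "Suc k"] by blast
    then show ?thesis using Suc.IH by blast
  qed
  then show ?case using Suc.prems Ck_on_continuous unfolding Ck_on.simps(2) by blast
qed auto

lemma Ck_on_subset: "Ck_on k V f \<Longrightarrow> W \<subseteq> V \<Longrightarrow> Ck_on k W f"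
proof (induction k arbitrary: f)
  case (Suc k)
  then show ?case unfolding Ck_on.simps
    by (meson continuous_on_subset subsetD)
qed (auto intro: continuous_on_subset)

text \<open>Differentiability of every order is a local property. On an open set the derivatives chosen near
  different points agree, since each equals \<^const>\<open>ddir\<close>.\<close>

lemma Ck_on_local:
  assumes "open V" "\<And>x. x \<in> V \<Longrightarrow> \<exists>W. open W \<and> x \<in> W \<and> Ck_on k (W \<inter> V) f"
  shows "Ck_on k V f"
  using assms(2)
proof (induction k arbitrary: f)
  case 0
  show ?case unfolding Ck_on.simps continuous_on_eq_continuous_at[OF assms(1)]
  proof
    fix x assume "x \<in> V"
    then obtain W where W: "open W" "x \<in> W" "Ck_on 0 (W \<inter> V) f" using 0 by blast
    then show "isCont f x" using \<open>x \<in> V\<close> assms(1)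
      by (metis Ck_on.simps(1) IntI continuous_on_eq_continuous_at open_Int)
  qed
next
  case (Suc k)
  have loc: "\<exists>W. open W \<and> x \<in> W \<and> continuous_on (W \<inter> V) f \<and>
      (\<forall>v. Ck_on k (W \<inter> V) (ddir f v) \<and> (\<forall>y\<in>W \<inter> V. has_ddir f v (ddir f v y) y))"
    if "x \<in> V" for x
    using Suc.prems[OF that] Ck_on_Suc_iff[OF open_Int[OF _ assms(1)]] by metis
  have "continuous_on V f" unfolding continuous_on_eq_continuous_at[OF assms(1)]
    using loc assms(1) by (metis IntI continuous_on_eq_continuous_at open_Int)
  moreover have "Ck_on k V (ddir f v)" for v by (rule Suc.IH) (use loc in blast)
  moreover have "\<forall>x\<in>V. has_ddir f v (ddir f v x) x" for v using loc by blast
  ultimately show ?case using Ck_on_Suc_iff[OF assms(1)] by blast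
qed

lemma Ck_on_const: "Ck_on k V (\<lambda>x. a)"
proof (induction k arbitrary: a)
  case (Suc k)
  show ?case by (rule Ck_on_SucI[where g="\<lambda>v x. 0"]) (auto intro: Suc)
qed auto

lemma has_ddir_add: "has_ddir f v a x \<Longrightarrow> has_ddir g v b x \<Longrightarrow> has_ddir (\<lambda>x. f x + g x) v (a + b) x"
  by (rule has_vector_derivative_add)

lemma Ck_on_add: "Ck_on k V f \<Longrightarrow> Ck_on k V g \<Longrightarrow> Ck_on k V (\<lambda>x. f x + g x)"
proof (induction k arbitrary: f g)
  case (Suc k)
  obtain f' where f': "\<And>v. Ck_on k V (f' v)" "\<And>v x. x \<in> V \<Longrightarrow> has_ddir f v (f' v x) x"
    using Suc.prems(1) by (rule Ck_on_SucE) (rule that)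
  obtain g' where g': "\<And>v. Ck_on k V (g' v)" "\<And>v x. x \<in> V \<Longrightarrow> has_ddir g v (g' v x) x"
    using Suc.prems(2) by (rule Ck_on_SucE) (rule that)
  show ?case
    by (rule Ck_on_SucI[where g="\<lambda>v x. f' v x + g' v x"])
      (use Suc Ck_on_continuous f' g' in \<open>auto intro!: continuous_intros has_ddir_add\<close>)
qed (auto intro: continuous_intros)

lemma has_ddir_linear:
  assumes "bounded_linear h" "has_ddir f v a x"
  shows "has_ddir (\<lambda>x. h (f x)) v (h a) x"
  using bounded_linear.has_vector_derivative[OF assms] .

lemma Ck_on_linear:
  assumes "bounded_linear h" "Ck_on k V f"
  shows "Ck_on k V (\<lambda>x. h (f x))"
  using assms(2)
proof (induction k arbitrary: f)
  case 0 then show ?case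
    using linear_continuous_on[OF assms(1)] by (auto intro: continuous_on_compose2)
next
  case (Suc k)
  obtain f' where f': "\<And>v. Ck_on k V (f' v)" "\<And>v x. x \<in> V \<Longrightarrow> has_ddir f v (f' v x) x"
    using Suc.prems by (rule Ck_on_SucE) (rule that)
  have c: "continuous_on V (\<lambda>x. h (f x))"
    using linear_continuous_on[OF assms(1)] Suc.prems by (auto intro: continuous_on_compose2)
  show ?case
    by (rule Ck_on_SucI[OF c Suc.IH[OF f'(1)] has_ddir_linear[OF assms(1) f'(2)]])
qed

lemma has_ddir_bilinear:
  assumes "bounded_bilinear h" "has_ddir f v a x" "has_ddir g v b x"
  shows "has_ddir (\<lambda>x. h (f x) (g x)) v (h (f x) b + h a (g x)) x"
proof -
  have "((\<lambda>t. h (f (x + t *\<^sub>R v)) (g (x + t *\<^sub>R v))) has_derivative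
      (\<lambda>s. h (f (x + 0 *\<^sub>R v)) (s *\<^sub>R b) + h (s *\<^sub>R a) (g (x + 0 *\<^sub>R v)))) (at 0)"
    using bounded_bilinear.FDERIV[OF assms(1)] assms(2,3) unfolding has_vector_derivative_def
    by blast
  then show ?thesis unfolding has_vector_derivative_def
    by (simp add: bounded_bilinear.scaleR_left[OF assms(1)] bounded_bilinear.scaleR_right[OF assms(1)]
        scaleR_add_right)
qed

lemma Ck_on_bilinear:
  assumes "bounded_bilinear h" "Ck_on k V f" "Ck_on k V g"
  shows "Ck_on k V (\<lambda>x. h (f x) (g x))"
  using assms(2,3)
proof (induction k arbitrary: f g)
  case 0 then show ?case using bounded_bilinear.continuous_on[OF assms(1)] by auto
next
  case (Suc k)
  obtain f' where f': "\<And>v. Ck_on k V (f' v)" "\<And>v x. x \<in> V \<Longrightarrow> has_ddir f v (f' v x) x"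
    using Suc.prems(1) by (rule Ck_on_SucE) (rule that)
  obtain g' where g': "\<And>v. Ck_on k V (g' v)" "\<And>v x. x \<in> V \<Longrightarrow> has_ddir g v (g' v x) x"
    using Suc.prems(2) by (rule Ck_on_SucE) (rule that)
  have c: "continuous_on V (\<lambda>x. h (f x) (g x))"
    using bounded_bilinear.continuous_on[OF assms(1)] Suc.prems by auto
  note fg = Suc.prems[THEN Ck_on_SucD]
  have 1: "Ck_on k V (\<lambda>x. h (f x) (g' v x) + h (f' v x) (g x))" for v
    by (intro Ck_on_add Suc.IH fg f' g')
  have 2: "has_ddir (\<lambda>x. h (f x) (g x)) v (h (f x) (g' v x) + h (f' v x) (g x)) x" if "x \<in> V" for v x
    by (intro has_ddir_bilinear assms(1) f' g' that)
  show ?case by (rule Ck_on_SucI[OF c 1 2])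
qed

lemma Ck_on_sum:
  "finite I \<Longrightarrow> (\<And>i. i \<in> I \<Longrightarrow> Ck_on k V (f i)) \<Longrightarrow> Ck_on k V (\<lambda>x. \<Sum>i\<in>I. f i x)"
  by (induction I rule: finite_induct) (auto intro: Ck_on_const Ck_on_add)

lemma Ck_on_scale: "Ck_on k V f \<Longrightarrow> Ck_on k V g \<Longrightarrow> Ck_on k V (\<lambda>x. f x *\<^sub>R g x)"
  by (rule Ck_on_bilinear[OF bounded_bilinear_scaleR])

lemma Ck_on_mult:
  fixes f g :: "_ \<Rightarrow> _::real_normed_algebra"
  shows "Ck_on k V f \<Longrightarrow> Ck_on k V g \<Longrightarrow> Ck_on k V (\<lambda>x. f x * g x)"
  by (rule Ck_on_bilinear[OF bounded_bilinear_mult])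

lemma Ck_on_of_real: "Ck_on k V f \<Longrightarrow> Ck_on k V (\<lambda>x. complex_of_real (f x))"
  by (rule Ck_on_linear[OF bounded_linear_of_real])

lemma has_ddir_ident: "has_ddir (\<lambda>x. x) v v x"
  by (auto intro!: derivative_eq_intros simp: has_vector_derivative_def)

lemma Ck_on_ident: "Ck_on k V (\<lambda>x. x)"
proof (cases k)
  case (Suc k')
  show ?thesis unfolding Suc
    by (rule Ck_on_SucI[where g="\<lambda>v x. v"]) (auto intro: Ck_on_const has_ddir_ident)
qed auto

lemma Ck_on_inverse:
  fixes f :: "'a::real_normed_vector \<Rightarrow> real"
  assumes "\<And>x. x \<in> V \<Longrightarrow> f x \<noteq> 0" "Ck_on k V f"
  shows "Ck_on k V (\<lambda>x. inverse (f x))"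
  using assms(2)
proof (induction k)
  case 0 then show ?case using assms(1) by (auto intro: continuous_intros)
next
  case (Suc k)
  obtain f' where f': "\<And>v. Ck_on k V (f' v)" "\<And>v x. x \<in> V \<Longrightarrow> has_ddir f v (f' v x) x"
    using Suc.prems by (rule Ck_on_SucE) (rule that)
  have c: "continuous_on V (\<lambda>x. inverse (f x))"
    using assms(1) Suc.prems by (auto intro: continuous_intros)
  note IH = Suc.IH[OF Ck_on_SucD[OF Suc.prems]]
  have 1: "Ck_on k V (\<lambda>x. (-1) * (inverse (f x) * (f' v x * inverse (f x))))" for v
    by (intro Ck_on_mult Ck_on_const IH f')
  have 2: "has_ddir (\<lambda>x. inverse (f x)) v ((-1) * (inverse (f x) * (f' v x * inverse (f x)))) x"
    if "x \<in> V" for v x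
  proof -
    have "((\<lambda>t. f (x + t *\<^sub>R v)) has_real_derivative f' v x) (at 0)"
      using f'(2)[OF that] by (simp add: has_real_derivative_iff_has_vector_derivative)
    from DERIV_inverse_fun[OF this] show ?thesis using assms(1)[OF that]
      by (simp add: has_real_derivative_iff_has_vector_derivative[symmetric] power2_eq_square divide_inverse mult_ac)
  qed
  show ?case by (rule Ck_on_SucI[OF c 1 2])
qed

section \<open>Flat functions and bump functions\<close>

text \<open>The functions \<open>p(1/t) exp(-1/t)\<close>, extended by 0 to \<open>t \<le> 0\<close>. The
  family over all polynomials \<open>p\<close> is closed under differentiation, which makes every
  member smooth by a single induction.\<close>

definition flat :: "real poly \<Rightarrow> real \<Rightarrow> real" where
  "flat p t = (if t \<le> 0 then 0 else poly p (1 / t) * exp (- (1 / t)))"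

lemma poly_times_exp_tendsto_0: "((\<lambda>x::real. poly p x * exp (- x)) \<longlongrightarrow> 0) at_top"
proof -
  have "((\<lambda>x::real. \<Sum>i\<le>degree p. coeff p i * (x ^ i / exp x)) \<longlongrightarrow> (\<Sum>i\<le>degree p. coeff p i * 0)) at_top"
    by (intro tendsto_intros tendsto_power_div_exp_0)
  then show ?thesis
    by (simp add: poly_altdef exp_minus divide_inverse sum_distrib_right mult.assoc)
qed

lemma DERIV_flat: "(flat p has_real_derivative flat (monom 1 2 * (p - pderiv p)) t) (at t)"
proof -
  consider "t < 0" | "t = 0" | "t > 0" by linarith
  then show ?thesis
  proof cases
    case 1
    have "((\<lambda>_. 0) has_real_derivative 0) (at t)" by simp
    then have "(flat p has_real_derivative 0) (at t)"
      by (rule has_field_derivative_transform_within_open[where S="{..<0}"]) (use 1 in \<open>auto simp: flat_def\<close>)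
    then show ?thesis using 1 by (simp add: flat_def)
  next
    case 3
    have "((\<lambda>t. poly p (1 / t) * exp (- (1 / t))) has_real_derivative
        flat (monom 1 2 * (p - pderiv p)) t) (at t)"
    proof -
      have i: "((\<lambda>t. 1 / t) has_real_derivative - (1 / t\<^sup>2)) (at t)"
        using 3 by (auto intro!: derivative_eq_intros simp: power2_eq_square)
      have "((\<lambda>t. poly p (1 / t) * exp (- (1 / t))) has_real_derivative
          poly (pderiv p) (1 / t) * (- (1 / t\<^sup>2)) * exp (- (1 / t)) +
          exp (- (1 / t)) * (- (- (1 / t\<^sup>2))) * poly p (1 / t)) (at t)"
        by (intro DERIV_mult DERIV_chain2[OF poly_DERIV i] DERIV_chain2[OF DERIV_exp] DERIV_minus i)
      then show ?thesis using 3
        by (simp add: flat_def poly_monom power_one_over algebra_simps)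
    qed
    then show ?thesis
      by (rule has_field_derivative_transform_within_open[where S="{0<..}"]) (use 3 in \<open>auto simp: flat_def\<close>)
  next
    case 2
    have "((\<lambda>h. poly (pCons 0 p) (inverse h) * exp (- inverse h)) \<longlongrightarrow> 0) (at_right (0::real))"
      by (rule filterlim_compose[OF poly_times_exp_tendsto_0 filterlim_inverse_at_top_right])
    then have r: "((\<lambda>h. (flat p (0 + h) - flat p 0) / h) \<longlongrightarrow> 0) (at_right 0)"
      by (rule Lim_transform_eventually)
        (auto simp: eventually_at_filter flat_def divide_inverse)
    have l: "((\<lambda>h. (flat p (0 + h) - flat p 0) / h) \<longlongrightarrow> 0) (at_left 0)"
      by (rule Lim_transform_eventually[OF tendsto_const])
        (auto simp: eventually_at_filter flat_def)
    have "((\<lambda>h. (flat p (0 + h) - flat p 0) / h) \<longlongrightarrow> 0) (at 0)"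
      using l r by (simp add: filterlim_split_at)
    then show ?thesis unfolding 2 DERIV_def by (simp add: flat_def)
  qed
qed

lemma Ck_on_flat:
  assumes "Ck_on k V f"
  shows "Ck_on k V (\<lambda>x. flat p (f x))"
  using assms
proof (induction k arbitrary: p)
  have cont: "continuous_on UNIV (flat p)" for p
    using DERIV_flat by (meson DERIV_isCont continuous_at_imp_continuous_on)
  {
    case 0 then show ?case using cont by (auto intro: continuous_on_compose2)
  next
    case (Suc k)
    obtain f' where f': "\<And>v. Ck_on k V (f' v)" "\<And>v x. x \<in> V \<Longrightarrow> has_ddir f v (f' v x) x"
      using Suc.prems by (rule Ck_on_SucE) (rule that)
    have c: "continuous_on V (\<lambda>x. flat p (f x))"
      using cont Suc.prems by (auto intro: continuous_on_compose2)
    let ?q = "monom 1 2 * (p - pderiv p)"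
    have 1: "Ck_on k V (\<lambda>x. flat ?q (f x) * f' v x)" for v
      by (intro Ck_on_mult Suc.IH Ck_on_SucD[OF Suc.prems] f')
    have 2: "has_ddir (\<lambda>x. flat p (f x)) v (flat ?q (f x) * f' v x) x" if "x \<in> V" for v x
    proof -
      have "((\<lambda>t. f (x + t *\<^sub>R v)) has_real_derivative f' v x) (at 0)"
        using f'(2)[OF that] by (simp add: has_real_derivative_iff_has_vector_derivative)
      from DERIV_chain2[OF DERIV_flat this] show ?thesis
        by (simp add: has_real_derivative_iff_has_vector_derivative[symmetric])
    qed
    show ?case by (rule Ck_on_SucI[OF c 1 2])
  }
qed

text \<open>The smooth step \<open>f(s)/(f(s)+f(t))\<close> with \<open>f = flat 1\<close> and
  \<open>s = R\<^sup>2 - |y-a|\<^sup>2\<close>, \<open>t = |y-a|\<^sup>2 - r\<^sup>2\<close>. For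
  \<open>0 < r < R\<close> the numbers \<open>s\<close> and \<open>t\<close> are never both
  nonpositive.\<close>

definition radial_bump :: "'a::real_inner \<Rightarrow> real \<Rightarrow> real \<Rightarrow> 'a \<Rightarrow> real" where
  "radial_bump a r R y =
     flat 1 (R\<^sup>2 - (y - a) \<bullet> (y - a)) *
     inverse (flat 1 (R\<^sup>2 - (y - a) \<bullet> (y - a)) + flat 1 ((y - a) \<bullet> (y - a) - r\<^sup>2))"

lemma flat_1: "flat 1 t \<ge> 0" "t > 0 \<Longrightarrow> flat 1 t > 0" "t \<le> 0 \<Longrightarrow> flat 1 t = 0"
  by (auto simp: flat_def)

context
  fixes a :: "'a::real_inner" and r R :: real
  assumes rR: "0 < r" "r < R"
begin

lemma Ck_on_radial_bump: "Ck_on k V (radial_bump a r R)"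
proof -
  have rR2: "r\<^sup>2 < R\<^sup>2" using rR by (simp add: power_strict_mono)
  have q: "Ck_on k V (\<lambda>y. (y - a) \<bullet> (y - a))"
    using Ck_on_add[OF Ck_on_ident Ck_on_const[of k V "- a"]]
    by (intro Ck_on_bilinear[OF bounded_bilinear_inner]) auto
  have 1: "Ck_on k V (\<lambda>y. flat 1 (R\<^sup>2 - (y - a) \<bullet> (y - a)))"
    using Ck_on_add[OF Ck_on_const[of k V "R\<^sup>2"] Ck_on_mult[OF Ck_on_const[of k V "-1"] q]]
    by (intro Ck_on_flat) auto
  have 2: "Ck_on k V (\<lambda>y. flat 1 ((y - a) \<bullet> (y - a) - r\<^sup>2))"
    using Ck_on_add[OF q Ck_on_const[of k V "- r\<^sup>2"]] by (intro Ck_on_flat) auto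
  have pos: "flat 1 (R\<^sup>2 - s) + flat 1 (s - r\<^sup>2) \<noteq> 0" for s
  proof (cases "s < R\<^sup>2")
    case True then show ?thesis using flat_1(1)[of "s - r\<^sup>2"] flat_1(2)[of "R\<^sup>2 - s"] by simp
  next
    case False then show ?thesis using flat_1(1)[of "R\<^sup>2 - s"] flat_1(2)[of "s - r\<^sup>2"] rR2 by simp
  qed
  show ?thesis unfolding radial_bump_def[abs_def]
    by (intro Ck_on_mult 1 Ck_on_inverse Ck_on_add 2 pos)
qed

lemma radial_bump_1: "norm (y - a) \<le> r \<Longrightarrow> radial_bump a r R y = 1"
proof -
  assume "norm (y - a) \<le> r"
  then have *: "(y - a) \<bullet> (y - a) \<le> r\<^sup>2"
    by (simp add: power2_norm_eq_inner[symmetric] power_mono)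
  have "r\<^sup>2 < R\<^sup>2" using rR by (simp add: power_strict_mono)
  with * show ?thesis using flat_1(2)[of "R\<^sup>2 - (y - a) \<bullet> (y - a)"]
    by (simp add: radial_bump_def flat_1(3))
qed

lemma radial_bump_0: "norm (y - a) \<ge> R \<Longrightarrow> radial_bump a r R y = 0"
proof -
  assume "norm (y - a) \<ge> R"
  then have "R\<^sup>2 \<le> (y - a) \<bullet> (y - a)"
    using rR by (simp add: power2_norm_eq_inner[symmetric] power_mono)
  then show ?thesis by (simp add: radial_bump_def flat_1(3))
qed

end

section \<open>The chain rule in finite dimensions\<close>

lemma vector_mean_value_bound:
  fixes f :: "real \<Rightarrow> 'a::real_normed_vector"
  assumes "\<And>t. t \<in> closed_segment 0 s \<Longrightarrow> (f has_vector_derivative f' t) (at t within closed_segment 0 s)"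
    and "\<And>t. t \<in> closed_segment 0 s \<Longrightarrow> norm (f' t) \<le> B"
  shows "norm (f s - f 0) \<le> B * \<bar>s\<bar>"
proof -
  have "norm (f s - f 0) \<le> B * norm (s - 0)"
  proof (rule differentiable_bound[where S="closed_segment 0 s" and f'="\<lambda>t h. h *\<^sub>R f' t"])
    fix t assume t: "t \<in> closed_segment 0 s"
    show "(f has_derivative (\<lambda>h. h *\<^sub>R f' t)) (at t within closed_segment 0 s)"
      using assms(1)[OF t] by (simp add: has_vector_derivative_def)
    have "norm (h *\<^sub>R f' t) \<le> B * norm h" for h
      using mult_right_mono[OF assms(2)[OF t], of "norm h"] by (simp add: mult.commute)
    then show "onorm (\<lambda>h. h *\<^sub>R f' t) \<le> B" by (rule onorm_le)
  qed auto
  then show ?thesis by simp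
qed

lemma has_vector_derivative_linear_path:
  "((\<lambda>t. t *\<^sub>R w) has_vector_derivative 1 *\<^sub>R w) (at t within S)"
  unfolding has_vector_derivative_def
  using bounded_linear.has_derivative[OF bounded_linear_scaleR_left has_derivative_ident] by simp

text \<open>A finite orthonormal basis of the model space replaces the class \<open>euclidean_space\<close>.
  It is empty when the model space has dimension 0.\<close>

locale finite_onb =
  fixes Bs :: "'e::real_inner set"
  assumes finite_Bs: "finite Bs" and span_Bs: "span Bs = UNIV"
    and unit_Bs: "b \<in> Bs \<Longrightarrow> b \<bullet> b = 1"
    and orth_Bs: "b \<in> Bs \<Longrightarrow> b' \<in> Bs \<Longrightarrow> b \<noteq> b' \<Longrightarrow> b \<bullet> b' = 0"

lemma finite_onb_exists:
  fixes B :: "'e::real_inner set"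
  assumes "finite B" "span B = UNIV"
  shows "\<exists>Bs::'e set. finite_onb Bs"
proof -
  obtain C :: "'e set" where C: "finite C" "span C = UNIV" "pairwise orthogonal C"
    using basis_orthogonal[OF assms(1)] assms(2) by auto
  let ?f = "\<lambda>b::'e. b /\<^sub>R norm b"
  let ?B = "?f ` (C - {0})"
  have "C \<subseteq> span ?B"
  proof
    fix c assume c: "c \<in> C"
    show "c \<in> span ?B"
    proof (cases "c = 0")
      case False
      then have "norm c *\<^sub>R ?f c \<in> span ?B" using c by (intro span_mul span_base) auto
      with False show ?thesis by simp
    qed (simp add: span_zero)
  qed
  then have "span ?B = UNIV" using span_minimal[of C "span ?B"] C(2) by auto
  moreover have "b \<bullet> b = 1" if "b \<in> ?B" for b
  proof -
    from that have "\<exists>a\<in>C - {0}. b = a /\<^sub>R norm a" by blast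
    then have "norm b = 1" by (auto intro!: left_inverse)
    then show ?thesis by (simp add: norm_eq_sqrt_inner)
  qed
  moreover have "b \<bullet> b' = 0" if "b \<in> ?B" "b' \<in> ?B" "b \<noteq> b'" for b b'
    using that C(3) unfolding pairwise_def orthogonal_def by auto metis
  ultimately have "finite_onb ?B" using C(1) by (unfold_locales) auto
  then show ?thesis by blast
qed

context finite_onb
begin

lemma onb_expansion: "x = (\<Sum>b\<in>Bs. (x \<bullet> b) *\<^sub>R b)"
proof -
  define y where "y = x - (\<Sum>b\<in>Bs. (x \<bullet> b) *\<^sub>R b)"
  have "y \<bullet> b' = 0" if "b' \<in> Bs" for b'
  proof -
    have "(\<Sum>b\<in>Bs. (x \<bullet> b) *\<^sub>R b) \<bullet> b' = (\<Sum>b\<in>Bs. if b = b' then x \<bullet> b' else 0)"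
      unfolding inner_sum_left
      by (rule sum.cong) (use that unit_Bs orth_Bs in auto)
    then show ?thesis using that finite_Bs by (simp add: y_def inner_diff_left)
  qed
  then have "orthogonal y y"
    using orthogonal_to_span[of y Bs y] span_Bs by (auto simp: orthogonal_def)
  then show ?thesis by (simp add: orthogonal_def y_def)
qed

lemma norm_Bs: "b \<in> Bs \<Longrightarrow> norm b = 1"
  using unit_Bs by (simp add: norm_eq_sqrt_inner)

lemma abs_coord_le: "b \<in> Bs \<Longrightarrow> \<bar>h \<bullet> b\<bar> \<le> norm h"
  using Cauchy_Schwarz_ineq2[of h b] norm_Bs by simp

lemma norm_partial_sum_le:
  assumes "B' \<subseteq> Bs"
  shows "norm (\<Sum>b\<in>B'. (h \<bullet> b) *\<^sub>R b) \<le> real (card B') * norm h"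
proof -
  have "norm (\<Sum>b\<in>B'. (h \<bullet> b) *\<^sub>R b) \<le> (\<Sum>b\<in>B'. norm h)"
    by (rule sum_norm_le) (use assms abs_coord_le norm_Bs in auto)
  then show ?thesis by simp
qed

text \<open>The usual argument: move from \<open>x\<close> to \<open>x + h\<close> along one basis vector
  after the other and apply the mean value inequality to each piece. The induction is over the set
  of basis vectors already used.\<close>

lemma frechet_derivative_if_continuous_partials:
  fixes f :: "'e \<Rightarrow> 'b::real_normed_vector"
  assumes V: "open V" "x \<in> V"
    and der: "\<And>b y. b \<in> Bs \<Longrightarrow> y \<in> V \<Longrightarrow> has_ddir f b (d b y) y"
    and cont: "\<And>b. b \<in> Bs \<Longrightarrow> continuous_on V (d b)"
  shows "(f has_derivative (\<lambda>h. \<Sum>b\<in>Bs. (h \<bullet> b) *\<^sub>R d b x)) (at x)"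
proof -
  have "\<forall>e>0. \<exists>\<delta>>0. \<forall>h. norm h < \<delta> \<longrightarrow> norm (f (x + (\<Sum>b\<in>B'. (h \<bullet> b) *\<^sub>R b)) - f x -
      (\<Sum>b\<in>B'. (h \<bullet> b) *\<^sub>R d b x)) \<le> e * norm h" if "B' \<subseteq> Bs" for B'
    using finite_subset[OF that finite_Bs] that
  proof (induction B' rule: finite_induct)
    case (insert b B')
    show ?case
    proof (intro allI impI)
      fix e :: real assume "e > 0"
      let ?S = "\<lambda>h. \<Sum>b\<in>B'. (h \<bullet> b) *\<^sub>R b"
      have b: "b \<in> Bs" using insert by auto
      obtain \<delta>1 where \<delta>1: "\<delta>1 > 0" "\<And>h. norm h < \<delta>1 \<Longrightarrow> norm (f (x + ?S h) - f x -
          (\<Sum>b\<in>B'. (h \<bullet> b) *\<^sub>R d b x)) \<le> e / 2 * norm h"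
        using insert.IH insert.prems half_gt_zero[OF \<open>e > 0\<close>] by blast
      obtain \<rho> where \<rho>: "\<rho> > 0" "ball x \<rho> \<subseteq> V" using V openE by blast
      have "continuous (at x) (d b)" using cont[OF b] V continuous_on_eq_continuous_at by blast
      then obtain \<delta>2 where \<delta>2: "\<delta>2 > 0" "\<And>y. dist y x < \<delta>2 \<Longrightarrow> dist (d b y) (d b x) < e / 2"
        unfolding continuous_at_eps_delta using \<open>e > 0\<close> half_gt_zero by blast
      define \<delta> where "\<delta> = min \<delta>1 (min \<rho> \<delta>2 / (real (card B') + 2))"
      have "\<delta> > 0" using \<delta>1(1) \<delta>2(1) \<rho>(1) by (simp add: \<delta>_def)
      moreover have "norm (f (x + (\<Sum>b\<in>insert b B'. (h \<bullet> b) *\<^sub>R b)) - f x -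
          (\<Sum>b\<in>insert b B'. (h \<bullet> b) *\<^sub>R d b x)) \<le> e * norm h" if h: "norm h < \<delta>" for h
      proof -
        let ?y = "x + ?S h" and ?s = "h \<bullet> b"
        have hs: "(real (card B') + 2) * norm h < min \<rho> \<delta>2"
        proof -
          have "norm h < min \<rho> \<delta>2 / (real (card B') + 2)" using h by (simp add: \<delta>_def)
          then show ?thesis by (simp add: pos_less_divide_eq mult.commute)
        qed
        have near: "dist (?y + t *\<^sub>R b) x < min \<rho> \<delta>2" if "t \<in> closed_segment 0 ?s" for t
        proof -
          have "\<bar>t\<bar> \<le> norm h"
            using that abs_coord_le[OF b, of h] by (auto simp: closed_segment_eq_real_ivl split: if_splits)
          then have "norm (t *\<^sub>R b) \<le> norm h" using norm_Bs[OF b] by simp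
          moreover have "norm (?S h) \<le> real (card B') * norm h"
            using norm_partial_sum_le insert by auto
          moreover have "dist (?y + t *\<^sub>R b) x = norm (?S h + t *\<^sub>R b)" by (simp add: dist_norm add.assoc)
          moreover have "norm (?S h + t *\<^sub>R b) \<le> norm (?S h) + norm (t *\<^sub>R b)" by (rule norm_triangle_ineq)
          moreover have "(real (card B') + 2) * norm h = real (card B') * norm h + norm h + norm h"
            by (simp add: algebra_simps)
          ultimately show ?thesis using hs norm_ge_zero[of h] by linarith
        qed
        have "norm ((f (?y + ?s *\<^sub>R b) - ?s *\<^sub>R d b x) - (f (?y + 0 *\<^sub>R b) - 0 *\<^sub>R d b x)) \<le> e / 2 * \<bar>?s\<bar>"
        proof (rule vector_mean_value_bound[where f' = "\<lambda>t. d b (?y + t *\<^sub>R b) - 1 *\<^sub>R d b x"])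
          fix t assume t: "t \<in> closed_segment 0 ?s"
          have "?y + t *\<^sub>R b \<in> V" using near[OF t] \<rho>(2) by (auto simp: dist_commute)
          then have "((\<lambda>t. f (?y + t *\<^sub>R b)) has_vector_derivative d b (?y + t *\<^sub>R b)) (at t within closed_segment 0 ?s)"
            by (rule has_ddir_line[OF der[OF b]])
          then show "((\<lambda>t. f (?y + t *\<^sub>R b) - t *\<^sub>R d b x) has_vector_derivative d b (?y + t *\<^sub>R b) - 1 *\<^sub>R d b x)
              (at t within closed_segment 0 ?s)"
            by (rule has_vector_derivative_diff[OF _ has_vector_derivative_linear_path])
          show "norm (d b (?y + t *\<^sub>R b) - 1 *\<^sub>R d b x) \<le> e / 2"
            using \<delta>2(2)[of "?y + t *\<^sub>R b"] near[OF t] by (simp add: dist_norm)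
        qed
        also have "\<dots> \<le> e / 2 * norm h" using abs_coord_le[OF b, of h] \<open>e > 0\<close> by simp
        finally have 1: "norm (f (?y + ?s *\<^sub>R b) - ?s *\<^sub>R d b x - f ?y) \<le> e / 2 * norm h" by simp
        have 2: "norm (f ?y - f x - (\<Sum>b\<in>B'. (h \<bullet> b) *\<^sub>R d b x)) \<le> e / 2 * norm h"
          using \<delta>1(2)[of h] h by (simp add: \<delta>_def)
        have "f (x + (\<Sum>b\<in>insert b B'. (h \<bullet> b) *\<^sub>R b)) - f x - (\<Sum>b\<in>insert b B'. (h \<bullet> b) *\<^sub>R d b x)
          = (f (?y + ?s *\<^sub>R b) - ?s *\<^sub>R d b x - f ?y) + (f ?y - f x - (\<Sum>b\<in>B'. (h \<bullet> b) *\<^sub>R d b x))"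
          using insert by (simp add: algebra_simps)
        also have "norm \<dots> \<le> e / 2 * norm h + e / 2 * norm h"
          using norm_triangle_ineq 1 2 by (meson add_mono order_trans)
        finally show ?thesis by (simp add: algebra_simps)
      qed
      ultimately show "\<exists>\<delta>>0. \<forall>h. norm h < \<delta> \<longrightarrow> norm (f (x + (\<Sum>b\<in>insert b B'. (h \<bullet> b) *\<^sub>R b)) - f x -
          (\<Sum>b\<in>insert b B'. (h \<bullet> b) *\<^sub>R d b x)) \<le> e * norm h" by blast
    qed
  qed (auto intro: exI[of _ 1])
  from this[OF subset_refl] have main: "\<forall>e>0. \<exists>\<delta>>0. \<forall>h. norm h < \<delta> \<longrightarrow>
      norm (f (x + h) - f x - (\<Sum>b\<in>Bs. (h \<bullet> b) *\<^sub>R d b x)) \<le> e * norm h"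
    using onb_expansion by simp
  have bl: "bounded_linear (\<lambda>h. \<Sum>b\<in>Bs. (h \<bullet> b) *\<^sub>R d b x)"
    by (intro bounded_linear_sum bounded_linear_scaleR_const bounded_linear_inner_left)
  show ?thesis unfolding has_derivative_at_alt
  proof (intro conjI bl allI impI)
    fix e :: real assume "e > 0"
    then obtain \<delta> where \<delta>: "\<delta> > 0" "\<And>h. norm h < \<delta> \<Longrightarrow>
      norm (f (x + h) - f x - (\<Sum>b\<in>Bs. (h \<bullet> b) *\<^sub>R d b x)) \<le> e * norm h" using main by blast
    have "norm (f y - f x - (\<Sum>b\<in>Bs. ((y - x) \<bullet> b) *\<^sub>R d b x)) \<le> e * norm (y - x)"
      if "norm (y - x) < \<delta>" for y using \<delta>(2)[OF that] by simp
    with \<delta>(1) show "\<exists>\<delta>>0. \<forall>y. norm (y - x) < \<delta> \<longrightarrow>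
        norm (f y - f x - (\<Sum>b\<in>Bs. ((y - x) \<bullet> b) *\<^sub>R d b x)) \<le> e * norm (y - x)" by blast
  qed
qed

lemma has_vector_derivative_along_curve:
  fixes f :: "'e \<Rightarrow> 'b::real_normed_vector"
  assumes V: "open V" "\<gamma> 0 \<in> V"
    and der: "\<And>b y. b \<in> Bs \<Longrightarrow> y \<in> V \<Longrightarrow> has_ddir f b (d b y) y"
    and cont: "\<And>b. b \<in> Bs \<Longrightarrow> continuous_on V (d b)"
    and \<gamma>: "(\<gamma> has_vector_derivative u) (at (0::real))"
  shows "((\<lambda>t. f (\<gamma> t)) has_vector_derivative (\<Sum>b\<in>Bs. (u \<bullet> b) *\<^sub>R d b (\<gamma> 0))) (at 0)"
proof -
  have "(f has_derivative (\<lambda>h. \<Sum>b\<in>Bs. (h \<bullet> b) *\<^sub>R d b (\<gamma> 0))) (at (\<gamma> 0))"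
    by (rule frechet_derivative_if_continuous_partials[OF V der cont])
  from has_derivative_compose[OF \<gamma>[unfolded has_vector_derivative_def] this]
  show ?thesis unfolding has_vector_derivative_def
    by (simp add: scaleR_sum_right)
qed

lemma has_ddir_expand:
  fixes f :: "'e \<Rightarrow> 'b::real_normed_vector"
  assumes "open V" "Ck_on (Suc 0) V f" "x \<in> V"
  shows "ddir f v x = (\<Sum>b\<in>Bs. (v \<bullet> b) *\<^sub>R ddir f b x)"
proof -
  have C: "\<And>v. continuous_on V (ddir f v)" "\<And>v x. x \<in> V \<Longrightarrow> has_ddir f v (ddir f v x) x"
    using assms(2) unfolding Ck_on_Suc_iff[OF assms(1)] by auto
  have *: "((\<lambda>t::real. x + t *\<^sub>R v) has_vector_derivative v) (at 0)"
    by (rule has_ddir_ident)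
  show ?thesis
    using has_vector_derivative_along_curve[OF assms(1) _ C(2) C(1) *] assms(3)
    by (intro has_ddir_imp_ddir) simp
qed

text \<open>The derivative of \<open>f \<circ> \<tau>\<close> is a sum of products of derivatives of
  \<open>\<tau>\<close> with functions \<open>f' b \<circ> \<tau>\<close>, to which the induction
  hypothesis applies. This is what makes smoothness independent of the chart.\<close>

lemma Ck_on_compose:
  fixes f :: "'e \<Rightarrow> 'b::real_normed_vector" and \<tau> :: "'a::real_normed_vector \<Rightarrow> 'e"
  assumes "open S" "\<tau> ` V \<subseteq> S" "Ck_on k V \<tau>" "Ck_on k S f"
  shows "Ck_on k V (\<lambda>x. f (\<tau> x))"
  using assms(3,4)
proof (induction k arbitrary: f)
  case 0 then show ?case using assms(2) by (auto intro: continuous_on_compose2)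
next
  case (Suc k)
  obtain \<tau>' where \<tau>': "\<And>v. Ck_on k V (\<tau>' v)" "\<And>v x. x \<in> V \<Longrightarrow> has_ddir \<tau> v (\<tau>' v x) x"
    using Suc.prems(1) by (rule Ck_on_SucE) (rule that)
  obtain f' where f': "\<And>v. Ck_on k S (f' v)" "\<And>v x. x \<in> S \<Longrightarrow> has_ddir f v (f' v x) x"
    using Suc.prems(2) by (rule Ck_on_SucE) (rule that)
  have c: "continuous_on V (\<lambda>x. f (\<tau> x))"
    using Suc.prems assms(2) by (auto intro: continuous_on_compose2)
  have 1: "Ck_on k V (\<lambda>x. \<Sum>b\<in>Bs. (\<tau>' v x \<bullet> b) *\<^sub>R f' b (\<tau> x))" for v
    by (intro Ck_on_sum finite_Bs Ck_on_scale Suc.IH f' Ck_on_SucD[OF Suc.prems(1)]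
        Ck_on_linear[OF bounded_linear_inner_left] \<tau>')
  have 2: "has_ddir (\<lambda>x. f (\<tau> x)) v (\<Sum>b\<in>Bs. (\<tau>' v x \<bullet> b) *\<^sub>R f' b (\<tau> x)) x" if "x \<in> V" for v x
    using has_vector_derivative_along_curve[OF assms(1) _ f'(2) Ck_on_continuous[OF f'(1)] \<tau>'(2)[OF that, of v]]
      that assms(2) by auto
  show ?case by (rule Ck_on_SucI[OF c 1 2])
qed

text \<open>A closed ball lies in the image of a cube, and a cube is a finite Minkowski sum of segments.\<close>

lemma compact_cball: "compact (cball (a::'e) r)"
proof -
  have "compact {(\<Sum>b\<in>B'. c b *\<^sub>R b) | c. \<forall>b. \<bar>c b\<bar> \<le> r}" if "finite B'" for B' :: "'e set"
    using that
  proof (induction B' rule: finite_induct)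
    case empty
    have "{(\<Sum>b\<in>{}. c b *\<^sub>R b) | c. \<forall>b. \<bar>c b\<bar> \<le> r} \<subseteq> {0::'e}" by auto
    then show ?case by (meson finite.intros finite_imp_compact finite_subset)
  next
    case (insert b B')
    have "compact ((\<lambda>t. t *\<^sub>R b) ` {-r..r})"
      by (intro compact_continuous_image continuous_intros) auto
    from compact_sums[OF this insert.IH]
    have "compact {x + y |x y. x \<in> (\<lambda>t. t *\<^sub>R b) ` {-r..r} \<and>
        y \<in> {(\<Sum>b\<in>B'. c b *\<^sub>R b) | c. \<forall>b. \<bar>c b\<bar> \<le> r}}" .
    moreover have "{x + y |x y. x \<in> (\<lambda>t. t *\<^sub>R b) ` {-r..r} \<and>
        y \<in> {(\<Sum>b\<in>B'. c b *\<^sub>R b) | c. \<forall>b. \<bar>c b\<bar> \<le> r}} =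
        {(\<Sum>b\<in>insert b B'. c b *\<^sub>R b) | c. \<forall>b. \<bar>c b\<bar> \<le> r}" (is "?L = ?R")
    proof (intro equalityI subsetI)
      fix z assume "z \<in> ?L"
      then obtain t c where tc: "z = t *\<^sub>R b + (\<Sum>b\<in>B'. c b *\<^sub>R b)" "\<forall>b. \<bar>c b\<bar> \<le> r" "\<bar>t\<bar> \<le> r"
        by auto
      have "z = (\<Sum>b'\<in>insert b B'. (c(b := t)) b' *\<^sub>R b')"
        using insert tc by (auto intro!: sum.cong)
      moreover have "\<forall>b'. \<bar>(c(b := t)) b'\<bar> \<le> r" using tc by auto
      ultimately show "z \<in> ?R" by blast
    next
      fix z assume "z \<in> ?R"
      then obtain c where c: "z = (\<Sum>b\<in>insert b B'. c b *\<^sub>R b)" "\<forall>b. \<bar>c b\<bar> \<le> r" by blast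
      then have "z = c b *\<^sub>R b + (\<Sum>b\<in>B'. c b *\<^sub>R b)" using insert by simp
      moreover have "c b *\<^sub>R b \<in> (\<lambda>t. t *\<^sub>R b) ` {-r..r}" using c(2) by (auto simp: abs_le_iff minus_le_iff)
      ultimately show "z \<in> ?L" using c(2) by blast
    qed
    ultimately show ?case by simp
  qed
  then have 1: "compact ((\<lambda>x. a + x) ` {(\<Sum>b\<in>Bs. c b *\<^sub>R b) | c. \<forall>b. \<bar>c b\<bar> \<le> r})" (is "compact ?K")
    using finite_Bs by (intro compact_translation) auto
  have "cball a r \<subseteq> ?K"
  proof
    fix y assume y: "y \<in> cball a r"
    then have r: "norm (y - a) \<le> r" "0 \<le> r" by (auto simp: dist_norm norm_minus_commute intro: order_trans[OF norm_ge_zero])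
    let ?c = "\<lambda>b. if b \<in> Bs then (y - a) \<bullet> b else 0"
    have "y - a = (\<Sum>b\<in>Bs. ?c b *\<^sub>R b)" by (subst onb_expansion) auto
    moreover have "\<forall>b. \<bar>?c b\<bar> \<le> r" using abs_coord_le[of _ "y - a"] r by (auto intro: order_trans)
    ultimately have "y - a \<in> {(\<Sum>b\<in>Bs. c b *\<^sub>R b) | c. \<forall>b. \<bar>c b\<bar> \<le> r}" by (intro CollectI exI[of _ ?c]) auto
    then show "y \<in> ?K" by (rule rev_image_eqI) simp
  qed
  then have "cball a r = cball a r \<inter> ?K" by blast
  with closed_Int_compact[OF closed_cball 1, of a r] show ?thesis by metis
qed

end

section \<open>Hadamard's lemma\<close>

lemma segment_point_in_convex:
  assumes "convex V" "x \<in> V" "y \<in> V" "t \<in> {0..1::real}"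
  shows "x + t *\<^sub>R (y - x) \<in> V"
  using convexD_alt[OF assms(1-3), of t] assms(4) by (simp add: algebra_simps)

text \<open>Differentiating under the integral sign multiplies the weight by \<open>t\<close>, so the weights
  \<open>t ^ m\<close> are carried along in the induction.\<close>

lemma Ck_on_segment_integral:
  fixes g :: "'e::real_normed_vector \<Rightarrow> 'b::banach"
  assumes V: "open V" "convex V" "x \<in> V" and g: "Ck_on k V g"
  shows "Ck_on k V (\<lambda>y. integral (cbox 0 1) (\<lambda>t. t ^ m *\<^sub>R g (x + t *\<^sub>R (y - x))))"
  using g
proof (induction k arbitrary: g m)
  have joint: "continuous_on (V \<times> cbox 0 1) (\<lambda>(y, t). t ^ m *\<^sub>R g (x + t *\<^sub>R (y - x)))"
    if "continuous_on V g" for g :: "'e \<Rightarrow> 'b" and m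
    unfolding split_beta
    by (intro continuous_intros continuous_on_compose2[OF that])
      (auto intro: segment_point_in_convex[OF V(2,3)])
  {
    case 0
    show ?case using integral_continuous_on_param[OF joint[of g m]] 0 by simp
  next
    case (Suc k)
    obtain g' where g': "\<And>v. Ck_on k V (g' v)" "\<And>v x. x \<in> V \<Longrightarrow> has_ddir g v (g' v x) x"
      using Suc.prems by (rule Ck_on_SucE) (rule that)
    have gc: "continuous_on V g" using Suc.prems by simp
    have c: "continuous_on V (\<lambda>y. integral (cbox 0 1) (\<lambda>t. t ^ m *\<^sub>R g (x + t *\<^sub>R (y - x))))"
      by (rule integral_continuous_on_param[OF joint[OF gc]])
    show ?case
    proof (rule Ck_on_SucI[OF c Suc.IH[OF g'(1), of "Suc m"]])
      fix v y assume y: "y \<in> V"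
      obtain d where d: "d > 0" "\<And>s. \<bar>s\<bar> \<le> d \<Longrightarrow> y + s *\<^sub>R v \<in> V"
        using line_in_open[OF V(1) y, of v] by blast
      let ?f = "\<lambda>s t. t ^ m *\<^sub>R g (x + t *\<^sub>R (y + s *\<^sub>R v - x))"
      let ?f' = "\<lambda>s t. t ^ Suc m *\<^sub>R g' v (x + t *\<^sub>R (y + s *\<^sub>R v - x))"
      let ?U = "{-d..d}"
      have "((\<lambda>s. integral (cbox 0 1) (?f s)) has_vector_derivative integral (cbox 0 1) (?f' 0)) (at 0 within ?U)"
      proof (rule leibniz_rule_vector_derivative)
        fix s t :: real assume s: "s \<in> ?U" and t: "t \<in> cbox 0 1"
        have "x + t *\<^sub>R (y + s *\<^sub>R v - x) \<in> V"
          using s t d(2)[of s] by (intro segment_point_in_convex[OF V(2,3)]) auto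
        moreover have eq: "x + t *\<^sub>R (y + s *\<^sub>R v - x) = (x + t *\<^sub>R (y - x)) + (t * s) *\<^sub>R v" for s
          by (simp add: algebra_simps)
        ultimately have "has_ddir g v (g' v (x + t *\<^sub>R (y + s *\<^sub>R v - x))) (x + t *\<^sub>R (y - x) + (t * s) *\<^sub>R v)"
          by (metis g'(2))
        then have g1: "((\<lambda>r. g ((x + t *\<^sub>R (y - x)) + r *\<^sub>R v)) has_vector_derivative
            g' v (x + t *\<^sub>R (y + s *\<^sub>R v - x))) (at (t * s))"
          by (rule has_ddir_line)
        have "((\<lambda>s. t * s) has_vector_derivative t) (at s)"
          using has_vector_derivative_linear_path[of t] by (simp add: mult.commute)
        from vector_diff_chain_at[OF this g1]
        have "((\<lambda>s. g (x + t *\<^sub>R (y + s *\<^sub>R v - x))) has_vector_derivative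
            t *\<^sub>R g' v (x + t *\<^sub>R (y + s *\<^sub>R v - x))) (at s)"
          unfolding o_def eq[symmetric] .
        from bounded_linear.has_vector_derivative[OF bounded_linear_scaleR_right[of "t ^ m"] this]
        show "((\<lambda>s. ?f s t) has_vector_derivative ?f' s t) (at s within ?U)"
          by (rule has_vector_derivative_at_within[THEN has_vector_derivative_eq_rhs]) (simp add: mult.commute)
      next
        fix s assume "s \<in> ?U"
        then have "y + s *\<^sub>R v \<in> V" using d(2) by auto
        then show "?f s integrable_on cbox 0 1"
          by (intro integrable_continuous continuous_intros continuous_on_compose2[OF gc])
            (auto intro!: segment_point_in_convex[OF V(2,3)])
      next
        show "continuous_on (?U \<times> cbox 0 1) (\<lambda>(s, t). ?f' s t)"
          unfolding split_beta
          by (intro continuous_intros continuous_on_compose2[OF Ck_on_continuous[OF g'(1)[of v]]])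
            (use d(2) in \<open>auto intro!: segment_point_in_convex[OF V(2,3)] simp: abs_le_iff\<close>)
      qed (use d in auto)
      moreover have "at 0 within ?U = at 0" using d(1) by (intro at_within_interior) simp
      ultimately show "has_ddir (\<lambda>y. integral (cbox 0 1) (\<lambda>t. t ^ m *\<^sub>R g (x + t *\<^sub>R (y - x)))) v
          (integral (cbox 0 1) (\<lambda>t. t ^ Suc m *\<^sub>R g' v (x + t *\<^sub>R (y - x)))) y"
        by simp
    qed
  }
qed

text \<open>Integrate the derivative of \<open>g\<close> along the segment from \<open>x\<close> to
  \<open>y\<close>; \<open>G b\<close> is the mean of the partial derivative of \<open>g\<close> in
  direction \<open>b\<close> on it.\<close>

lemma (in finite_onb) Hadamard:
  fixes g :: "'e \<Rightarrow> 'b::banach"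
  assumes V: "open V" "convex V" "x \<in> V" and g: "\<And>k. Ck_on k V g"
  obtains G where "\<And>b k. Ck_on k V (G b)" "\<And>b. G b x = ddir g b x"
    "\<And>y. y \<in> V \<Longrightarrow> g y = g x + (\<Sum>b\<in>Bs. ((y - x) \<bullet> b) *\<^sub>R G b y)"
proof
  let ?G = "\<lambda>b y. integral (cbox 0 1) (\<lambda>t. t ^ 0 *\<^sub>R ddir g b (x + t *\<^sub>R (y - x)))"
  have C: "\<And>v k. Ck_on k V (ddir g v)" "\<And>v x. x \<in> V \<Longrightarrow> has_ddir g v (ddir g v x) x"
    using g Ck_on_Suc_iff[OF V(1)] by blast+
  show "Ck_on k V (?G b)" for b k by (rule Ck_on_segment_integral[OF V C(1)])
  show "?G b x = ddir g b x" for b by simp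
  fix y assume y: "y \<in> V"
  have seg: "x + t *\<^sub>R (y - x) \<in> V" if "t \<in> {0..1}" for t
    using segment_point_in_convex[OF V(2,3) y that] .
  have "((\<lambda>t. ddir g (y - x) (x + t *\<^sub>R (y - x))) has_integral
      g (x + 1 *\<^sub>R (y - x)) - g (x + 0 *\<^sub>R (y - x))) {0..1}"
    by (rule fundamental_theorem_of_calculus) (simp, rule has_ddir_line[OF C(2)[OF seg]])
  moreover have "integral {0..1} (\<lambda>t. ddir g (y - x) (x + t *\<^sub>R (y - x))) =
      integral {0..1} (\<lambda>t. \<Sum>b\<in>Bs. ((y - x) \<bullet> b) *\<^sub>R ddir g b (x + t *\<^sub>R (y - x)))"
    by (rule integral_cong) (rule has_ddir_expand[OF V(1) g seg])
  moreover have "\<dots> = (\<Sum>b\<in>Bs. integral {0..1} (\<lambda>t. ((y - x) \<bullet> b) *\<^sub>R ddir g b (x + t *\<^sub>R (y - x))))"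
  proof (rule integral_sum[OF finite_Bs])
    fix b
    show "(\<lambda>t. ((y - x) \<bullet> b) *\<^sub>R ddir g b (x + t *\<^sub>R (y - x))) integrable_on {0..1}"
      by (intro integrable_continuous_real continuous_intros
          continuous_on_compose2[OF Ck_on_continuous[OF C(1)[of 0 b]]]) (use seg in auto)
  qed
  ultimately have "g y - g x = (\<Sum>b\<in>Bs. ((y - x) \<bullet> b) *\<^sub>R ?G b y)"
    by (simp add: integral_unique)
  then show "g y = g x + (\<Sum>b\<in>Bs. ((y - x) \<bullet> b) *\<^sub>R ?G b y)"
    by (metis add.commute diff_add_cancel)
qed

section \<open>Differentiating limits\<close>

text \<open>The theorem on termwise differentiation of sequences, applied on the line through \<open>y\<close>
  in direction \<open>v\<close>.\<close>

lemma has_ddir_limit: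
  fixes f :: "nat \<Rightarrow> 'a::real_normed_vector \<Rightarrow> 'b::banach"
  assumes V: "open V" "y \<in> V"
    and d: "\<And>j x. x \<in> V \<Longrightarrow> has_ddir (f j) v (g j x) x"
    and lf: "\<And>x. x \<in> V \<Longrightarrow> (\<lambda>j. f j x) \<longlonglongrightarrow> F x" and lg: "uniform_limit V g G sequentially"
  shows "has_ddir F v (G y) y"
proof -
  obtain \<delta> where \<delta>: "\<delta> > 0" "\<And>s. \<bar>s\<bar> \<le> \<delta> \<Longrightarrow> y + s *\<^sub>R v \<in> V"
    using line_in_open[OF V, of v] by blast
  let ?S = "{-\<delta>..\<delta>}"
  have inV: "y + t *\<^sub>R v \<in> V" if "t \<in> ?S" for t using that \<delta>(2) by auto
  have "\<exists>h. \<forall>t\<in>?S. (\<lambda>n. f n (y + t *\<^sub>R v)) \<longlonglongrightarrow> h t \<and>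
      (h has_derivative (\<lambda>s. s *\<^sub>R G (y + t *\<^sub>R v))) (at t within ?S)"
  proof (rule has_derivative_sequence[where f'="\<lambda>n t s. s *\<^sub>R g n (y + t *\<^sub>R v)" and ?x0.0=0 and l="F y"])
    fix n t assume "t \<in> ?S"
    then show "((\<lambda>t. f n (y + t *\<^sub>R v)) has_derivative (\<lambda>s. s *\<^sub>R g n (y + t *\<^sub>R v))) (at t within ?S)"
      using has_ddir_line[OF d[OF inV]] by (simp add: has_vector_derivative_def)
  next
    fix e :: real assume "e > 0"
    then have "\<forall>\<^sub>F n in sequentially. \<forall>x\<in>V. dist (g n x) (G x) < e" using lg by (simp add: uniform_limit_iff)
    then show "\<forall>\<^sub>F n in sequentially. \<forall>t\<in>?S. \<forall>h.
        norm (h *\<^sub>R g n (y + t *\<^sub>R v) - h *\<^sub>R G (y + t *\<^sub>R v)) \<le> e * norm h"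
    proof eventually_elim
      case (elim n)
      show ?case
      proof (intro ballI allI)
        fix t h :: real assume "t \<in> ?S"
        then have "norm (g n (y + t *\<^sub>R v) - G (y + t *\<^sub>R v)) \<le> e"
          using elim inV by (force simp: dist_norm)
        from mult_left_mono[OF this abs_ge_zero[of h]]
        show "norm (h *\<^sub>R g n (y + t *\<^sub>R v) - h *\<^sub>R G (y + t *\<^sub>R v)) \<le> e * norm h"
          by (simp add: scaleR_diff_right[symmetric] mult.commute[of e])
      qed
    qed
  qed (use \<delta>(1) lf V in auto)
  then obtain h where h: "\<And>t. t \<in> ?S \<Longrightarrow> (\<lambda>n. f n (y + t *\<^sub>R v)) \<longlonglongrightarrow> h t"
    "\<And>t. t \<in> ?S \<Longrightarrow> (h has_derivative (\<lambda>s. s *\<^sub>R G (y + t *\<^sub>R v))) (at t within ?S)" by blast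
  have hF: "h t = F (y + t *\<^sub>R v)" if "t \<in> ?S" for t
    using LIMSEQ_unique[OF h(1)[OF that] lf[OF inV[OF that]]] .
  have "(h has_vector_derivative G y) (at 0 within ?S)"
    using h(2)[of 0] \<delta>(1) by (simp add: has_vector_derivative_def)
  then have "((\<lambda>t. F (y + t *\<^sub>R v)) has_vector_derivative G y) (at 0 within ?S)"
    by (rule has_vector_derivative_transform[rotated 2]) (use \<delta>(1) hF in auto)
  moreover have "at 0 within ?S = at 0" using \<delta>(1) by (intro at_within_interior) simp
  ultimately show ?thesis by simp
qed

text \<open>A family of scalar derivatives assembles to a derivative in the supremum norm as soon as the
  candidate \<open>g\<close> is norm continuous: by the mean value inequality the error in each
  value of the function is bounded by the oscillation of \<open>g\<close>, uniformly in the argument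
  \<open>z\<close>.\<close>

lemma has_ddir_bcontfun:
  fixes f g :: "'a::real_normed_vector \<Rightarrow> ('b::topological_space \<Rightarrow>\<^sub>C 'c::real_normed_vector)"
  assumes V: "open V" "x \<in> V"
    and d: "\<And>y z. y \<in> V \<Longrightarrow> has_ddir (\<lambda>y. apply_bcontfun (f y) z) v (apply_bcontfun (g y) z) y"
    and g: "continuous_on V g"
  shows "has_ddir f v (g x) x"
proof -
  obtain \<delta> where \<delta>: "\<delta> > 0" "\<And>s. \<bar>s\<bar> \<le> \<delta> \<Longrightarrow> x + s *\<^sub>R v \<in> V"
    using line_in_open[OF V, of v] by blast
  have "\<exists>d>0. \<forall>s. norm (s - 0) < d \<longrightarrow>
      norm (f (x + s *\<^sub>R v) - f (x + 0 *\<^sub>R v) - (s - 0) *\<^sub>R g x) \<le> e * norm (s - 0)" if "e > 0" for e :: real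
  proof -
    have "((\<lambda>t. g (x + t *\<^sub>R v)) \<longlongrightarrow> g x) (nhds (0::real))"
    proof -
      have "isCont g (x + 0 *\<^sub>R v)" using g V by (simp add: continuous_on_eq_continuous_at)
      moreover have "((\<lambda>t. x + t *\<^sub>R v) \<longlongrightarrow> x + 0 *\<^sub>R v) (nhds (0::real))"
        by (intro tendsto_intros filterlim_ident)
      ultimately have "((\<lambda>t. g (x + t *\<^sub>R v)) \<longlongrightarrow> g (x + 0 *\<^sub>R v)) (nhds (0::real))"
        by (rule isCont_tendsto_compose)
      then show ?thesis by simp
    qed
    then have "\<forall>\<^sub>F t in nhds 0. dist (g (x + t *\<^sub>R v)) (g x) < e" using that by (rule tendstoD)
    then obtain d where d0: "d > 0" "\<And>t. \<bar>t\<bar> < d \<Longrightarrow> dist (g (x + t *\<^sub>R v)) (g x) < e"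
      unfolding eventually_nhds_metric by auto
    show ?thesis
    proof (intro exI[of _ "min d \<delta>"] conjI allI impI)
      fix s :: real assume "norm (s - 0) < min d \<delta>"
      then have s: "\<bar>s\<bar> < d" "\<bar>s\<bar> < \<delta>" by auto
      have sm: "\<bar>t\<bar> < d" "\<bar>t\<bar> < \<delta>" if "t \<in> closed_segment 0 s" for t
        using that s by (auto simp: closed_segment_eq_real_ivl split: if_splits)
      show "norm (f (x + s *\<^sub>R v) - f (x + 0 *\<^sub>R v) - (s - 0) *\<^sub>R g x) \<le> e * norm (s - 0)"
      proof (rule norm_bound)
        fix z
        have "norm ((f (x + s *\<^sub>R v) z - s *\<^sub>R g x z) - (f (x + 0 *\<^sub>R v) z - 0 *\<^sub>R g x z)) \<le> e * \<bar>s\<bar>"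
        proof (rule vector_mean_value_bound[where f'="\<lambda>t. g (x + t *\<^sub>R v) z - 1 *\<^sub>R g x z"])
          fix t assume t: "t \<in> closed_segment 0 s"
          show "((\<lambda>t. f (x + t *\<^sub>R v) z - t *\<^sub>R g x z) has_vector_derivative g (x + t *\<^sub>R v) z - 1 *\<^sub>R g x z)
              (at t within closed_segment 0 s)"
            using sm[OF t] by (intro has_vector_derivative_diff[OF has_ddir_line[where f="\<lambda>y. f y z", OF d[OF \<delta>(2)]]
                  has_vector_derivative_linear_path]) simp
          have "dist (g (x + t *\<^sub>R v) z) (g x z) < e"
            using dist_fun_lt_imp_dist_val_lt[OF d0(2)[OF sm(1)[OF t]]] .
          then show "norm (g (x + t *\<^sub>R v) z - 1 *\<^sub>R g x z) \<le> e" by (simp add: dist_norm)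
        qed
        then show "norm (apply_bcontfun (f (x + s *\<^sub>R v) - f (x + 0 *\<^sub>R v) - (s - 0) *\<^sub>R g x) z) \<le> e * norm (s - 0)"
          by (simp add: algebra_simps)
      qed
    qed (use d0 \<delta> in auto)
  qed
  then show ?thesis
    unfolding has_vector_derivative_def has_derivative_at_alt
    using bounded_linear_scaleR_left by blast
qed

section \<open>Hilbert spaces on a carrier set inside a Banach space\<close>

text \<open>This form of the derivative can be compared with the limits of difference quotients in
  \<^const>\<open>hilbert_Ck_on\<close>.\<close>

lemma has_ddir_iff_quotient:
  "has_ddir f v g x \<longleftrightarrow> ((\<lambda>t. (f (x + t *\<^sub>R v) - f x) /\<^sub>R t) \<longlongrightarrow> g) (at 0)"
proof -
  have "has_ddir f v g x \<longleftrightarrow>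
      ((\<lambda>t. norm (f (x + t *\<^sub>R v) - f x - t *\<^sub>R g) / norm t) \<longlongrightarrow> 0) (at 0)"
    by (simp add: has_vector_derivative_def has_derivative_at bounded_linear_scaleR_left)
  also have "\<dots> \<longleftrightarrow> ((\<lambda>t. norm ((f (x + t *\<^sub>R v) - f x) /\<^sub>R t - g)) \<longlongrightarrow> 0) (at 0)"
  proof (rule tendsto_cong)
    have "norm (f (x + t *\<^sub>R v) - f x - t *\<^sub>R g) / norm t = norm ((f (x + t *\<^sub>R v) - f x) /\<^sub>R t - g)"
      if "t \<noteq> 0" for t
    proof -
      have "(f (x + t *\<^sub>R v) - f x) /\<^sub>R t - g = (f (x + t *\<^sub>R v) - f x - t *\<^sub>R g) /\<^sub>R t"
        using that by (simp add: scaleR_diff_right)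
      then show ?thesis by (simp add: divide_inverse)
    qed
    then show "\<forall>\<^sub>F t in at 0. norm (f (x + t *\<^sub>R v) - f x - t *\<^sub>R g) / norm t =
        norm ((f (x + t *\<^sub>R v) - f x) /\<^sub>R t - g)" by (simp add: eventually_at_filter)
  qed
  also have "\<dots> \<longleftrightarrow> ((\<lambda>t. (f (x + t *\<^sub>R v) - f x) /\<^sub>R t) \<longlongrightarrow> g) (at 0)"
    by (simp add: tendsto_norm_zero_iff LIM_zero_iff)
  finally show ?thesis .
qed

context complex_hilbert_space
begin

lemma inner_add_right:
  "x \<in> hcarrier V \<Longrightarrow> y \<in> hcarrier V \<Longrightarrow> z \<in> hcarrier V \<Longrightarrow>
    hinner V x (hadd V y z) = hinner V x y + hinner V x z"
  by (metis add_closed complex_cnj_add inner_add inner_cnj)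

lemma inner_scale_right:
  "x \<in> hcarrier V \<Longrightarrow> y \<in> hcarrier V \<Longrightarrow> hinner V x (hscale V a y) = cnj a * hinner V x y"
  by (metis complex_cnj_mult inner_cnj inner_scale scale_closed)

lemma sub_closed: "x \<in> hcarrier V \<Longrightarrow> y \<in> hcarrier V \<Longrightarrow> hsub V x y \<in> hcarrier V"
  by (simp add: hsub_def add_closed scale_closed)

lemma inner_sub:
  "x \<in> hcarrier V \<Longrightarrow> y \<in> hcarrier V \<Longrightarrow> z \<in> hcarrier V \<Longrightarrow>
    hinner V (hsub V x y) z = hinner V x z - hinner V y z"
  by (simp add: hsub_def inner_add inner_scale scale_closed)

lemma inner_sub_right:
  "x \<in> hcarrier V \<Longrightarrow> y \<in> hcarrier V \<Longrightarrow> z \<in> hcarrier V \<Longrightarrow>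
    hinner V z (hsub V x y) = hinner V z x - hinner V z y"
  by (simp add: hsub_def inner_add_right inner_scale_right scale_closed)

lemma inner_zero: "x \<in> hcarrier V \<Longrightarrow> hinner V (hzero V) x = 0"
  using inner_add[OF zero_closed zero_closed, of x] by (simp add: add_zero zero_closed)

lemma inner_self: "x \<in> hcarrier V \<Longrightarrow> hinner V x x = complex_of_real ((hnorm V x)\<^sup>2)"
proof -
  assume x: "x \<in> hcarrier V"
  have "Im (hinner V x x) = 0" using inner_cnj[OF x x] by (simp add: complex_eq_iff)
  with inner_nonneg[OF x] show ?thesis by (simp add: hnorm_def complex_eq_iff)
qed

lemma hnorm_nonneg: "x \<in> hcarrier V \<Longrightarrow> 0 \<le> hnorm V x"
  by (simp add: hnorm_def inner_nonneg)

lemma scale_0: "x \<in> hcarrier V \<Longrightarrow> hscale V 0 x = hzero V"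
  by (rule inner_definite) (simp_all add: scale_closed inner_scale)

lemma sub_eq_zero_iff:
  assumes "x \<in> hcarrier V" "y \<in> hcarrier V" "hsub V x y = hzero V"
  shows "x = y"
proof -
  have y': "hscale V (-1) y \<in> hcarrier V" using assms by (simp add: scale_closed)
  have "hadd V (hscale V (-1) y) y = hzero V"
    using scale_add_left[OF assms(2), of "-1" 1] assms by (simp add: scale_one scale_0)
  then have "x = hadd V (hsub V x y) y"
    unfolding hsub_def using add_assoc[OF assms(1) y' assms(2)] by (simp add: add_zero assms)
  then show ?thesis using assms by (metis add_commute add_zero zero_closed)
qed

lemma inner_eqI:
  assumes "x \<in> hcarrier V" "y \<in> hcarrier V" "\<And>z. z \<in> hcarrier V \<Longrightarrow> hinner V x z = hinner V y z"
  shows "x = y"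
proof (rule sub_eq_zero_iff[OF assms(1,2)])
  show "hsub V x y = hzero V"
    by (rule inner_definite) (use assms in \<open>auto simp: sub_closed inner_sub\<close>)
qed

lemma hnorm_scale: "x \<in> hcarrier V \<Longrightarrow> hnorm V (hscale V a x) = cmod a * hnorm V x"
proof -
  assume x: "x \<in> hcarrier V"
  have "hinner V (hscale V a x) (hscale V a x) = (a * cnj a) * hinner V x x"
    using x by (simp add: inner_scale inner_scale_right scale_closed)
  also have "\<dots> = complex_of_real ((cmod a * hnorm V x)\<^sup>2)"
    by (simp add: complex_norm_square[symmetric] inner_self[OF x] power_mult_distrib del: of_real_power)
  finally show ?thesis
    using inner_self[OF scale_closed[OF x, of a]] hnorm_nonneg[OF x] hnorm_nonneg[OF scale_closed[OF x, of a]]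
    by (metis mult_nonneg_nonneg norm_ge_zero of_real_eq_iff power2_eq_imp_eq)
qed

lemma Cauchy_Schwarz:
  assumes x: "x \<in> hcarrier V" and y: "y \<in> hcarrier V"
  shows "cmod (hinner V x y) \<le> hnorm V x * hnorm V y"
proof (cases "y = hzero V")
  case True
  then show ?thesis using inner_cnj[OF y x] inner_zero[OF x] hnorm_nonneg x y by (simp add: inner_zero)
next
  case False
  then have "hinner V y y \<noteq> 0" using inner_definite[OF y] by blast
  then have ny: "hnorm V y > 0" using inner_self[OF y] hnorm_nonneg[OF y] by auto
  let ?c = "hinner V x y / complex_of_real ((hnorm V y)\<^sup>2)"
  let ?z = "hsub V x (hscale V ?c y)"
  have cy: "hscale V ?c y \<in> hcarrier V" using y by (rule scale_closed)
  have "hinner V ?z y = 0"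
    using ny by (simp add: inner_sub x y scale_closed inner_scale inner_self)
  then have "hinner V ?z (hscale V ?c y) = 0" using inner_scale_right[OF sub_closed[OF x cy] y, of ?c] by simp
  then have "hinner V ?z ?z = hinner V ?z x"
    using inner_sub_right[OF x cy sub_closed[OF x cy]] by simp
  also have "\<dots> = hinner V x x - ?c * hinner V y x"
    using x y cy by (simp add: inner_sub inner_scale)
  also have "?c * hinner V y x = complex_of_real ((cmod (hinner V x y))\<^sup>2 / (hnorm V y)\<^sup>2)"
    unfolding inner_cnj[OF x y] by (simp add: complex_norm_square[symmetric] del: of_real_power)
  finally have "0 \<le> (hnorm V x)\<^sup>2 - (cmod (hinner V x y))\<^sup>2 / (hnorm V y)\<^sup>2"
    using inner_nonneg[OF sub_closed[OF x cy]] inner_self[OF x] by (metis Re_complex_of_real of_real_diff)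
  then have "(cmod (hinner V x y))\<^sup>2 \<le> (hnorm V x * hnorm V y)\<^sup>2"
    using ny by (simp add: power_mult_distrib pos_divide_le_eq)
  then show ?thesis by (rule power2_le_imp_le) (simp add: hnorm_nonneg x y)
qed

end

instance bcontfun :: (metric_space, banach) banach ..

type_synonym 'v bfun = "'v discrete \<Rightarrow>\<^sub>C complex"

definition cscale :: "complex \<Rightarrow> 'v bfun \<Rightarrow> 'v bfun" where
  "cscale a f = Bcontfun (\<lambda>z. a * apply_bcontfun f z)"

text \<open>The vector \<open>x\<close> as the function \<open>z \<mapsto> \<langle>x, z\<rangle>\<close> on
  the unit ball, extended by 0. The supremum norm of this function is the norm of \<open>x\<close>,
  by the Cauchy--Schwarz inequality and the choice \<open>z = x / |x|\<close>.\<close>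

definition embed :: "'v hilbert \<Rightarrow> 'v \<Rightarrow> 'v bfun" where
  "embed V x = Bcontfun (\<lambda>z. if of_discrete z \<in> hcarrier V \<and> hnorm V (of_discrete z) \<le> 1
     then hinner V x (of_discrete z) else 0)"

lemma continuous_on_discrete: "continuous_on S (f :: 'v discrete \<Rightarrow> _)"
  by (auto simp: continuous_on_topological intro: exI[of _ "{_}"] open_discrete)

lemma bcontfun_discreteI:
  fixes f :: "'v discrete \<Rightarrow> complex"
  assumes "\<And>z. cmod (f z) \<le> c"
  shows "apply_bcontfun (Bcontfun f) = f"
  by (rule Bcontfun_inverse) (auto simp: bcontfun_def continuous_on_discrete bounded_iff intro!: exI[of _ c] assms)

lemma apply_cscale: "apply_bcontfun (cscale a f) z = a * apply_bcontfun f z"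
proof -
  have "cmod (a * apply_bcontfun f z) \<le> cmod a * norm f" for z
    by (simp add: norm_mult mult_left_mono norm_bounded)
  then show ?thesis unfolding cscale_def by (subst bcontfun_discreteI) auto
qed

lemma bounded_bilinear_cscale: "bounded_bilinear cscale"
proof
  show "\<exists>K. \<forall>a b. norm (cscale a b) \<le> norm a * norm b * K"
  proof (intro exI[of _ 1] allI)
    fix a and b :: "'v bfun"
    have "norm (cscale a b) \<le> norm a * norm b"
      by (rule norm_bound) (simp add: apply_cscale norm_mult mult_left_mono norm_bounded)
    then show "norm (cscale a b) \<le> norm a * norm b * 1" by simp
  qed
qed (auto intro!: bcontfun_eqI simp: apply_cscale algebra_simps)

lemma norm_cscale_le: "norm (cscale a b) \<le> norm a * norm b"
  by (rule norm_bound) (simp add: apply_cscale norm_mult mult_left_mono norm_bounded)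

context complex_hilbert_space
begin

abbreviation "J \<equiv> embed V"

lemma apply_embed:
  assumes "x \<in> hcarrier V"
  shows "apply_bcontfun (J x) z = (if of_discrete z \<in> hcarrier V \<and> hnorm V (of_discrete z) \<le> 1
     then hinner V x (of_discrete z) else 0)"
proof -
  have "cmod (if of_discrete z \<in> hcarrier V \<and> hnorm V (of_discrete z) \<le> 1
     then hinner V x (of_discrete z) else 0) \<le> hnorm V x" for z
  proof (cases "of_discrete z \<in> hcarrier V \<and> hnorm V (of_discrete z) \<le> 1")
    case True
    then have "cmod (hinner V x (of_discrete z)) \<le> hnorm V x * 1"
      using Cauchy_Schwarz[OF assms, of "of_discrete z"] hnorm_nonneg[OF assms]
      by (meson mult_left_mono order_trans)
    with True show ?thesis by simp
  qed (use assms in \<open>auto simp: hnorm_nonneg\<close>)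
  then show ?thesis unfolding embed_def by (subst bcontfun_discreteI) (assumption, rule refl)
qed

lemma apply_embed_discrete:
  "x \<in> hcarrier V \<Longrightarrow> z \<in> hcarrier V \<Longrightarrow> hnorm V z \<le> 1 \<Longrightarrow>
    apply_bcontfun (J x) (discrete z) = hinner V x z"
  by (simp add: apply_embed discrete_inverse)

lemma embed_add: "x \<in> hcarrier V \<Longrightarrow> y \<in> hcarrier V \<Longrightarrow> J (hadd V x y) = J x + J y"
  by (rule bcontfun_eqI) (simp add: apply_embed add_closed inner_add)

lemma embed_sub: "x \<in> hcarrier V \<Longrightarrow> y \<in> hcarrier V \<Longrightarrow> J (hsub V x y) = J x - J y"
  by (rule bcontfun_eqI) (simp add: apply_embed sub_closed inner_sub)

lemma embed_scale: "x \<in> hcarrier V \<Longrightarrow> J (hscale V a x) = cscale a (J x)"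
  by (rule bcontfun_eqI) (simp add: apply_embed apply_cscale scale_closed inner_scale)

lemma embed_scale_real: "x \<in> hcarrier V \<Longrightarrow> J (hscale V (complex_of_real r) x) = r *\<^sub>R J x"
  by (rule bcontfun_eqI) (simp add: apply_embed scale_closed inner_scale scaleR_conv_of_real)

lemma embed_zero: "J (hzero V) = 0"
  by (rule bcontfun_eqI) (simp add: apply_embed zero_closed inner_zero)

lemma norm_embed: "x \<in> hcarrier V \<Longrightarrow> norm (J x) = hnorm V x"
proof (rule antisym)
  assume x: "x \<in> hcarrier V"
  show "norm (J x) \<le> hnorm V x"
  proof (rule norm_bound)
    fix z
    show "norm (apply_bcontfun (J x) z) \<le> hnorm V x"
    proof (cases "of_discrete z \<in> hcarrier V \<and> hnorm V (of_discrete z) \<le> 1")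
      case True
      then have "cmod (hinner V x (of_discrete z)) \<le> hnorm V x * 1"
        using Cauchy_Schwarz[OF x, of "of_discrete z"] hnorm_nonneg[OF x]
        by (meson mult_left_mono order_trans)
      with True show ?thesis by (simp add: apply_embed x)
    qed (use x in \<open>auto simp: hnorm_nonneg apply_embed\<close>)
  qed
  show "hnorm V x \<le> norm (J x)"
  proof (cases "hnorm V x = 0")
    case False
    then have n: "hnorm V x > 0" using hnorm_nonneg[OF x] by simp
    let ?z = "hscale V (complex_of_real (inverse (hnorm V x))) x"
    have z: "?z \<in> hcarrier V" using x by (rule scale_closed)
    have "hnorm V ?z = 1" unfolding hnorm_scale[OF x] norm_of_real using n by simp
    then have "apply_bcontfun (J x) (discrete ?z) = hinner V x ?z"
      using apply_embed_discrete[OF x z] by simp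
    also have "\<dots> = complex_of_real (hnorm V x)"
      using n by (simp add: inner_scale_right x inner_self power2_eq_square)
    finally have "cmod (apply_bcontfun (J x) (discrete ?z)) = hnorm V x" using n by simp
    then show ?thesis using norm_bounded[of "J x" "discrete ?z"] by simp
  qed simp
qed

lemma hdist_embed: "x \<in> hcarrier V \<Longrightarrow> y \<in> hcarrier V \<Longrightarrow> hdist V x y = dist (J x) (J y)"
  by (simp add: hdist_def norm_embed[symmetric] sub_closed embed_sub dist_norm)

lemma embed_inj: "x \<in> hcarrier V \<Longrightarrow> y \<in> hcarrier V \<Longrightarrow> J x = J y \<Longrightarrow> x = y"
proof (rule sub_eq_zero_iff)
  assume *: "x \<in> hcarrier V" "y \<in> hcarrier V" "J x = J y"
  then have "hnorm V (hsub V x y) = 0" by (simp add: norm_embed[symmetric] sub_closed embed_sub)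
  then show "hsub V x y = hzero V"
    using inner_self[OF sub_closed[OF *(1,2)]] inner_definite[OF sub_closed[OF *(1,2)]] by simp
qed

lemma Metric_space_hdist: "Metric_space (hcarrier V) (hdist V)"
proof
  show "0 \<le> hdist V x y" for x y by (simp add: hdist_def hnorm_nonneg sub_closed)
  show "hdist V x y = hdist V y x" for x y
    using hdist_embed dist_commute by (metis hdist_def)
qed (auto simp: hdist_embed dist_triangle embed_inj)

lemma limitin_htopology:
  "limitin (htopology V) f l F \<longleftrightarrow>
    l \<in> hcarrier V \<and> (\<forall>\<^sub>F x in F. f x \<in> hcarrier V) \<and> ((\<lambda>x. J (f x)) \<longlongrightarrow> J l) F"
proof -
  have "(\<forall>\<epsilon>>0. \<forall>\<^sub>F x in F. f x \<in> hcarrier V \<and> hdist V (f x) l < \<epsilon>) \<longleftrightarrow>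
      (\<forall>\<^sub>F x in F. f x \<in> hcarrier V) \<and> (\<forall>\<epsilon>>0. \<forall>\<^sub>F x in F. dist (J (f x)) (J l) < \<epsilon>)" (is "?A \<longleftrightarrow> ?B")
    if l: "l \<in> hcarrier V"
  proof
    assume A: ?A
    have "\<forall>\<^sub>F x in F. f x \<in> hcarrier V"
      using A[rule_format, OF zero_less_one] by eventually_elim simp
    moreover have "\<forall>\<^sub>F x in F. dist (J (f x)) (J l) < \<epsilon>" if "\<epsilon> > 0" for \<epsilon>
      using A[rule_format, OF that] by eventually_elim (metis hdist_embed l)
    ultimately show ?B by blast
  next
    assume B: ?B
    show ?A
    proof (intro allI impI)
      fix \<epsilon> :: real assume "\<epsilon> > 0"
      then have "\<forall>\<^sub>F x in F. dist (J (f x)) (J l) < \<epsilon>" using B by blast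
      with conjunct1[OF B] show "\<forall>\<^sub>F x in F. f x \<in> hcarrier V \<and> hdist V (f x) l < \<epsilon>"
        by eventually_elim (simp add: hdist_embed l)
    qed
  qed
  then show ?thesis
    unfolding htopology_def Metric_space.limitin_metric[OF Metric_space_hdist] tendsto_iff by blast
qed

lemma closed_embed: "closed (J ` hcarrier V)"
proof (rule complete_imp_closed, rule completeI)
  fix s assume s: "\<forall>n. s n \<in> J ` hcarrier V" "Cauchy s"
  from s(1) have "\<forall>n. \<exists>x. x \<in> hcarrier V \<and> s n = J x" by blast
  then obtain f where f: "\<And>n. f n \<in> hcarrier V" "\<And>n. s n = J (f n)" using choice by metis
  interpret Metric_space "hcarrier V" "hdist V" by (rule Metric_space_hdist)
  have "MCauchy f"
    unfolding MCauchy_def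
    using s(2) f by (auto simp: Cauchy_def hdist_embed)
  then obtain l where "limitin mtopology f l sequentially"
    using complete unfolding mcomplete_def by blast
  then have "l \<in> hcarrier V" "(\<lambda>n. J (f n)) \<longlonglongrightarrow> J l"
    using limitin_htopology[of f l sequentially] unfolding htopology_def by auto
  then show "\<exists>l\<in>J ` hcarrier V. s \<longlonglongrightarrow> l" unfolding f(2)[abs_def] by blast
qed

lemma continuous_map_htopology:
  fixes S :: "'a::metric_space set"
  shows "continuous_map (top_of_set S) (htopology V) f \<longleftrightarrow> f ` S \<subseteq> hcarrier V \<and> continuous_on S (\<lambda>x. J (f x))"
proof -
  interpret Metric_space "hcarrier V" "hdist V" by (rule Metric_space_hdist)
  show ?thesis unfolding htopology_def
  proof (intro iffI conjI)
    assume L: "continuous_map (top_of_set S) mtopology f"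
    then show f: "f ` S \<subseteq> hcarrier V" by (auto simp: continuous_map_def)
    show "continuous_on S (\<lambda>x. J (f x))" unfolding continuous_on_iff
    proof (intro ballI allI impI)
      fix x and e :: real assume x: "x \<in> S" and "e > 0"
      then obtain U where U: "openin (top_of_set S) U" "x \<in> U" "\<forall>y\<in>U. f y \<in> mball (f x) e"
        using L unfolding continuous_map_to_metric topspace_euclidean_subtopology by meson
      then obtain T where T: "open T" "U = S \<inter> T" by (auto simp: openin_open)
      then obtain d where d: "d > 0" "ball x d \<subseteq> T" using U(2) openE by blast
      have "dist (J (f y)) (J (f x)) < e" if "y \<in> S" "dist y x < d" for y
      proof -
        have "y \<in> U" using that d T by (auto simp: dist_commute)
        then have "hdist V (f x) (f y) < e" using U(3) by auto
        then show ?thesis using f that x by (metis commute hdist_embed image_subset_iff)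
      qed
      with d(1) show "\<exists>d>0. \<forall>y\<in>S. dist y x < d \<longrightarrow> dist (J (f y)) (J (f x)) < e" by blast
    qed
  next
    assume R: "f ` S \<subseteq> hcarrier V \<and> continuous_on S (\<lambda>x. J (f x))"
    show "continuous_map (top_of_set S) mtopology f" unfolding continuous_map_to_metric
    proof (intro ballI allI impI)
      fix x and e :: real assume x: "x \<in> topspace (top_of_set S)" and "e > 0"
      let ?U = "S \<inter> (\<lambda>x. J (f x)) -` ball (J (f x)) e"
      have "openin (top_of_set S) ?U"
        using R by (intro continuous_openin_preimage_gen) auto
      moreover have "x \<in> ?U" using x \<open>e > 0\<close> by auto
      moreover have "\<forall>y\<in>?U. f y \<in> mball (f x) e" using R x by (auto simp: hdist_embed image_subset_iff)
      ultimately show "\<exists>U. openin (top_of_set S) U \<and> x \<in> U \<and> (\<forall>y\<in>U. f y \<in> mball (f x) e)" by blast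
    qed
  qed
qed

text \<open>Through the isometry \<^const>\<open>embed\<close> the calculus in a Hilbert space on a carrier
  set becomes calculus in a Banach space. In the direction from right to left, derivatives stay in
  the image because it is closed.\<close>

lemma hilbert_Ck_on_iff:
  fixes S :: "'a::real_normed_vector set"
  assumes "open S"
  shows "hilbert_Ck_on k S V f \<longleftrightarrow> f ` S \<subseteq> hcarrier V \<and> Ck_on k S (\<lambda>x. J (f x))"
proof (induction k arbitrary: f)
  case 0 show ?case by (simp add: continuous_map_htopology)
next
  case (Suc k)
  have quotient: "limitin (htopology V)
       (\<lambda>t. hscale V (complex_of_real (1 / t)) (hsub V (f (x + t *\<^sub>R v)) (f x))) (g x) (at 0) \<longleftrightarrow>
      g x \<in> hcarrier V \<and> has_ddir (\<lambda>x. J (f x)) v (J (g x)) x"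
    if f: "f ` S \<subseteq> hcarrier V" and x: "x \<in> S" for x v g
  proof -
    have ev: "\<forall>\<^sub>F t in at 0. f (x + t *\<^sub>R v) \<in> hcarrier V"
      unfolding eventually_at_filter using eventually_line_in_open[OF assms x, of v]
      by eventually_elim (use f in auto)
    have fx: "f x \<in> hcarrier V" using f x by auto
    have 1: "\<forall>\<^sub>F t in at 0. hscale V (complex_of_real (1 / t)) (hsub V (f (x + t *\<^sub>R v)) (f x)) \<in> hcarrier V"
      using ev by eventually_elim (simp add: scale_closed sub_closed fx)
    have "((\<lambda>t. J (hscale V (complex_of_real (1 / t)) (hsub V (f (x + t *\<^sub>R v)) (f x)))) \<longlongrightarrow> J (g x)) (at 0) \<longleftrightarrow>
        ((\<lambda>t. (J (f (x + t *\<^sub>R v)) - J (f x)) /\<^sub>R t) \<longlongrightarrow> J (g x)) (at 0)"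
    proof (rule tendsto_cong)
      show "\<forall>\<^sub>F t in at 0. J (hscale V (complex_of_real (1 / t)) (hsub V (f (x + t *\<^sub>R v)) (f x))) =
          (J (f (x + t *\<^sub>R v)) - J (f x)) /\<^sub>R t"
        using ev by eventually_elim
          (simp only: embed_scale_real sub_closed fx embed_sub, simp add: divide_inverse)
    qed
    also have "\<dots> \<longleftrightarrow> has_ddir (\<lambda>x. J (f x)) v (J (g x)) x"
      by (rule has_ddir_iff_quotient[symmetric])
    finally show ?thesis unfolding limitin_htopology using 1 by blast
  qed
  show ?case
  proof
    assume L: "hilbert_Ck_on (Suc k) S V f"
    then have f: "f ` S \<subseteq> hcarrier V" "continuous_on S (\<lambda>x. J (f x))"
      by (auto simp: continuous_map_htopology)
    have "\<exists>g. Ck_on k S g \<and> (\<forall>x\<in>S. has_ddir (\<lambda>x. J (f x)) v (g x) x)" for v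
    proof -
      obtain g where g: "hilbert_Ck_on k S V g" "\<forall>x\<in>S. limitin (htopology V)
        (\<lambda>t. hscale V (complex_of_real (1 / t)) (hsub V (f (x + t *\<^sub>R v)) (f x))) (g x) (at 0)"
        using L by auto
      show ?thesis using g Suc.IH quotient[OF f(1)] by (intro exI[of _ "\<lambda>x. J (g x)"]) blast
    qed
    with f show "f ` S \<subseteq> hcarrier V \<and> Ck_on (Suc k) S (\<lambda>x. J (f x))" by simp
  next
    assume R: "f ` S \<subseteq> hcarrier V \<and> Ck_on (Suc k) S (\<lambda>x. J (f x))"
    have "\<exists>g. hilbert_Ck_on k S V g \<and> (\<forall>x\<in>S. limitin (htopology V)
        (\<lambda>t. hscale V (complex_of_real (1 / t)) (hsub V (f (x + t *\<^sub>R v)) (f x))) (g x) (at 0))" for v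
    proof -
      obtain g where g: "Ck_on k S g" "\<forall>x\<in>S. has_ddir (\<lambda>x. J (f x)) v (g x) x"
        using conjunct2[OF R] unfolding Ck_on.simps by blast
      have "g x \<in> J ` hcarrier V" if x: "x \<in> S" for x
      proof (rule Lim_in_closed_set[OF closed_embed])
        have "has_ddir (\<lambda>x. J (f x)) v (g x) x" using g x by blast
        then show "((\<lambda>t. (J (f (x + t *\<^sub>R v)) - J (f x)) /\<^sub>R t) \<longlongrightarrow> g x) (at 0)"
          by (rule has_ddir_iff_quotient[of "\<lambda>x. J (f x)", THEN iffD1])
        have fx: "f x \<in> hcarrier V" using R x by auto
        have "\<forall>\<^sub>F t in at 0. f (x + t *\<^sub>R v) \<in> hcarrier V"
          unfolding eventually_at_filter using eventually_line_in_open[OF assms x, of v]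
          by eventually_elim (use R in auto)
        then show "\<forall>\<^sub>F t in at 0. (J (f (x + t *\<^sub>R v)) - J (f x)) /\<^sub>R t \<in> J ` hcarrier V"
        proof eventually_elim
          case (elim t)
          have "(J (f (x + t *\<^sub>R v)) - J (f x)) /\<^sub>R t =
              J (hscale V (complex_of_real (inverse t)) (hsub V (f (x + t *\<^sub>R v)) (f x)))"
            using elim fx by (simp only: embed_scale_real sub_closed embed_sub)
          then show ?case using elim fx by (simp only: imageI scale_closed sub_closed)
        qed
      qed simp
      then have "\<forall>x\<in>S. \<exists>h. h \<in> hcarrier V \<and> J h = g x"
        by (auto simp: image_iff) metis
      from bchoice[OF this] obtain g' where
        g': "\<And>x. x \<in> S \<Longrightarrow> g' x \<in> hcarrier V" "\<And>x. x \<in> S \<Longrightarrow> J (g' x) = g x"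
        by blast
      have "Ck_on k S (\<lambda>x. J (g' x))" using g(1) Ck_on_cong[OF assms, of "\<lambda>x. J (g' x)" g k] g'(2) by blast
      then have "hilbert_Ck_on k S V g'" using g'(1) Suc.IH by blast
      moreover have "limitin (htopology V)
        (\<lambda>t. hscale V (complex_of_real (1 / t)) (hsub V (f (x + t *\<^sub>R v)) (f x))) (g' x) (at 0)" if "x \<in> S" for x
        using quotient[OF conjunct1[OF R] that, of v g'] g'[OF that] bspec[OF g(2) that] by metis
      ultimately show ?thesis by blast
    qed
    moreover have "continuous_on S (\<lambda>x. J (f x))" using R by simp
    ultimately show "hilbert_Ck_on (Suc k) S V f"
      using R unfolding hilbert_Ck_on.simps continuous_map_htopology by blast
  qed
qed

end

section \<open>Uniform boundedness of skew operators\<close>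

text \<open>The image of a Hilbert space under \<^const>\<open>embed\<close>, with the real part of the inner
  product, as a real Hilbert space inside a Banach space.\<close>

locale real_hilbert_subspace =
  fixes S :: "'w::banach set" and ip :: "'w \<Rightarrow> 'w \<Rightarrow> real"
  assumes subspace_S: "subspace S" and closed_S: "closed S"
    and ip_add: "u \<in> S \<Longrightarrow> v \<in> S \<Longrightarrow> w \<in> S \<Longrightarrow> ip (u + v) w = ip u w + ip v w"
    and ip_scale: "u \<in> S \<Longrightarrow> w \<in> S \<Longrightarrow> ip (c *\<^sub>R u) w = c * ip u w"
    and ip_sym: "u \<in> S \<Longrightarrow> w \<in> S \<Longrightarrow> ip u w = ip w u"
    and ip_norm: "u \<in> S \<Longrightarrow> ip u u = (norm u)\<^sup>2"
begin

lemma ip_diff: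
  assumes "u \<in> S" "v \<in> S" "w \<in> S"
  shows "ip (u - v) w = ip u w - ip v w"
proof -
  have "ip (u + (-1) *\<^sub>R v) w = ip u w + (-1) * ip v w"
    using assms subspace_S by (simp only: ip_add ip_scale subspace_mul)
  then show ?thesis by simp
qed

lemma ip_bound:
  assumes "u \<in> S" "w \<in> S"
  shows "\<bar>ip u w\<bar> \<le> norm u * norm w"
proof (cases "w = 0")
  case True
  have "ip 0 u = 0" using ip_scale[of u u 0] assms by simp
  then show ?thesis using True ip_sym assms by simp
next
  case False
  let ?t = "ip u w / (norm w)\<^sup>2"
  let ?z = "u - ?t *\<^sub>R w"
  have tw: "?t *\<^sub>R w \<in> S" and z: "?z \<in> S" using assms subspace_S by (auto simp: subspace_mul subspace_diff)
  have zw: "ip ?z w = 0" using False assms tw by (simp add: ip_diff ip_scale ip_norm)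
  have "(norm ?z)\<^sup>2 = ip u ?z - ip (?t *\<^sub>R w) ?z" using assms tw z by (simp add: ip_norm[symmetric] ip_diff)
  also have "ip (?t *\<^sub>R w) ?z = 0" using ip_scale[OF assms(2) z, of ?t] ip_sym[OF z assms(2)] zw by simp
  also have "ip u ?z = (norm u)\<^sup>2 - ?t * ip u w"
    using ip_sym[OF assms(1) z] ip_diff[OF assms(1) tw assms(1)] ip_scale[OF assms(2,1), of ?t] ip_sym[OF assms]
    by (simp add: ip_norm assms)
  finally have "0 \<le> (norm u)\<^sup>2 - (ip u w)\<^sup>2 / (norm w)\<^sup>2"
    by (metis diff_zero power2_eq_square times_divide_eq_left zero_le_power2)
  then have "(ip u w)\<^sup>2 \<le> (norm u * norm w)\<^sup>2"
    using False by (simp add: power_mult_distrib pos_divide_le_eq)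
  then have "\<bar>ip u w\<bar>\<^sup>2 \<le> (norm u * norm w)\<^sup>2" by simp
  then show ?thesis by (rule power2_le_imp_le) simp
qed

lemma ip_eqI:
  assumes "u \<in> S" "v \<in> S" "\<And>w. w \<in> S \<Longrightarrow> ip u w = ip v w"
  shows "u = v"
proof -
  have s: "u - v \<in> S" using assms subspace_S by (simp add: subspace_diff)
  have "(norm (u - v))\<^sup>2 = 0" using assms s by (simp add: ip_norm[symmetric] ip_diff)
  then show ?thesis by simp
qed

lemma tendsto_ip:
  assumes "(f \<longlongrightarrow> l) F" "\<forall>\<^sub>F x in F. f x \<in> S" "l \<in> S" "w \<in> S"
  shows "((\<lambda>x. ip (f x) w) \<longlongrightarrow> ip l w) F"
proof -
  have "((\<lambda>x. norm (f x - l) * norm w) \<longlongrightarrow> 0 * norm w) F"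
    by (intro tendsto_intros) (use assms(1) in \<open>simp add: LIM_zero tendsto_norm_zero\<close>)
  then have n: "((\<lambda>x. norm (f x - l) * norm w) \<longlongrightarrow> 0) F" by simp
  have "((\<lambda>x. ip (f x) w - ip l w) \<longlongrightarrow> 0) F"
  proof (rule Lim_null_comparison[OF _ n], unfold real_norm_def)
    show "\<forall>\<^sub>F x in F. \<bar>ip (f x) w - ip l w\<bar> \<le> norm (f x - l) * norm w"
      using assms(2)
    proof eventually_elim
      case (elim x)
      then have "f x - l \<in> S" using assms subspace_S by (simp add: subspace_diff)
      from ip_bound[OF this assms(4)] show ?case using elim assms by (simp add: ip_diff)
    qed
  qed
  then show ?thesis by (simp add: LIM_zero_iff)
qed

text \<open>Sokal's elementary proof of the uniform boundedness principle. If the norms \<open>N i\<close> of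
  the functionals are unbounded, build a sequence \<open>X n\<close> by steps of length at most
  \<open>3\<^sup>-\<^sup>n\<close> such that some functional with norm above
  \<open>4\<^sup>n\<close> is at least \<open>3/4 \<cdot> 3\<^sup>-\<^sup>n N i\<close> at the new
  point. All later steps together have length at most \<open>3\<^sup>-\<^sup>n / 2\<close>, so this
  functional is at least \<open>(4/3)\<^sup>n / 4\<close> at the limit.\<close>

lemma uniform_boundedness:
  fixes L :: "'i \<Rightarrow> 'w \<Rightarrow> real"
  assumes add: "\<And>i u v. i \<in> I \<Longrightarrow> u \<in> S \<Longrightarrow> v \<in> S \<Longrightarrow> L i (u + v) = L i u + L i v"
    and scale: "\<And>i u c. i \<in> I \<Longrightarrow> u \<in> S \<Longrightarrow> L i (c *\<^sub>R u) = c * L i u"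
    and bdd: "\<And>i. i \<in> I \<Longrightarrow> \<exists>c. \<forall>u\<in>S. \<bar>L i u\<bar> \<le> c * norm u"
    and pointwise: "\<And>u. u \<in> S \<Longrightarrow> \<exists>c. \<forall>i\<in>I. \<bar>L i u\<bar> \<le> c"
  shows "\<exists>c. \<forall>i\<in>I. \<forall>u\<in>S. \<bar>L i u\<bar> \<le> c * norm u"
proof (rule ccontr)
  assume unbdd: "\<not> ?thesis"
  have S0: "0 \<in> S" using subspace_S by (rule subspace_0)
  define N where "N i = Sup ((\<lambda>u. \<bar>L i u\<bar>) ` {u \<in> S. norm u \<le> 1})" for i
  have bdd_above: "bdd_above ((\<lambda>u. \<bar>L i u\<bar>) ` {u \<in> S. norm u \<le> 1})" if "i \<in> I" for i
  proof -
    from bdd[OF that] obtain c where c: "\<forall>u\<in>S. \<bar>L i u\<bar> \<le> c * norm u" by blast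
    show ?thesis
    proof (rule bdd_aboveI2[where M="\<bar>c\<bar>"])
      fix u assume u: "u \<in> {u \<in> S. norm u \<le> 1}"
      then have "\<bar>L i u\<bar> \<le> c * norm u" using c by blast
      also have "\<dots> \<le> \<bar>c\<bar> * norm u" by (simp add: mult_right_mono)
      also have "\<dots> \<le> \<bar>c\<bar> * 1" using u by (intro mult_left_mono) auto
      finally show "\<bar>L i u\<bar> \<le> \<bar>c\<bar>" by simp
    qed
  qed
  have N: "\<bar>L i u\<bar> \<le> N i * norm u" if i: "i \<in> I" and u: "u \<in> S" for i u
  proof (cases "u = 0")
    case True then show ?thesis using scale[OF i S0, of 0] by simp
  next
    case False
    have "\<bar>L i ((1 / norm u) *\<^sub>R u)\<bar> \<le> N i" unfolding N_def
      by (rule cSUP_upper[OF _ bdd_above[OF i]]) (use u False subspace_S in \<open>auto simp: subspace_mul\<close>)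
    then show ?thesis using False by (simp add: scale[OF i u] abs_mult pos_divide_le_eq)
  qed
  have "\<exists>x'. x' \<in> S \<and> norm (x' - x) \<le> (1/3)^n \<and> (\<exists>i\<in>I. N i > 4^n \<and> \<bar>L i x'\<bar> \<ge> 3/4 * (1/3)^n * N i)"
    if x: "x \<in> S" for x n
  proof -
    have "\<exists>i\<in>I. N i > 4^n"
    proof (rule ccontr)
      assume "\<not> (\<exists>i\<in>I. N i > 4^n)"
      then have "\<forall>i\<in>I. \<forall>u\<in>S. \<bar>L i u\<bar> \<le> 4^n * norm u"
        using N by (meson linorder_not_le mult_right_mono norm_ge_zero order_trans)
      with unbdd show False by blast
    qed
    then obtain i where i: "i \<in> I" "N i > 4^n" by blast
    have Np: "N i > 0" using i(2) by (meson less_trans zero_less_numeral zero_less_power)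
    have "3/4 * N i < N i" using Np by simp
    then have "\<exists>y\<in>(\<lambda>u. \<bar>L i u\<bar>) ` {u \<in> S. norm u \<le> 1}. 3/4 * N i < y"
      unfolding N_def by (subst (asm) less_cSup_iff) (use S0 bdd_above[OF i(1)] in \<open>auto intro!: exI[of _ 0]\<close>)
    then obtain u where u: "u \<in> S" "norm u \<le> 1" "3/4 * N i < \<bar>L i u\<bar>" by auto
    let ?r = "(1/3)^n :: real"
    have ru: "?r *\<^sub>R u \<in> S" using u subspace_S by (simp add: subspace_mul)
    have rr: "?r * (3/4 * N i) \<le> ?r * \<bar>L i u\<bar>" using u(3) by (intro mult_left_mono) auto
    have rr': "3/4 * ?r * N i \<le> ?r * \<bar>L i u\<bar>" using rr by (simp only: mult_ac)
    have L1: "L i (x + ?r *\<^sub>R u) = L i x + ?r * L i u" using add[OF i(1) x ru] scale[OF i(1) u(1)] by simp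
    have L2: "L i (x + (- ?r) *\<^sub>R u) = L i x - ?r * L i u"
      using add[OF i(1) x subspace_mul[OF subspace_S u(1), of "- ?r"]] scale[OF i(1) u(1), of "- ?r"] by simp
    have ar: "\<bar>?r * L i u\<bar> = ?r * \<bar>L i u\<bar>" by (simp add: abs_mult)
    have nr: "norm (?r *\<^sub>R u) \<le> ?r" using u(2) by (simp add: mult_left_le)
    have "\<bar>L i (x + ?r *\<^sub>R u)\<bar> \<ge> ?r * \<bar>L i u\<bar> \<or> \<bar>L i (x + (- ?r) *\<^sub>R u)\<bar> \<ge> ?r * \<bar>L i u\<bar>"
      unfolding L1 L2 ar[symmetric] by linarith
    then show ?thesis
    proof
      assume *: "\<bar>L i (x + ?r *\<^sub>R u)\<bar> \<ge> ?r * \<bar>L i u\<bar>"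
      show ?thesis
        by (intro exI[of _ "x + ?r *\<^sub>R u"] conjI bexI[of _ i])
          (use order_trans[OF rr' *] nr i subspace_add[OF subspace_S x ru]
            in \<open>simp_all only: add_diff_cancel_left'\<close>)
    next
      assume *: "\<bar>L i (x + (- ?r) *\<^sub>R u)\<bar> \<ge> ?r * \<bar>L i u\<bar>"
      have ru': "(- ?r) *\<^sub>R u \<in> S" by (rule subspace_mul[OF subspace_S u(1)])
      have nr': "norm ((- ?r) *\<^sub>R u) \<le> ?r" using nr by simp
      show ?thesis
        by (intro exI[of _ "x + (- ?r) *\<^sub>R u"] conjI bexI[of _ i])
          (use order_trans[OF rr' *] nr' i subspace_add[OF subspace_S x ru']
            in \<open>simp_all only: add_diff_cancel_left'\<close>)
    qed
  qed
  note ex_step = this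
  define step where "step n x = (SOME x'. x' \<in> S \<and> norm (x' - x) \<le> (1/3)^n \<and>
      (\<exists>i\<in>I. N i > 4^n \<and> \<bar>L i x'\<bar> \<ge> 3/4 * (1/3)^n * N i))" for n x
  have step: "step n x \<in> S \<and> norm (step n x - x) \<le> (1/3)^n \<and>
      (\<exists>i\<in>I. N i > 4^n \<and> \<bar>L i (step n x)\<bar> \<ge> 3/4 * (1/3)^n * N i)" if "x \<in> S" for x n
    unfolding step_def by (rule someI_ex[OF ex_step[OF that]])
  define X where "X = rec_nat 0 step"
  have X: "X 0 = 0" "X (Suc n) = step n (X n)" for n by (simp_all add: X_def)
  have XS: "X n \<in> S" for n by (induction n) (use X S0 step in auto)
  have inc: "norm (X (Suc n) - X n) \<le> (1/3)^n" for n using step[OF XS] X by simp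
  have far: "norm (X m - X (Suc n)) \<le> (1/3)^n / 2 - (1/3)^(m - 1) / 2" if "m \<ge> Suc n" for m n
    using that
  proof (induction m rule: dec_induct)
    case base then show ?case by simp
  next
    case (step m)
    obtain k where k: "m = Suc k" using step(1) by (cases m) auto
    have "norm (X (Suc m) - X (Suc n)) \<le> norm (X (Suc m) - X m) + norm (X m - X (Suc n))"
      by (rule norm_diff_triangle_ineq[of "X (Suc m)" "X m" "X m" "X (Suc n)", simplified])
    also have "\<dots> \<le> (1/3)^m + ((1/3)^n / 2 - (1/3)^(m - 1) / 2)" using inc step.IH by (intro add_mono)
    also have "\<dots> = (1/3)^n / 2 - (1/3)^(Suc m - 1) / 2" by (simp add: k)
    finally show ?case .
  qed
  have "summable (\<lambda>n. X (Suc n) - X n)"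
    by (rule summable_comparison_test[of _ "\<lambda>n. (1/3)^n"]) (use inc in auto)
  then have "convergent (\<lambda>n. \<Sum>k<n. X (Suc k) - X k)" by (simp add: summable_iff_convergent)
  then have "convergent X" by (simp add: sum_lessThan_telescope X(1))
  then obtain x where x: "X \<longlonglongrightarrow> x" by (auto simp: convergent_def)
  have xS: "x \<in> S" using closed_sequentially[OF closed_S _ x] XS by blast
  have close: "norm (x - X (Suc n)) \<le> (1/3)^n / 2" for n
  proof (rule LIMSEQ_le_const2)
    show "(\<lambda>m. norm (X m - X (Suc n))) \<longlonglongrightarrow> norm (x - X (Suc n))" by (intro tendsto_intros x)
    have "norm (X m - X (Suc n)) \<le> (1/3)^n / 2" if "m \<ge> Suc n" for m
      using far[OF that] by (smt (verit) zero_le_power divide_nonneg_pos)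
    then show "\<exists>M. \<forall>m\<ge>M. norm (X m - X (Suc n)) \<le> (1/3)^n / 2" by blast
  qed
  obtain c where c: "\<forall>i\<in>I. \<bar>L i x\<bar> \<le> c" using pointwise[OF xS] by blast
  have "(4/3)^n / 4 \<le> c" for n
  proof -
    obtain i where i: "i \<in> I" "N i > 4^n" "\<bar>L i (X (Suc n))\<bar> \<ge> 3/4 * (1/3)^n * N i"
      using step[OF XS, of n n] X by auto
    have d: "x - X (Suc n) \<in> S" using xS XS subspace_S by (simp add: subspace_diff)
    have "L i x = L i (X (Suc n)) + L i (x - X (Suc n))" using add[OF i(1) XS d, of "Suc n"] by simp
    moreover have "\<bar>L i (x - X (Suc n))\<bar> \<le> N i * ((1/3)^n / 2)"
    proof -
      have "N i \<ge> 0" using i(2) by (meson less_imp_le less_trans zero_less_numeral zero_less_power)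
      then show ?thesis using N[OF i(1) d] close[of n] by (meson mult_left_mono order_trans)
    qed
    ultimately have "\<bar>L i x\<bar> \<ge> 3/4 * (1/3)^n * N i - N i * ((1/3)^n / 2)" using i(3) by linarith
    also have "3/4 * (1/3)^n * N i - N i * ((1/3)^n / 2) = N i * (1/3)^n / 4" by (simp add: field_simps)
    finally have "N i * (1/3)^n / 4 \<le> c" using c i(1) by force
    moreover have "4^n * (1/3)^n \<le> N i * (1/3::real)^n" using i(2) by (intro mult_right_mono) auto
    moreover have "(4/3::real)^n = 4^n * (1/3)^n" by (simp add: power_mult_distrib[symmetric])
    ultimately show ?thesis by linarith
  qed
  note upper = this
  obtain n where "4 * c < (4/3::real)^n" using real_arch_pow[of "4/3" "4 * c"] by auto
  with upper[of n] show False by linarith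
qed

text \<open>Uniform boundedness applied to the functionals \<open>u \<mapsto> ip u (B i w) / |w|\<close>. Each
  is bounded by the Cauchy--Schwarz inequality. They are bounded pointwise since skewness turns them
  into \<open>- ip (B i u) w / |w|\<close>. Taking \<open>u = B i w\<close> in the resulting bound
  gives the claim. For a single operator this is the Hellinger--Toeplitz theorem.\<close>

lemma skew_uniformly_bounded:
  assumes B: "\<And>i u. i \<in> I \<Longrightarrow> u \<in> S \<Longrightarrow> B i u \<in> S"
    and skew: "\<And>i u w. i \<in> I \<Longrightarrow> u \<in> S \<Longrightarrow> w \<in> S \<Longrightarrow> ip (B i u) w = - ip u (B i w)"
    and pointwise: "\<And>u. u \<in> S \<Longrightarrow> \<exists>c. \<forall>i\<in>I. norm (B i u) \<le> c"
  shows "\<exists>c\<ge>0. \<forall>i\<in>I. \<forall>u\<in>S. norm (B i u) \<le> c * norm u"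
proof -
  let ?L = "\<lambda>(i, w) u. ip u (B i w) / norm w"
  let ?I = "I \<times> (S - {0})"
  have "\<exists>c. \<forall>j\<in>?I. \<forall>u\<in>S. \<bar>?L j u\<bar> \<le> c * norm u"
  proof (rule uniform_boundedness)
    fix j and u v assume "j \<in> ?I" "u \<in> S" "v \<in> S"
    then show "?L j (u + v) = ?L j u + ?L j v"
      using B by (auto simp: ip_add add_divide_distrib)
  next
    fix j and u and c :: real assume "j \<in> ?I" "u \<in> S"
    then show "?L j (c *\<^sub>R u) = c * ?L j u" using B by (auto simp: ip_scale)
  next
    fix j assume "j \<in> ?I"
    then obtain i w where j: "j = (i, w)" "i \<in> I" "w \<in> S" "w \<noteq> 0" by auto
    have "\<bar>?L j u\<bar> \<le> (norm (B i w) / norm w) * norm u" if "u \<in> S" for u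
    proof -
      have "\<bar>ip u (B i w)\<bar> / norm w \<le> (norm u * norm (B i w)) / norm w"
        using ip_bound[OF that B[OF j(2,3)]] by (intro divide_right_mono) auto
      then show ?thesis using j by (simp add: mult.commute)
    qed
    then show "\<exists>c. \<forall>u\<in>S. \<bar>?L j u\<bar> \<le> c * norm u" by blast
  next
    fix u assume u: "u \<in> S"
    then obtain c where c: "\<forall>i\<in>I. norm (B i u) \<le> c" using pointwise by blast
    have "\<bar>?L j u\<bar> \<le> c" if jI: "j \<in> ?I" for j
    proof -
      obtain i w where j: "j = (i, w)" "i \<in> I" "w \<in> S" "w \<noteq> 0" using jI by auto
      have "\<bar>ip u (B i w)\<bar> = \<bar>ip (B i u) w\<bar>" using skew[OF j(2) u j(3)] by simp
      also have "\<dots> \<le> norm (B i u) * norm w" by (rule ip_bound[OF B[OF j(2) u] j(3)])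
      also have "\<dots> \<le> c * norm w" using c j by (intro mult_right_mono) auto
      finally show ?thesis using j by (simp add: pos_divide_le_eq)
    qed
    then show "\<exists>c. \<forall>j\<in>?I. \<bar>?L j u\<bar> \<le> c" by blast
  qed
  then obtain c where c: "\<And>i w u. i \<in> I \<Longrightarrow> w \<in> S \<Longrightarrow> w \<noteq> 0 \<Longrightarrow> u \<in> S \<Longrightarrow> \<bar>ip u (B i w)\<bar> / norm w \<le> c * norm u"
    by fastforce
  have "norm (B i w) \<le> \<bar>c\<bar> * norm w" if iw: "i \<in> I" "w \<in> S" for i w
  proof (cases "w = 0 \<or> B i w = 0")
    case True
    have S0: "0 \<in> S" by (rule subspace_0[OF subspace_S])
    have "(norm (B i 0))\<^sup>2 = - ip 0 (B i (B i 0))"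
      using skew[OF iw(1) S0 B[OF iw(1) S0]] ip_norm[OF B[OF iw(1) S0]] by simp
    also have "\<dots> = 0" using ip_scale[OF S0 B[OF iw(1) B[OF iw(1) S0]], of 0] by simp
    finally have "B i 0 = 0" by simp
    with True show ?thesis by auto
  next
    case False
    then have "(norm (B i w))\<^sup>2 / norm w \<le> c * norm (B i w)"
      using c[OF iw(1,2) _ B[OF iw]] ip_norm[OF B[OF iw]] by simp
    then have "norm (B i w) * norm (B i w) \<le> (c * norm w) * norm (B i w)"
      using False by (simp add: pos_divide_le_eq power2_eq_square mult_ac)
    then have "norm (B i w) \<le> c * norm w" using False by (simp add: mult_le_cancel_right)
    also have "\<dots> \<le> \<bar>c\<bar> * norm w" by (simp add: mult_right_mono)
    finally show ?thesis .
  qed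
  then show ?thesis by (intro exI[of _ "\<bar>c\<bar>"]) auto
qed

end

section \<open>Smooth families of skew operators\<close>

locale operator_families = finite_onb Bs + real_hilbert_subspace S ip
  for Bs :: "'e::real_inner set" and S :: "'w::banach set" and ip
begin

definition skew_family :: "'e set \<Rightarrow> ('e \<Rightarrow> 'w \<Rightarrow> 'w) \<Rightarrow> bool" where
  "skew_family V B \<longleftrightarrow> (\<forall>y\<in>V. \<forall>u\<in>S. B y u \<in> S \<and> (\<forall>w\<in>S. ip (B y u) w = - ip u (B y w)))"

lemma skew_family_in: "skew_family V B \<Longrightarrow> y \<in> V \<Longrightarrow> u \<in> S \<Longrightarrow> B y u \<in> S"
  and skew_family_ip: "skew_family V B \<Longrightarrow> y \<in> V \<Longrightarrow> u \<in> S \<Longrightarrow> w \<in> S \<Longrightarrow> ip (B y u) w = - ip u (B y w)"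
  by (auto simp: skew_family_def)

lemma skew_family_diff:
  assumes "skew_family V B" "y \<in> V" "u \<in> S" "v \<in> S"
  shows "B y (u - v) = B y u - B y v"
proof (rule ip_eqI)
  have uv: "u - v \<in> S" using assms subspace_S by (simp add: subspace_diff)
  note in_S = skew_family_in[OF assms(1,2)]
  show "B y (u - v) \<in> S" by (rule in_S[OF uv])
  show "B y u - B y v \<in> S" using in_S assms subspace_S by (simp add: subspace_diff)
  fix w assume w: "w \<in> S"
  show "ip (B y (u - v)) w = ip (B y u - B y v) w"
    using skew_family_ip[OF assms(1,2)] w uv assms in_S by (simp add: ip_diff)
qed

lemma skew_family_scale:
  assumes "skew_family V B" "y \<in> V" "u \<in> S"
  shows "B y (c *\<^sub>R u) = c *\<^sub>R B y u"
proof (rule ip_eqI)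
  have cu: "c *\<^sub>R u \<in> S" using assms subspace_S by (simp add: subspace_mul)
  note in_S = skew_family_in[OF assms(1,2)]
  show "B y (c *\<^sub>R u) \<in> S" by (rule in_S[OF cu])
  show "c *\<^sub>R B y u \<in> S" using in_S assms subspace_S by (simp add: subspace_mul)
  fix w assume w: "w \<in> S"
  show "ip (B y (c *\<^sub>R u)) w = ip (c *\<^sub>R B y u) w"
    using skew_family_ip[OF assms(1,2)] w cu assms in_S by (simp add: ip_scale)
qed

text \<open>Strong continuity bounds \<open>B y u\<close> on a compact ball for each \<open>u\<close>; the
  uniform boundedness of skew operators then bounds the operators.\<close>

lemma skew_family_locally_bounded:
  assumes V: "open V" "y0 \<in> V" and B: "skew_family V B"
    and cont: "\<And>u. u \<in> S \<Longrightarrow> continuous_on V (\<lambda>y. B y u)"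
  obtains r c where "r > 0" "cball y0 r \<subseteq> V" "c \<ge> 0"
    "\<And>y u. y \<in> cball y0 r \<Longrightarrow> u \<in> S \<Longrightarrow> norm (B y u) \<le> c * norm u"
proof -
  obtain r where r: "r > 0" "cball y0 r \<subseteq> V" using V open_contains_cball by blast
  have "\<exists>c\<ge>0. \<forall>y\<in>cball y0 r. \<forall>u\<in>S. norm (B y u) \<le> c * norm u"
  proof (rule skew_uniformly_bounded)
    fix u assume u: "u \<in> S"
    have "compact ((\<lambda>y. B y u) ` cball y0 r)"
      by (rule compact_continuous_image[OF continuous_on_subset[OF cont[OF u] r(2)] compact_cball])
    from compact_imp_bounded[OF this] show "\<exists>c. \<forall>y\<in>cball y0 r. norm (B y u) \<le> c"
      by (auto simp: bounded_iff)
  qed (use r(2) skew_family_in[OF B] skew_family_ip[OF B] in auto)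
  with r show ?thesis using that by blast
qed

lemma continuous_apply_family_at:
  assumes V: "open V" "y \<in> V" and B: "skew_family V B"
    and cont: "\<And>u. u \<in> S \<Longrightarrow> continuous_on V (\<lambda>y. B y u)"
    and p: "(p \<longlongrightarrow> y) F" and q: "(q \<longlongrightarrow> u) F" "\<forall>\<^sub>F t in F. q t \<in> S" "u \<in> S"
  shows "((\<lambda>t. B (p t) (q t)) \<longlongrightarrow> B y u) F"
proof -
  obtain r c where rc: "r > 0" "cball y r \<subseteq> V" "c \<ge> 0"
    "\<And>z u. z \<in> cball y r \<Longrightarrow> u \<in> S \<Longrightarrow> norm (B z u) \<le> c * norm u"
    using skew_family_locally_bounded[OF V B cont] by blast
  have evp: "\<forall>\<^sub>F t in F. p t \<in> cball y r"
    using tendstoD[OF p rc(1)] by eventually_elim (simp add: dist_commute less_imp_le)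
  have "((\<lambda>t. B (p t) (q t - u)) \<longlongrightarrow> 0) F"
  proof (rule tendsto_0_le[where K=c])
    show "((\<lambda>t. q t - u) \<longlongrightarrow> 0) F" using q(1) by (rule LIM_zero)
    show "\<forall>\<^sub>F t in F. norm (B (p t) (q t - u)) \<le> norm (q t - u) * c"
      using evp q(2) by eventually_elim
        (use rc(4) q(3) subspace_S in \<open>simp add: subspace_diff mult.commute\<close>)
  qed
  moreover have "((\<lambda>t. B (p t) u) \<longlongrightarrow> B y u) F"
    using isCont_tendsto_compose[OF _ p, of "\<lambda>y. B y u"] cont[OF q(3)] V
    by (simp add: continuous_on_eq_continuous_at)
  ultimately have "((\<lambda>t. B (p t) (q t - u) + B (p t) u) \<longlongrightarrow> 0 + B y u) F" by (rule tendsto_add)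
  moreover have "\<forall>\<^sub>F t in F. B (p t) (q t - u) + B (p t) u = B (p t) (q t)"
    using evp q(2) by eventually_elim (use skew_family_diff[OF B] q(3) rc(2) in auto)
  ultimately show ?thesis using Lim_transform_eventually by fastforce
qed

lemma ddir_in_S:
  assumes V: "open V" "y \<in> V" and f: "\<And>y. y \<in> V \<Longrightarrow> f y \<in> S" and d: "has_ddir f v d y"
  shows "d \<in> S" and "\<forall>\<^sub>F t in at 0. (f (y + t *\<^sub>R v) - f y) /\<^sub>R t \<in> S"
proof -
  show ev: "\<forall>\<^sub>F t in at 0. (f (y + t *\<^sub>R v) - f y) /\<^sub>R t \<in> S"
    unfolding eventually_at_filter using eventually_line_in_open[OF V, of v]
    by eventually_elim (use f V subspace_S in \<open>simp add: subspace_mul subspace_diff\<close>)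
  show "d \<in> S"
    by (rule Lim_in_closed_set[OF closed_S ev _ d[unfolded has_ddir_iff_quotient]]) simp
qed

text \<open>The product rule for a family of operators whose dependence on the point is only known after
  evaluation at a fixed vector. The derivative of such a family is again a family of everywhere
  defined skew operators, so the induction on the order closes up. Local boundedness is what allows
  one to apply the operators to a vector that moves with the point.\<close>

lemma Ck_on_apply_family:
  assumes V: "open V" and "skew_family V B" "\<And>u. u \<in> S \<Longrightarrow> Ck_on k V (\<lambda>y. B y u)"
    and "Ck_on k V f" "\<And>y. y \<in> V \<Longrightarrow> f y \<in> S"
  shows "Ck_on k V (\<lambda>y. B y (f y))"
  using assms(2-)
proof (induction k arbitrary: B f)
  have cont: "continuous_on V (\<lambda>y. B y (f y))" if B: "skew_family V B"
    and Bu: "\<And>u. u \<in> S \<Longrightarrow> continuous_on V (\<lambda>y. B y u)"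
    and f: "continuous_on V f" "\<And>y. y \<in> V \<Longrightarrow> f y \<in> S" for B f
    unfolding continuous_on_def
  proof
    fix y assume y: "y \<in> V"
    show "((\<lambda>y. B y (f y)) \<longlongrightarrow> B y (f y)) (at y within V)"
      by (rule continuous_apply_family_at[OF V y B Bu])
        (use f y in \<open>auto simp: continuous_on_def eventually_at_filter\<close>)
  qed
  {
    case 0 then show ?case using cont by simp
  next
    case (Suc k)
    have Bc: "continuous_on V (\<lambda>y. B y u)" if "u \<in> S" for u
      using Suc.prems(2)[OF that] by simp
    have Bd: "Ck_on k V (ddir (\<lambda>y. B y u) v)" "y \<in> V \<Longrightarrow> has_ddir (\<lambda>y. B y u) v (ddir (\<lambda>y. B y u) v y) y"
      if "u \<in> S" for u v y
      using Suc.prems(2)[OF that] unfolding Ck_on_Suc_iff[OF V] by auto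
    let ?B' = "\<lambda>v y u. ddir (\<lambda>y. B y u) v y"
    have BS: "B y u \<in> S" if "y \<in> V" "u \<in> S" for y u using skew_family_in[OF Suc.prems(1) that] .
    have skew': "skew_family V (?B' v)" for v
      unfolding skew_family_def
    proof (intro ballI conjI)
      fix y u assume y: "y \<in> V" and u: "u \<in> S"
      have inS: "?B' v y u \<in> S" "\<forall>\<^sub>F t in at 0. (B (y + t *\<^sub>R v) u - B y u) /\<^sub>R t \<in> S" if "u \<in> S" for u
        using ddir_in_S[where f="\<lambda>y. B y u", OF V y BS[OF _ that] Bd(2)[OF that y]] by auto
      show "?B' v y u \<in> S" by (rule inS(1)[OF u])
      fix w assume w: "w \<in> S"
      let ?q = "\<lambda>u t. (B (y + t *\<^sub>R v) u - B y u) /\<^sub>R t"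
      have "((\<lambda>t. ip (?q u t) w) \<longlongrightarrow> ip (?B' v y u) w) (at 0)"
        by (rule tendsto_ip[OF Bd(2)[OF u y, unfolded has_ddir_iff_quotient[of "\<lambda>y. B y u"]] inS(2)[OF u] inS(1)[OF u] w])
      moreover have "((\<lambda>t. ip (?q w t) u) \<longlongrightarrow> ip (?B' v y w) u) (at 0)"
        by (rule tendsto_ip[OF Bd(2)[OF w y, unfolded has_ddir_iff_quotient[of "\<lambda>y. B y w"]] inS(2)[OF w] inS(1)[OF w] u])
      then have "((\<lambda>t. - ip (?q w t) u) \<longlongrightarrow> - ip (?B' v y w) u) (at 0)" by (rule tendsto_minus)
      then have "((\<lambda>t. ip (?q u t) w) \<longlongrightarrow> - ip (?B' v y w) u) (at 0)"
      proof (rule Lim_transform_eventually)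
        show "\<forall>\<^sub>F t in at 0. - ip (?q w t) u = ip (?q u t) w"
          unfolding eventually_at_filter using eventually_line_in_open[OF V y, of v]
        proof eventually_elim
          case (elim t)
          have s: "B (y + t *\<^sub>R v) u \<in> S" "B (y + t *\<^sub>R v) w \<in> S" "B y u \<in> S" "B y w \<in> S"
            using BS elim y u w by auto
          have "ip (B (y + t *\<^sub>R v) u) w = - ip (B (y + t *\<^sub>R v) w) u" "ip (B y u) w = - ip (B y w) u"
            using skew_family_ip[OF Suc.prems(1) elim u w] skew_family_ip[OF Suc.prems(1) y u w]
              ip_sym[OF u s(2)] ip_sym[OF u s(4)] by simp_all
          then show ?case using s u w subspace_S
            by (simp add: ip_scale ip_diff subspace_diff; simp add: algebra_simps)
        qed
      qed
      ultimately have "ip (?B' v y u) w = - ip (?B' v y w) u"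
        by (rule tendsto_unique[OF trivial_limit_at])
      then show "ip (?B' v y u) w = - ip u (?B' v y w)" using ip_sym[OF u inS(1)[OF w]] by simp
    qed
    obtain f' where f': "\<And>v. Ck_on k V (f' v)" "\<And>v y. y \<in> V \<Longrightarrow> has_ddir f v (f' v y) y"
      using Suc.prems(3) by (rule Ck_on_SucE) (rule that)
    have f'S: "f' v y \<in> S" if "y \<in> V" for v y
      using ddir_in_S(1)[OF V that Suc.prems(4) f'(2)[OF that]] by blast
    have fk: "Ck_on k V f" using Ck_on_SucD[OF Suc.prems(3)] .
    have c: "continuous_on V (\<lambda>y. B y (f y))"
      using cont[OF Suc.prems(1) Bc _ Suc.prems(4)] Suc.prems(3) by auto
    have 1: "Ck_on k V (\<lambda>y. ?B' v y (f y) + B y (f' v y))" for v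
      by (rule Ck_on_add[OF Suc.IH[OF skew' Bd(1) fk Suc.prems(4)]
            Suc.IH[OF Suc.prems(1) Ck_on_SucD[OF Suc.prems(2)] f'(1) f'S]])
    have 2: "has_ddir (\<lambda>y. B y (f y)) v (?B' v y (f y) + B y (f' v y)) y" if y: "y \<in> V" for v y
    proof (rule has_ddir_iff_quotient[of "\<lambda>y. B y (f y)", THEN iffD2])
      let ?q = "\<lambda>t. (f (y + t *\<^sub>R v) - f y) /\<^sub>R t"
      have fy: "f y \<in> S" using Suc.prems(4) y .
      have p: "((\<lambda>t. y + t *\<^sub>R v) \<longlongrightarrow> y) (at 0)"
        using tendsto_add[OF tendsto_const[of y] tendsto_scaleR[OF tendsto_ident_at[of "0::real"] tendsto_const[of v]]] by simp
      have "((\<lambda>t. B (y + t *\<^sub>R v) (?q t)) \<longlongrightarrow> B y (f' v y)) (at 0)"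
        by (rule continuous_apply_family_at[OF V y Suc.prems(1) Bc p f'(2)[OF y, unfolded has_ddir_iff_quotient]
              ddir_in_S(2)[OF V y Suc.prems(4) f'(2)[OF y]] f'S[OF y]])
      moreover have "((\<lambda>t. (B (y + t *\<^sub>R v) (f y) - B y (f y)) /\<^sub>R t) \<longlongrightarrow> ?B' v y (f y)) (at 0)"
        using Bd(2)[OF fy y] by (rule has_ddir_iff_quotient[of "\<lambda>z. B z (f y)", THEN iffD1])
      ultimately have "((\<lambda>t. (B (y + t *\<^sub>R v) (f y) - B y (f y)) /\<^sub>R t + B (y + t *\<^sub>R v) (?q t))
          \<longlongrightarrow> ?B' v y (f y) + B y (f' v y)) (at 0)" by (intro tendsto_add)
      then show "((\<lambda>t. (B (y + t *\<^sub>R v) (f (y + t *\<^sub>R v)) - B y (f y)) /\<^sub>R t)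
          \<longlongrightarrow> ?B' v y (f y) + B y (f' v y)) (at 0)"
      proof (rule Lim_transform_eventually)
        show "\<forall>\<^sub>F t in at 0. (B (y + t *\<^sub>R v) (f y) - B y (f y)) /\<^sub>R t + B (y + t *\<^sub>R v) (?q t) =
            (B (y + t *\<^sub>R v) (f (y + t *\<^sub>R v)) - B y (f y)) /\<^sub>R t"
          unfolding eventually_at_filter using eventually_line_in_open[OF V y, of v]
        proof eventually_elim
          case (elim t)
          have s: "f (y + t *\<^sub>R v) \<in> S" using Suc.prems(4) elim .
          have "B (y + t *\<^sub>R v) (?q t) = (B (y + t *\<^sub>R v) (f (y + t *\<^sub>R v)) - B (y + t *\<^sub>R v) (f y)) /\<^sub>R t"
            using skew_family_scale[OF Suc.prems(1) elim, of "f (y + t *\<^sub>R v) - f y"]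
              skew_family_diff[OF Suc.prems(1) elim s fy] s fy subspace_S by (simp add: subspace_diff)
          then show ?case by (simp add: scaleR_add_right[symmetric])
        qed
      qed
    qed
    show ?case by (rule Ck_on_SucI[OF c 1 2])
  }
qed

end

section \<open>Unitary maps and finite-rank approximation\<close>

text \<open>Linearity is automatic: both sides of each identity have the same inner product with every vector
  in the image.\<close>

lemma unitary_mapI:
  assumes V: "complex_hilbert_space V" and W: "complex_hilbert_space W"
    and onto: "T ` hcarrier V = hcarrier W"
    and iso: "\<And>x y. x \<in> hcarrier V \<Longrightarrow> y \<in> hcarrier V \<Longrightarrow> hinner W (T x) (T y) = hinner V x y"
  shows "unitary_map V W T"
proof -
  interpret V: complex_hilbert_space V by fact
  interpret W: complex_hilbert_space W by fact
  have T: "T x \<in> hcarrier W" if "x \<in> hcarrier V" for x using onto that by blast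
  have "T (hadd V x y) = hadd W (T x) (T y)" if "x \<in> hcarrier V" "y \<in> hcarrier V" for x y
  proof (rule W.inner_eqI)
    fix z assume "z \<in> hcarrier W"
    then obtain z' where "z = T z'" "z' \<in> hcarrier V" using onto by blast
    then show "hinner W (T (hadd V x y)) z = hinner W (hadd W (T x) (T y)) z"
      using that T by (simp add: iso V.add_closed V.inner_add W.inner_add)
  qed (use that T in \<open>auto simp: V.add_closed W.add_closed\<close>)
  moreover have "T (hscale V a x) = hscale W a (T x)" if "x \<in> hcarrier V" for a x
  proof (rule W.inner_eqI)
    fix z assume "z \<in> hcarrier W"
    then obtain z' where "z = T z'" "z' \<in> hcarrier V" using onto by blast
    then show "hinner W (T (hscale V a x)) z = hinner W (hscale W a (T x)) z"
      using that T by (simp add: iso V.scale_closed V.inner_scale W.inner_scale)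
  qed (use that T in \<open>auto simp: V.scale_closed W.scale_closed\<close>)
  ultimately show ?thesis unfolding unitary_map_def using onto iso by blast
qed

context complex_hilbert_space
begin

definition unembed :: "'v bfun \<Rightarrow> 'v" where
  "unembed = inv_into (hcarrier V) J"

lemma unembed: "x \<in> hcarrier V \<Longrightarrow> unembed (J x) = x"
  unfolding unembed_def by (rule inv_into_f_f) (auto intro: inj_onI embed_inj)

text \<open>The real inner product of the Hilbert space, carried over to its image under
  \<^const>\<open>embed\<close>.\<close>

definition hip :: "'v bfun \<Rightarrow> 'v bfun \<Rightarrow> real" where
  "hip p q = Re (hinner V (unembed p) (unembed q))"

lemma hip_embed: "x \<in> hcarrier V \<Longrightarrow> y \<in> hcarrier V \<Longrightarrow> hip (J x) (J y) = Re (hinner V x y)"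
  by (simp add: hip_def unembed)

lemma real_hilbert_subspace_embed: "real_hilbert_subspace (J ` hcarrier V) hip"
proof
  show "subspace (J ` hcarrier V)"
  proof (rule subspaceI)
    show "0 \<in> J ` hcarrier V" using embed_zero zero_closed by (metis image_eqI)
    show "p + q \<in> J ` hcarrier V" if "p \<in> J ` hcarrier V" "q \<in> J ` hcarrier V" for p q
      using that by (auto simp: embed_add[symmetric] add_closed)
    show "c *\<^sub>R p \<in> J ` hcarrier V" if "p \<in> J ` hcarrier V" for c p
      using that by (auto simp: embed_scale_real[symmetric] scale_closed)
  qed
  show "closed (J ` hcarrier V)" by (rule closed_embed)
next
  fix u v w c assume "u \<in> J ` hcarrier V" "v \<in> J ` hcarrier V" "w \<in> J ` hcarrier V"
  then obtain x y z where xyz: "x \<in> hcarrier V" "y \<in> hcarrier V" "z \<in> hcarrier V"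
    "u = J x" "v = J y" "w = J z" by blast
  show "hip (u + v) w = hip u w + hip v w"
    using xyz by (simp add: embed_add[symmetric] hip_embed add_closed inner_add)
next
  fix u w c assume "u \<in> J ` hcarrier V" "w \<in> J ` hcarrier V"
  then obtain x z where xz: "x \<in> hcarrier V" "z \<in> hcarrier V" "u = J x" "w = J z" by blast
  show "hip (c *\<^sub>R u) w = c * hip u w"
    using xz by (simp add: embed_scale_real[symmetric] hip_embed scale_closed inner_scale)
  show "hip u w = hip w u" using xz inner_cnj[OF xz(1,2)] by (simp add: hip_embed)
next
  fix u assume "u \<in> J ` hcarrier V"
  then show "hip u u = (norm u)\<^sup>2" by (auto simp: hip_embed norm_embed inner_self)
qed

definition orthonormal_set :: "'v set \<Rightarrow> bool" where
  "orthonormal_set E \<longleftrightarrow> finite E \<and> E \<subseteq> hcarrier V \<and>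
     (\<forall>e\<in>E. \<forall>f\<in>E. hinner V e f = (if e = f then 1 else 0))"

lemma linear_combination_exists:
  assumes "finite E" "E \<subseteq> hcarrier V"
  shows "\<exists>p\<in>hcarrier V. J p = (\<Sum>e\<in>E. cscale (c e) (J e)) \<and>
     (\<forall>z\<in>hcarrier V. hinner V p z = (\<Sum>e\<in>E. c e * hinner V e z))"
  using assms
proof (induction E rule: finite_induct)
  case empty
  show ?case by (rule bexI[OF _ zero_closed]) (simp add: embed_zero inner_zero)
next
  case (insert e E)
  then obtain p where p: "p \<in> hcarrier V" "J p = (\<Sum>e\<in>E. cscale (c e) (J e))"
    "\<forall>z\<in>hcarrier V. hinner V p z = (\<Sum>e\<in>E. c e * hinner V e z)" by auto
  have e: "e \<in> hcarrier V" using insert by auto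
  show ?case
    by (rule bexI[of _ "hadd V (hscale V (c e) e) p"])
      (use insert p e in \<open>simp_all add: embed_add embed_scale scale_closed inner_add inner_scale add_closed\<close>)
qed

text \<open>The orthogonal projection \<open>p\<close> of \<open>w\<close> to the span of \<open>E\<close> and
  the remainder \<open>q\<close>.\<close>

lemma orthonormal_projection:
  assumes E: "orthonormal_set E" and w: "w \<in> hcarrier V"
  obtains p q where "p \<in> hcarrier V" "q \<in> hcarrier V" "J p = (\<Sum>e\<in>E. cscale (hinner V w e) (J e))"
    "J q = J w - J p" "\<And>z. z \<in> hcarrier V \<Longrightarrow> hinner V p z = (\<Sum>e\<in>E. hinner V w e * hinner V e z)"
    "\<And>e. e \<in> E \<Longrightarrow> hinner V q e = 0" "hnorm V q \<le> hnorm V w" "q = hsub V w p"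
proof -
  have E': "finite E" "E \<subseteq> hcarrier V" using E by (auto simp: orthonormal_set_def)
  obtain p where p: "p \<in> hcarrier V" "J p = (\<Sum>e\<in>E. cscale (hinner V w e) (J e))"
    "\<And>z. z \<in> hcarrier V \<Longrightarrow> hinner V p z = (\<Sum>e\<in>E. hinner V w e * hinner V e z)"
    using linear_combination_exists[OF E', of "hinner V w"] by blast
  let ?q = "hsub V w p"
  have q: "?q \<in> hcarrier V" using w p(1) by (rule sub_closed)
  have orth: "hinner V ?q e = 0" if "e \<in> E" for e
  proof -
    have "e \<in> hcarrier V" using that E' by auto
    moreover have "(\<Sum>f\<in>E. hinner V w f * hinner V f e) = (\<Sum>f\<in>E. if f = e then hinner V w e else 0)"
      by (rule sum.cong) (use E that in \<open>auto simp: orthonormal_set_def\<close>)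
    ultimately show ?thesis using that E'(1) by (simp add: inner_sub w p)
  qed
  have "hinner V p ?q = 0"
  proof -
    have "hinner V e ?q = 0" if "e \<in> E" for e
      using orth[OF that] inner_cnj[OF q] that E'(2) by (metis complex_cnj_zero subsetD)
    then show ?thesis using p(3)[OF q] by simp
  qed
  then have "hinner V ?q ?q = hinner V ?q w"
    using inner_sub_right[OF w p(1) q] inner_cnj[OF p(1) q] by simp
  then have "(hnorm V ?q)\<^sup>2 = cmod (hinner V ?q w)"
    by (metis abs_power2 inner_self norm_of_real q)
  also have "\<dots> \<le> hnorm V ?q * hnorm V w" by (rule Cauchy_Schwarz[OF q w])
  finally have "hnorm V ?q * hnorm V ?q \<le> hnorm V ?q * hnorm V w" by (simp add: power2_eq_square)
  then have "hnorm V ?q \<le> hnorm V w"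
    using hnorm_nonneg[OF q] hnorm_nonneg[OF w] by (cases "hnorm V ?q = 0") (auto simp: mult_le_cancel_left)
  then show ?thesis using that[OF p(1) q p(2) _ p(3) orth] by (simp add: embed_sub w p(1))
qed

text \<open>That \<open>A\<close> lies in the span of \<open>E\<close> is expressed by Parseval's identity
  against every \<open>z\<close>, which avoids sums of vectors in a carrier set.\<close>

lemma Gram_Schmidt:
  assumes "finite A" "A \<subseteq> hcarrier V"
  shows "\<exists>E. orthonormal_set E \<and>
    (\<forall>a\<in>A. \<forall>z\<in>hcarrier V. hinner V a z = (\<Sum>e\<in>E. hinner V a e * hinner V e z))"
  using assms
proof (induction A rule: finite_induct)
  case empty
  show ?case by (rule exI[of _ "{}"]) (simp add: orthonormal_set_def)
next
  case (insert a A)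
  then obtain E where E: "orthonormal_set E"
    and span: "\<And>a z. a \<in> A \<Longrightarrow> z \<in> hcarrier V \<Longrightarrow> hinner V a z = (\<Sum>e\<in>E. hinner V a e * hinner V e z)"
    by auto
  have a: "a \<in> hcarrier V" using insert by auto
  have E': "finite E" "E \<subseteq> hcarrier V" using E by (auto simp: orthonormal_set_def)
  obtain p q where pq0: "p \<in> hcarrier V" "q \<in> hcarrier V" "J p = (\<Sum>e\<in>E. cscale (hinner V a e) (J e))"
      "J q = J a - J p" "\<And>z. z \<in> hcarrier V \<Longrightarrow> hinner V p z = (\<Sum>e\<in>E. hinner V a e * hinner V e z)"
      "\<And>e. e \<in> E \<Longrightarrow> hinner V q e = 0" "hnorm V q \<le> hnorm V a" "q = hsub V a p"
    by (rule orthonormal_projection[OF E a]) (rule that)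
  note pq = pq0(1,2,5,6,8)
  have az: "hinner V a z = (\<Sum>e\<in>E. hinner V a e * hinner V e z) + hinner V q z" if "z \<in> hcarrier V" for z
    using that pq a by (simp add: inner_sub)
  have eq0: "hinner V e q = 0" if "e \<in> E" for e
    using pq(4)[OF that] inner_cnj[OF pq(2)] that E'(2) by (metis complex_cnj_zero subsetD)
  show ?case
  proof (cases "hnorm V q = 0")
    case True
    have "hinner V q z = 0" if "z \<in> hcarrier V" for z
      using Cauchy_Schwarz[OF pq(2) that] True by simp
    then show ?thesis using E span az by (intro exI[of _ E]) auto
  next
    case False
    then have n: "hnorm V q > 0" using hnorm_nonneg[OF pq(2)] by simp
    let ?r = "complex_of_real (inverse (hnorm V q))"
    let ?e = "hscale V ?r q"
    have e: "?e \<in> hcarrier V" using pq(2) by (rule scale_closed)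
    have ee: "hinner V ?e ?e = 1"
    proof -
      have "hinner V ?e ?e = ?r * (?r * complex_of_real ((hnorm V q)\<^sup>2))"
        unfolding inner_scale[OF pq(2) e] inner_scale_right[OF pq(2) pq(2)] inner_self[OF pq(2)] complex_cnj_complex_of_real ..
      also have "\<dots> = complex_of_real (inverse (hnorm V q) * (inverse (hnorm V q) * (hnorm V q)\<^sup>2))"
        by (simp only: of_real_mult)
      also have "inverse (hnorm V q) * (inverse (hnorm V q) * (hnorm V q)\<^sup>2) = 1"
        using n by (simp add: power2_eq_square field_simps)
      finally show ?thesis by simp
    qed
    have ef: "hinner V ?e f = 0" "hinner V f ?e = 0" if "f \<in> E" for f
      using pq(4)[OF that] eq0[OF that] that E'(2) by (auto simp: inner_scale inner_scale_right pq(2) subsetD)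
    have notin: "?e \<notin> E" using ee ef(1)[of ?e] by auto
    have on: "orthonormal_set (insert ?e E)"
      using E e ee ef notin by (auto simp: orthonormal_set_def)
    have ae: "hinner V a ?e * hinner V ?e z = hinner V q z" if z: "z \<in> hcarrier V" for z
    proof -
      have "hinner V a ?e = hinner V q ?e" using az[OF e] ef by simp
      then have "hinner V a ?e = ?r * complex_of_real ((hnorm V q)\<^sup>2)"
        unfolding inner_scale_right[OF pq(2) pq(2)] inner_self[OF pq(2)] complex_cnj_complex_of_real .
      then have "hinner V a ?e * hinner V ?e z = complex_of_real (inverse (hnorm V q) * (inverse (hnorm V q) * (hnorm V q)\<^sup>2)) * hinner V q z"
        unfolding inner_scale[OF pq(2) z] by (simp only: of_real_mult mult_ac)
      also have "inverse (hnorm V q) * (inverse (hnorm V q) * (hnorm V q)\<^sup>2) = 1"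
        using n by (simp add: power2_eq_square field_simps)
      finally show ?thesis by simp
    qed
    have old: "hinner V a' ?e = 0" if "a' \<in> A" for a'
      using span[OF that e] ef by simp
    show ?thesis
      by (intro exI[of _ "insert ?e E"] conjI on)
        (use E'(1) notin ae az old span in auto)
  qed
qed

text \<open>The orthogonal projection to the span of \<open>E\<close>, which contains \<open>A\<close>, fixes
  \<open>a\<close> and has norm at most 1, so it moves \<open>w\<close> by at most the distance from
  \<open>w\<close> to \<open>a\<close>.\<close>

lemma finite_rank_approximation:
  assumes "finite A" "A \<subseteq> hcarrier V"
  obtains E where "orthonormal_set E"
    "\<And>w a. w \<in> hcarrier V \<Longrightarrow> a \<in> A \<Longrightarrow>
      norm (J w - (\<Sum>e\<in>E. cscale (hinner V w e) (J e))) \<le> norm (J w - J a)"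
    "\<And>w. w \<in> hcarrier V \<Longrightarrow> (\<Sum>e\<in>E. cscale (hinner V w e) (J e)) \<in> J ` hcarrier V"
proof -
  obtain E where E: "orthonormal_set E"
    and span: "\<And>a z. a \<in> A \<Longrightarrow> z \<in> hcarrier V \<Longrightarrow> hinner V a z = (\<Sum>e\<in>E. hinner V a e * hinner V e z)"
    using Gram_Schmidt[OF assms] by blast
  let ?P = "\<lambda>w. \<Sum>e\<in>E. cscale (hinner V w e) (J e)"
  have EV: "e \<in> hcarrier V" if "e \<in> E" for e using E that by (auto simp: orthonormal_set_def)
  have Pa: "?P a = J a" if "a \<in> A" for a
  proof -
    have a: "a \<in> hcarrier V" using that assms by auto
    obtain p q where p0: "p \<in> hcarrier V" "q \<in> hcarrier V" "J p = (\<Sum>e\<in>E. cscale (hinner V a e) (J e))"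
      "J q = J a - J p" "\<And>z. z \<in> hcarrier V \<Longrightarrow> hinner V p z = (\<Sum>e\<in>E. hinner V a e * hinner V e z)"
      "\<And>e. e \<in> E \<Longrightarrow> hinner V q e = 0" "hnorm V q \<le> hnorm V a" "q = hsub V a p"
      by (rule orthonormal_projection[OF E a]) (rule that)
    note p = p0(1,3,5)
    have "p = a" by (rule inner_eqI[OF p(1) a]) (simp add: p(3) span[OF that, symmetric])
    then show ?thesis using p(2) by simp
  qed
  show ?thesis
  proof (rule that[OF E])
    fix w a assume w: "w \<in> hcarrier V" and "a \<in> A"
    then have a: "a \<in> hcarrier V" using assms by auto
    let ?d = "hsub V w a"
    have d: "?d \<in> hcarrier V" using w a by (rule sub_closed)
    obtain p q where pq0: "p \<in> hcarrier V" "q \<in> hcarrier V" "J p = (\<Sum>e\<in>E. cscale (hinner V ?d e) (J e))"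
      "J q = J ?d - J p" "\<And>z. z \<in> hcarrier V \<Longrightarrow> hinner V p z = (\<Sum>e\<in>E. hinner V ?d e * hinner V e z)"
      "\<And>e. e \<in> E \<Longrightarrow> hinner V q e = 0" "hnorm V q \<le> hnorm V ?d" "q = hsub V ?d p"
      by (rule orthonormal_projection[OF E d]) (rule that)
    note pq = pq0(3,4,7,2)
    have "?P ?d = ?P w - ?P a"
      by (simp add: inner_sub w a EV sum_subtractf[symmetric] bounded_bilinear.diff_left[OF bounded_bilinear_cscale])
    then have "J q = J w - ?P w" using pq(1,2) Pa[OF \<open>a \<in> A\<close>] by (simp add: embed_sub w a)
    then show "norm (J w - ?P w) \<le> norm (J w - J a)"
      using pq(3) norm_embed[OF pq(4)] norm_embed[OF d] by (simp add: embed_sub w a)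
  next
    fix w assume "w \<in> hcarrier V"
    have "finite E" "E \<subseteq> hcarrier V" using E by (auto simp: orthonormal_set_def)
    from linear_combination_exists[OF this, of "hinner V w"] obtain p
      where "p \<in> hcarrier V" "J p = ?P w" by blast
    then show "?P w \<in> J ` hcarrier V" by (intro image_eqI[of _ _ p]) auto
  qed
qed

end

section \<open>Smooth functions and coordinate fields on a manifold\<close>

locale smooth_mfd = finite_onb Bs
  for Bs :: "'e::real_inner set" +
  fixes M :: "('n::{t2_space,second_countable_topology}, 'e) atlas"
  assumes mfd: "smooth_manifold M"
begin

lemma
  assumes "(D, c) \<in> M"
  shows chart_open: "open D" and chart_image_open: "open (c ` D)"
    and chart_homeo: "homeomorphism D (c ` D) c (inv_into D c)"
  using mfd assms unfolding smooth_manifold_def by auto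

lemma chart_cover: "\<exists>(D, c)\<in>M. x \<in> D"
proof -
  have "(\<Union>(D, c)\<in>M. D) = UNIV" using mfd unfolding smooth_manifold_def by blast
  then have "x \<in> (\<Union>(D, c)\<in>M. D)" by simp
  then show ?thesis by blast
qed

lemma transition: "(D, c) \<in> M \<Longrightarrow> (D', c') \<in> M \<Longrightarrow> Ck_on k (c ` (D \<inter> D')) (c' \<circ> inv_into D c)"
  using mfd unfolding smooth_manifold_def by fast

lemma chart_inverse:
  assumes "(D, c) \<in> M"
  shows "x \<in> D \<Longrightarrow> inv_into D c (c x) = x" "y \<in> c ` D \<Longrightarrow> c (inv_into D c y) = y"
    "y \<in> c ` D \<Longrightarrow> inv_into D c y \<in> D"
  using chart_homeo[OF assms] by (auto simp: homeomorphism_def)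

lemma chart_image_open_Int:
  assumes "(D, c) \<in> M" "open U"
  shows "open (c ` (D \<inter> U))"
  using homeomorphism_imp_open_map[OF chart_homeo[OF assms(1)], of "D \<inter> U"]
    chart_image_open[OF assms(1)] assms(2) openin_open_trans by (metis openin_open_Int)

lemma Cinf_iff: "f \<in> Cinf M U \<longleftrightarrow> (\<forall>D c k. (D, c) \<in> M \<longrightarrow> Ck_on k (c ` (D \<inter> U)) (f \<circ> inv_into D c))"
  unfolding Cinf_def by auto

lemma Cinf_subset: "f \<in> Cinf M U \<Longrightarrow> W \<subseteq> U \<Longrightarrow> f \<in> Cinf M W"
  unfolding Cinf_iff by (meson Ck_on_subset Int_mono image_mono subset_refl)

lemma Cinf_cong:
  assumes "open U" "\<And>x. x \<in> U \<Longrightarrow> f x = g x" "f \<in> Cinf M U"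
  shows "g \<in> Cinf M U"
  unfolding Cinf_iff
proof (intro allI impI)
  fix D c k assume C: "(D, c) \<in> M"
  have "Ck_on k (c ` (D \<inter> U)) (f \<circ> inv_into D c)" using assms(3) C unfolding Cinf_iff by blast
  moreover have "(f \<circ> inv_into D c) y = (g \<circ> inv_into D c) y" if "y \<in> c ` (D \<inter> U)" for y
    using that assms(2) chart_inverse[OF C] by auto
  ultimately show "Ck_on k (c ` (D \<inter> U)) (g \<circ> inv_into D c)"
    using Ck_on_cong[OF chart_image_open_Int[OF C assms(1)], of "f \<circ> inv_into D c" "g \<circ> inv_into D c" k]
    by blast
qed

lemma Cinf_local:
  assumes "open U" "\<And>x. x \<in> U \<Longrightarrow> \<exists>W. open W \<and> x \<in> W \<and> f \<in> Cinf M (W \<inter> U)"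
  shows "f \<in> Cinf M U"
  unfolding Cinf_iff
proof (intro allI impI)
  fix D c k assume C: "(D, c) \<in> M"
  show "Ck_on k (c ` (D \<inter> U)) (f \<circ> inv_into D c)"
  proof (rule Ck_on_local[OF chart_image_open_Int[OF C assms(1)]])
    fix y assume "y \<in> c ` (D \<inter> U)"
    then obtain x where x: "x \<in> D" "x \<in> U" "y = c x" by blast
    obtain W where W: "open W" "x \<in> W" "f \<in> Cinf M (W \<inter> U)" using assms(2)[OF x(2)] by blast
    have inj: "inj_on c D" using chart_inverse(1)[OF C] by (rule inj_on_inverseI)
    have "c ` (D \<inter> W) \<inter> c ` (D \<inter> U) = c ` (D \<inter> (W \<inter> U))"
      using inj_on_image_Int[OF inj, of "D \<inter> W" "D \<inter> U"] by (simp add: Int_ac)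
    moreover have "Ck_on k (c ` (D \<inter> (W \<inter> U))) (f \<circ> inv_into D c)"
      using W(3) C unfolding Cinf_iff by blast
    ultimately show "\<exists>W. open W \<and> y \<in> W \<and> Ck_on k (W \<inter> c ` (D \<inter> U)) (f \<circ> inv_into D c)"
      using chart_image_open_Int[OF C W(1)] x W(2) by (metis IntI imageI)
  qed
qed

lemma Cinf_const: "(\<lambda>x. a) \<in> Cinf M U"
  unfolding Cinf_iff o_def by (blast intro: Ck_on_const)

lemma Cinf_add: "f \<in> Cinf M U \<Longrightarrow> g \<in> Cinf M U \<Longrightarrow> (\<lambda>x. f x + g x) \<in> Cinf M U"
  unfolding Cinf_iff o_def by (intro allI impI Ck_on_add; blast)

lemma Cinf_mult: "f \<in> Cinf M U \<Longrightarrow> g \<in> Cinf M U \<Longrightarrow> (\<lambda>x. f x * g x) \<in> Cinf M U"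
  unfolding Cinf_iff o_def by (intro allI impI Ck_on_mult; blast)

lemma Cinf_cnj: "f \<in> Cinf M U \<Longrightarrow> (\<lambda>x. cnj (f x)) \<in> Cinf M U"
  unfolding Cinf_iff o_def by (intro allI impI Ck_on_linear[OF bounded_linear_cnj]; blast)

lemma Cinf_cnj_iff: "(\<lambda>x. cnj (f x)) \<in> Cinf M U \<longleftrightarrow> f \<in> Cinf M U"
  using Cinf_cnj[of f U] Cinf_cnj[of "\<lambda>x. cnj (f x)" U] by auto

lemma Cinf_sum: "finite I \<Longrightarrow> (\<And>i. i \<in> I \<Longrightarrow> f i \<in> Cinf M U) \<Longrightarrow> (\<lambda>x. \<Sum>i\<in>I. f i x) \<in> Cinf M U"
  by (induction I rule: finite_induct) (auto intro: Cinf_const Cinf_add)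

lemma Ck_on_change_of_chart:
  fixes f :: "'n \<Rightarrow> 'b::real_normed_vector"
  assumes C: "(D, c) \<in> M" and C': "(D', c') \<in> M" and U: "open U" "U \<subseteq> D"
    and f: "Ck_on k (c ` U) (\<lambda>y. f (inv_into D c y))"
  shows "Ck_on k (c' ` (D' \<inter> U)) (\<lambda>y. f (inv_into D' c' y))"
proof -
  have oU: "open (c ` U)" using chart_image_open_Int[OF C U(1)] U(2) by (simp add: Int_absorb1)
  have tr: "Ck_on k (c' ` (D' \<inter> U)) (c \<circ> inv_into D' c')"
    using Ck_on_subset[OF transition[OF C' C]] U(2) by (metis Int_mono image_mono subset_refl)
  have im: "(c \<circ> inv_into D' c') ` (c' ` (D' \<inter> U)) \<subseteq> c ` U"
    using chart_inverse(1)[OF C'] by auto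
  have "Ck_on k (c' ` (D' \<inter> U)) (\<lambda>x. f (inv_into D c ((c \<circ> inv_into D' c') x)))"
    using Ck_on_compose[OF oU im tr f] .
  moreover have "f (inv_into D c ((c \<circ> inv_into D' c') y)) = f (inv_into D' c' y)" if "y \<in> c' ` (D' \<inter> U)" for y
    using that chart_inverse(1)[OF C'] chart_inverse(1)[OF C] U(2) by auto
  ultimately show ?thesis
    using Ck_on_cong[OF chart_image_open_Int[OF C' U(1)],
        of "\<lambda>x. f (inv_into D c ((c \<circ> inv_into D' c') x))" "\<lambda>y. f (inv_into D' c' y)" k] by blast
qed

lemma Cinf_chartI:
  assumes C: "(D, c) \<in> M" and U: "open U" "U \<subseteq> D" and f: "\<And>k. Ck_on k (c ` U) (\<lambda>y. f (inv_into D c y))"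
  shows "f \<in> Cinf M U"
  unfolding Cinf_iff o_def using Ck_on_change_of_chart[OF C _ U f] by blast

end

text \<open>A ball of radius \<open>4 R\<close> whose closure lies in the image of a chart. The room is used
  as follows: the trivialization lives over the ball of radius \<open>R\<close>, cutoff functions
  that are 1 there vanish outside radius \<open>2 R\<close>, the coordinate fields are multiplied by
  a cutoff function that is 1 up to radius \<open>2 R\<close> and vanishes outside radius
  \<open>3 R\<close>, and Hadamard's lemma is applied on the ball of radius \<open>4 R\<close>.\<close>

locale chart_ball = smooth_mfd Bs M
  for Bs :: "'e::real_inner set" and M :: "('n::{t2_space,second_countable_topology}, 'e) atlas" +
  fixes D :: "'n set" and c :: "'n \<Rightarrow> 'e" and y0 :: 'e and R :: real
  assumes chart: "(D, c) \<in> M" and R: "R > 0" and ball_in_chart: "cball y0 (4 * R) \<subseteq> c ` D"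
begin

abbreviation p :: "'e \<Rightarrow> 'n" where "p \<equiv> inv_into D c"

definition nbhd :: "real \<Rightarrow> 'n set" where
  "nbhd r = {x \<in> D. c x \<in> ball y0 r}"

lemma p_c: "x \<in> D \<Longrightarrow> p (c x) = x"
  using chart_inverse(1)[OF chart] .

lemma p_ball:
  assumes "y \<in> ball y0 r" "r \<le> 4 * R"
  shows "c (p y) = y" "p y \<in> D" "p y \<in> nbhd r"
proof -
  have "y \<in> c ` D" using assms ball_in_chart by auto
  then show *: "c (p y) = y" "p y \<in> D" using chart_inverse[OF chart] by auto
  then show "p y \<in> nbhd r" using assms by (simp add: nbhd_def)
qed

lemma nbhd_D: "x \<in> nbhd r \<Longrightarrow> x \<in> D" "x \<in> nbhd r \<Longrightarrow> c x \<in> ball y0 r"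
  by (auto simp: nbhd_def)

lemma continuous_on_c: "continuous_on D c"
  and continuous_on_p: "continuous_on (c ` D) p"
  using chart_homeo[OF chart] by (auto simp: homeomorphism_def)

lemma open_nbhd: "open (nbhd r)"
proof -
  have "nbhd r = D \<inter> c -` ball y0 r" by (auto simp: nbhd_def)
  then show ?thesis
    using continuous_open_preimage[OF continuous_on_c chart_open[OF chart], of "ball y0 r"] by simp
qed

lemma nbhd_mono: "r \<le> r' \<Longrightarrow> nbhd r \<subseteq> nbhd r'"
  by (auto simp: nbhd_def)

lemma c_nbhd: "r \<le> 4 * R \<Longrightarrow> c ` nbhd r = ball y0 r"
  using p_ball by (force simp: nbhd_def)

definition ext :: "('e \<Rightarrow> complex) \<Rightarrow> 'n \<Rightarrow> complex" where
  "ext g x = (if x \<in> D then g (c x) else 0)"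

text \<open>The support is compact, hence closed in the Hausdorff space \<open>N\<close>, so the extension by
  0 is smooth near every point outside the chart.\<close>

lemma ext_Cinf:
  assumes g: "\<And>k. Ck_on k (ball y0 (4 * R)) g" and z: "\<And>y. norm (y - y0) \<ge> 3 * R \<Longrightarrow> g y = 0"
  shows "ext g \<in> Cinf M UNIV"
proof (rule Cinf_local)
  fix x :: 'n
  have "compact (p ` cball y0 (3 * R))"
  proof (rule compact_continuous_image[OF continuous_on_subset[OF continuous_on_p] compact_cball])
    show "cball y0 (3 * R) \<subseteq> c ` D"
      using R by (intro order_trans[OF subset_cball ball_in_chart]) simp
  qed
  then have cl: "closed (p ` cball y0 (3 * R))" by (rule compact_imp_closed)
  show "\<exists>W. open W \<and> x \<in> W \<and> ext g \<in> Cinf M (W \<inter> UNIV)"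
  proof (cases "x \<in> nbhd (4 * R)")
    case True
    have "ext g \<in> Cinf M (nbhd (4 * R))"
    proof (rule Cinf_chartI[OF chart open_nbhd])
      fix k
      have "ext g (p y) = g y" if "y \<in> ball y0 (4 * R)" for y
        using p_ball[OF that] by (simp add: ext_def)
      then show "Ck_on k (c ` nbhd (4 * R)) (\<lambda>y. ext g (p y))"
        using g[of k] Ck_on_cong[OF open_ball, of y0 "4 * R" "\<lambda>y. ext g (p y)" g k] c_nbhd[of "4 * R"] by simp
    qed (auto simp: nbhd_def)
    then show ?thesis using True open_nbhd by (intro exI[of _ "nbhd (4 * R)"]) simp
  next
    case False
    let ?W = "- p ` cball y0 (3 * R)"
    have zero: "ext g z = 0" if "z \<in> ?W" for z
    proof (cases "z \<in> D \<and> norm (c z - y0) < 3 * R")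
      case True
      then have "c z \<in> cball y0 (3 * R)" by (simp add: dist_norm norm_minus_commute)
      then have "z \<in> p ` cball y0 (3 * R)" using p_c True by (metis imageI)
      with that show ?thesis by simp
    qed (use z in \<open>auto simp: ext_def\<close>)
    have "open ?W" using cl by (rule open_Compl)
    moreover have "x \<in> ?W"
    proof
      assume "x \<in> p ` cball y0 (3 * R)"
      then obtain y where y: "y \<in> cball y0 (3 * R)" "x = p y" by blast
      then have "y \<in> ball y0 (4 * R)" using R by auto
      with p_ball(3)[OF this] y False show False by simp
    qed
    moreover have "ext g \<in> Cinf M (?W \<inter> UNIV)"
      using Cinf_cong[OF \<open>open ?W\<close> _ Cinf_const[of 0 ?W], of "ext g"] zero by simp
    ultimately show ?thesis by blast
  qed
qed simp

definition bump :: "real \<Rightarrow> real \<Rightarrow> 'e \<Rightarrow> complex" where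
  "bump r r' y = complex_of_real (radial_bump y0 r r' y)"

lemma Ck_on_bump: "0 < r \<Longrightarrow> r < r' \<Longrightarrow> Ck_on k V (bump r r')"
  unfolding bump_def[abs_def] by (intro Ck_on_of_real Ck_on_radial_bump)

lemma bump_1: "0 < r \<Longrightarrow> r < r' \<Longrightarrow> norm (y - y0) \<le> r \<Longrightarrow> bump r r' y = 1"
  by (simp add: bump_def radial_bump_1)

lemma bump_0: "0 < r \<Longrightarrow> r < r' \<Longrightarrow> norm (y - y0) \<ge> r' \<Longrightarrow> bump r r' y = 0"
  by (simp add: bump_def radial_bump_0)

lemma ext_bump_Cinf:
  assumes "0 < r" "r < r'" "r' \<le> 3 * R" and g: "\<And>k. Ck_on k (ball y0 (4 * R)) g"
  shows "ext (\<lambda>y. bump r r' y * g y) \<in> Cinf M UNIV"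
  by (rule ext_Cinf) (use assms in \<open>auto intro!: Ck_on_mult Ck_on_bump simp: bump_0\<close>)

abbreviation cut :: "'e \<Rightarrow> complex" where "cut \<equiv> bump (2 * R) (3 * R)"

lemma cut_1: "y \<in> ball y0 (2 * R) \<Longrightarrow> cut y = 1"
  using R by (intro bump_1) (auto simp: dist_norm norm_minus_commute)

text \<open>A global smooth function that is the coordinate in direction \<open>b\<close> up to radius
  \<open>2 R\<close>.\<close>

definition coord :: "'e \<Rightarrow> 'n \<Rightarrow> complex" where
  "coord b = ext (\<lambda>y. cut y * complex_of_real (y \<bullet> b))"

lemma coord_Cinf: "coord b \<in> Cinf M UNIV"
  unfolding coord_def using R
  by (intro ext_bump_Cinf Ck_on_of_real Ck_on_linear[OF bounded_linear_inner_left] Ck_on_ident) auto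

text \<open>The coordinate vector field in direction \<open>v\<close>, cut off so that it is defined globally.\<close>

definition frame :: "'e \<Rightarrow> 'n vfield" where
  "frame v x f = (if f \<in> Cinf M UNIV then ext (\<lambda>y. cut y * ddir (\<lambda>y. f (p y)) v y) x else 0)"

lemma Cinf_in_chart:
  assumes "f \<in> Cinf M U" "nbhd r \<subseteq> U" "r \<le> 4 * R"
  shows "Ck_on k (ball y0 r) (\<lambda>y. f (p y))"
proof -
  have "f \<in> Cinf M (nbhd r)" using assms Cinf_subset by blast
  then have "Ck_on k (c ` (D \<inter> nbhd r)) (\<lambda>y. f (p y))"
    using chart unfolding Cinf_iff o_def by blast
  moreover have "D \<inter> nbhd r = nbhd r" by (auto simp: nbhd_def)
  ultimately show ?thesis using c_nbhd[OF assms(3)] by simp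
qed

lemma Cinf_has_ddir:
  assumes "f \<in> Cinf M UNIV"
  shows "Ck_on k (ball y0 (4 * R)) (ddir (\<lambda>y. f (p y)) v)"
    "y \<in> ball y0 (4 * R) \<Longrightarrow> has_ddir (\<lambda>y. f (p y)) v (ddir (\<lambda>y. f (p y)) v y) y"
  using Cinf_in_chart[OF assms, of "4 * R" "Suc k"] Ck_on_Suc_iff[OF open_ball, of k y0 "4 * R" "\<lambda>y. f (p y)"]
  by auto

lemma frame_Cinf: "f \<in> Cinf M UNIV \<Longrightarrow> (\<lambda>x. frame v x f) \<in> Cinf M UNIV"
  using ext_bump_Cinf[OF _ _ _ Cinf_has_ddir(1)] R by (simp add: frame_def)

lemma frame_at:
  assumes "f \<in> Cinf M UNIV" "x \<in> nbhd (2 * R)"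
  shows "has_ddir (\<lambda>y. f (p y)) v (frame v x f) (c x)"
proof -
  have "frame v x f = ddir (\<lambda>y. f (p y)) v (c x)"
    using assms cut_1 by (simp add: frame_def ext_def nbhd_def)
  then show ?thesis using Cinf_has_ddir(2)[OF assms(1), of "c x" v] assms(2) R by (simp add: nbhd_def)
qed

lemma frame_ctangent: "frame v x \<in> ctangent M x"
  unfolding ctangent_def
proof (intro CollectI conjI ballI allI impI)
  have out: "frame v x f = 0" if "\<not> (x \<in> D \<and> c x \<in> ball y0 (4 * R))" for f
    using that R bump_0[of "2 * R" "3 * R" "c x"] by (auto simp: frame_def ext_def dist_norm norm_minus_commute)
  have val: "frame v x f = cut (c x) * ddir (\<lambda>y. f (p y)) v (c x)" if "x \<in> D" "f \<in> Cinf M UNIV" for f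
    using that by (simp add: frame_def ext_def)
  fix f g assume fg: "f \<in> Cinf M UNIV" "g \<in> Cinf M UNIV"
  show "frame v x (\<lambda>y. f y + g y) = frame v x f + frame v x g"
  proof (cases "x \<in> D \<and> c x \<in> ball y0 (4 * R)")
    case True
    have "ddir (\<lambda>y. f (p y) + g (p y)) v (c x) = ddir (\<lambda>y. f (p y)) v (c x) + ddir (\<lambda>y. g (p y)) v (c x)"
      using True by (intro has_ddir_imp_ddir has_ddir_add Cinf_has_ddir fg) auto
    then show ?thesis using True fg by (simp add: val Cinf_add distrib_left)
  qed (simp add: out)
  show "frame v x (\<lambda>y. f y * g y) = f x * frame v x g + g x * frame v x f"
  proof (cases "x \<in> D \<and> c x \<in> ball y0 (4 * R)")
    case True
    have "ddir (\<lambda>y. f (p y) * g (p y)) v (c x) =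
        f (p (c x)) * ddir (\<lambda>y. g (p y)) v (c x) + ddir (\<lambda>y. f (p y)) v (c x) * g (p (c x))"
      using True by (intro has_ddir_imp_ddir has_ddir_bilinear[OF bounded_bilinear_mult] Cinf_has_ddir fg) auto
    then show ?thesis using True fg by (simp add: val Cinf_mult p_c algebra_simps)
  qed (simp add: out)
next
  fix a f assume f: "f \<in> Cinf M UNIV"
  show "frame v x (\<lambda>y. a * f y) = a * frame v x f"
  proof (cases "x \<in> D \<and> c x \<in> ball y0 (4 * R)")
    case True
    have "ddir (\<lambda>y. a * f (p y)) v (c x) = a * ddir (\<lambda>y. f (p y)) v (c x)"
      using True by (intro has_ddir_imp_ddir has_ddir_linear[OF bounded_linear_mult_right] Cinf_has_ddir f) auto
    then show ?thesis using True f Cinf_mult[OF Cinf_const f, of a] by (simp add: frame_def ext_def)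
  next
    case False
    then have "x \<notin> D \<or> cut (c x) = 0"
      using R bump_0[of "2 * R" "3 * R" "c x"] by (auto simp: dist_norm norm_minus_commute)
    then show ?thesis by (auto simp: frame_def ext_def)
  qed
qed (simp add: frame_def)

lemma frame_Vect: "frame v \<in> Vect M UNIV"
  unfolding Vect_def using frame_ctangent frame_Cinf by auto

text \<open>The frame fields are real. Hence the same field appears twice in the compatibility of the
  connection with the inner product.\<close>

lemma vf_cnj_frame: "vf_cnj (frame v) = frame v"
proof (intro ext)
  fix x f
  show "vf_cnj (frame v) x f = frame v x f"
  proof (cases "f \<in> Cinf M UNIV \<and> x \<in> D \<and> c x \<in> ball y0 (4 * R)")
    case True
    have "ddir (\<lambda>y. cnj (f (p y))) v (c x) = cnj (ddir (\<lambda>y. f (p y)) v (c x))"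
      using True by (intro has_ddir_imp_ddir has_ddir_linear[OF bounded_linear_cnj] Cinf_has_ddir) auto
    then show ?thesis using True by (simp add: vf_cnj_def frame_def ext_def Cinf_cnj bump_def)
  next
    case False
    then have "f \<notin> Cinf M UNIV \<or> x \<notin> D \<or> cut (c x) = 0"
      using R bump_0[of "2 * R" "3 * R" "c x"] by (auto simp: dist_norm norm_minus_commute)
    then show ?thesis by (auto simp: vf_cnj_def frame_def ext_def Cinf_cnj_iff)
  qed
qed

lemma ctangent_rules:
  assumes "w \<in> ctangent M x"
  shows "f \<in> Cinf M UNIV \<Longrightarrow> g \<in> Cinf M UNIV \<Longrightarrow> w (\<lambda>y. f y + g y) = w f + w g"
    "f \<in> Cinf M UNIV \<Longrightarrow> w (\<lambda>y. a * f y) = a * w f"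
    "f \<in> Cinf M UNIV \<Longrightarrow> g \<in> Cinf M UNIV \<Longrightarrow> w (\<lambda>y. f y * g y) = f x * w g + g x * w f"
    "f \<notin> Cinf M UNIV \<Longrightarrow> w f = 0"
  using assms unfolding ctangent_def by auto

lemma ctangent_const:
  assumes w: "w \<in> ctangent M x"
  shows "w (\<lambda>y. a) = 0"
proof -
  have "w (\<lambda>y. 1 * 1) = 1 * w (\<lambda>y. 1) + 1 * w (\<lambda>y. 1)"
    by (rule ctangent_rules(3)[OF w Cinf_const Cinf_const])
  then have "w (\<lambda>y. 1) = 0" by simp
  then show ?thesis using ctangent_rules(2)[OF w Cinf_const[of 1], of a] by simp
qed

lemma ctangent_sum:
  assumes w: "w \<in> ctangent M x" and "finite I" "\<And>i. i \<in> I \<Longrightarrow> f i \<in> Cinf M UNIV"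
  shows "w (\<lambda>y. \<Sum>i\<in>I. f i y) = (\<Sum>i\<in>I. w (f i))"
  using assms(2,3)
  by (induction I rule: finite_induct) (auto simp: ctangent_const[OF w] ctangent_rules(1)[OF w] Cinf_sum)

text \<open>A tangent vector is determined by its values at the coordinate functions. With Hadamard's lemma,
  \<open>X\<^sup>2 (f - f(x))\<close> for the cutoff function \<open>X\<close> is globally a sum of
  products of \<open>X (y\<^sub>b - x\<^sub>b)\<close> with smooth functions, to which the product
  rule applies.\<close>

lemma ctangent_expansion:
  assumes x: "x \<in> nbhd (2 * R)" and w: "w \<in> ctangent M x"
  shows "w f = (\<Sum>b\<in>Bs. w (coord b) * frame b x f)"
proof (cases "f \<in> Cinf M UNIV")
  case False
  then show ?thesis using ctangent_rules(4)[OF w] by (simp add: frame_def)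
next
  case f: True
  let ?V = "ball y0 (4 * R)" and ?g = "\<lambda>y. f (p y)"
  have cx: "c x \<in> ?V" "x \<in> D" "c x \<in> ball y0 (2 * R)" using x R by (auto simp: nbhd_def)
  obtain G where G: "\<And>b k. Ck_on k ?V (G b)" "\<And>b. G b (c x) = ddir ?g b (c x)"
    "\<And>y. y \<in> ?V \<Longrightarrow> ?g y = ?g (c x) + (\<Sum>b\<in>Bs. ((y - c x) \<bullet> b) *\<^sub>R G b y)"
    using Hadamard[OF open_ball convex_ball cx(1) Cinf_in_chart[OF f, of "4 * R"]] by auto
  define X where "X = ext cut"
  define H where "H b = ext (\<lambda>y. cut y * G b y)" for b
  have XC: "X \<in> Cinf M UNIV"
    using ext_bump_Cinf[of "2 * R" "3 * R" "\<lambda>_. 1"] R by (simp add: X_def Ck_on_const)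
  have HC: "H b \<in> Cinf M UNIV" for b unfolding H_def using R by (intro ext_bump_Cinf G) auto
  have Xx: "X x = 1" using cx cut_1 by (simp add: X_def ext_def)
  \<comment> \<open>\<open>X\<close> is 1 near \<open>x\<close>; this is seen by multiplying it with a bump function \<open>\<rho>\<close> supported where \<open>X = 1\<close>.\<close>
  have "w X = 0"
  proof -
    define r where "r = max R (norm (c x - y0))"
    have r: "0 < r" "r < 2 * R" "norm (c x - y0) \<le> r"
      using R cx(3) by (auto simp: r_def dist_norm norm_minus_commute)
    define \<rho> where "\<rho> = ext (bump r (2 * R))"
    have \<rho>C: "\<rho> \<in> Cinf M UNIV"
      using ext_bump_Cinf[of r "2 * R" "\<lambda>_. 1"] R r by (simp add: \<rho>_def Ck_on_const)
    have "X z * \<rho> z = \<rho> z" for z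
    proof (cases "norm (c z - y0) < 2 * R")
      case True
      then show ?thesis using cut_1[of "c z"] by (simp add: X_def \<rho>_def ext_def dist_norm norm_minus_commute)
    qed (use r in \<open>simp add: \<rho>_def ext_def bump_0\<close>)
    then have "(\<lambda>z. X z * \<rho> z) = \<rho>" by (rule HOL.ext)
    then have "w \<rho> = w (\<lambda>z. X z * \<rho> z)" by (rule arg_cong[OF sym])
    also have "\<dots> = X x * w \<rho> + \<rho> x * w X" by (rule ctangent_rules(3)[OF w XC \<rho>C])
    finally show ?thesis using Xx bump_1[OF r] cx by (simp add: \<rho>_def ext_def)
  qed
  define h where "h b = (\<lambda>z. coord b z + (- complex_of_real (c x \<bullet> b)) * X z)" for b
  have hC: "h b \<in> Cinf M UNIV" for b
    unfolding h_def by (intro Cinf_add Cinf_mult Cinf_const XC coord_Cinf)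
  have fC: "(\<lambda>z. f z + - f x) \<in> Cinf M UNIV" by (intro Cinf_add Cinf_const f)
  have "X z * (X z * (f z + - f x)) = (\<Sum>b\<in>Bs. h b z * H b z)" for z
  proof (cases "z \<in> D \<and> c z \<in> ?V")
    case True
    have "f z - f x = (\<Sum>b\<in>Bs. ((c z - c x) \<bullet> b) *\<^sub>R G b (c z))"
      using G(3)[of "c z"] True cx(2) by (simp add: p_c)
    moreover have "h b z * H b z = cut (c z) * (cut (c z) * (((c z - c x) \<bullet> b) *\<^sub>R G b (c z)))" for b
      using True by (simp add: h_def H_def coord_def X_def ext_def inner_diff_left scaleR_conv_of_real algebra_simps)
    ultimately show ?thesis using True by (simp add: X_def ext_def sum_distrib_left)
  next
    case False
    then have "X z = 0" "\<And>b. H b z = 0"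
      using R bump_0[of "2 * R" "3 * R" "c z"] by (auto simp: X_def H_def ext_def dist_norm norm_minus_commute)
    then show ?thesis by simp
  qed
  then have "w (\<lambda>z. X z * (X z * (f z + - f x))) = w (\<lambda>z. \<Sum>b\<in>Bs. h b z * H b z)" by simp
  also have "\<dots> = (\<Sum>b\<in>Bs. w (\<lambda>z. h b z * H b z))"
    by (rule ctangent_sum[OF w finite_Bs Cinf_mult[OF hC HC]])
  also have "\<dots> = (\<Sum>b\<in>Bs. w (coord b) * frame b x f)"
  proof (rule sum.cong[OF refl])
    fix b
    have hx: "h b x = 0" using cx cut_1[OF cx(3)] by (simp add: h_def coord_def X_def ext_def)
    have "w (h b) = w (coord b) + w (\<lambda>z. (- complex_of_real (c x \<bullet> b)) * X z)"
      unfolding h_def by (intro ctangent_rules(1)[OF w] coord_Cinf Cinf_mult Cinf_const XC)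
    then have wh: "w (h b) = w (coord b)" using ctangent_rules(2)[OF w XC, of "- complex_of_real (c x \<bullet> b)"] \<open>w X = 0\<close> by simp
    have "H b x = frame b x f" using cx f cut_1[OF cx(3)] G(2) by (simp add: H_def ext_def frame_def)
    then show "w (\<lambda>z. h b z * H b z) = w (coord b) * frame b x f"
      using ctangent_rules(3)[OF w hC HC] hx wh by simp
  qed
  also have "w (\<lambda>z. X z * (X z * (f z + - f x))) = w f"
    using ctangent_rules(3)[OF w XC Cinf_mult[OF XC fC]] ctangent_rules(3)[OF w XC fC]
      ctangent_rules(1)[OF w f Cinf_const[of "- f x"]] ctangent_const[OF w] Xx by simp
  finally show ?thesis .
qed

end

section \<open>The connection in a chart\<close>

context smooth_mfd
begin

lemma ctangent_add: "v \<in> ctangent M x \<Longrightarrow> w \<in> ctangent M x \<Longrightarrow> (\<lambda>f. v f + w f) \<in> ctangent M x"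
  unfolding ctangent_def by (auto simp: algebra_simps)

lemma ctangent_scale: "v \<in> ctangent M x \<Longrightarrow> (\<lambda>f. a * v f) \<in> ctangent M x"
  unfolding ctangent_def by (auto simp: algebra_simps)

lemma vf_add_Vect: "X \<in> Vect M U \<Longrightarrow> Y \<in> Vect M U \<Longrightarrow> vf_add X Y \<in> Vect M U"
  unfolding Vect_def vf_add_def by (auto intro: ctangent_add Cinf_add)

lemma vf_scale_Vect: "a \<in> Cinf M U \<Longrightarrow> X \<in> Vect M U \<Longrightarrow> vf_scale a X \<in> Vect M U"
  unfolding Vect_def vf_scale_def by (auto intro: ctangent_scale Cinf_mult)

end

context complex_hilbert_space
begin

lemma limitin_inner:
  assumes "limitin (htopology V) f v F" "z \<in> hcarrier V"
  shows "((\<lambda>j. hinner V (f j) z) \<longlongrightarrow> hinner V v z) F"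
proof -
  have v: "v \<in> hcarrier V" "\<forall>\<^sub>F j in F. f j \<in> hcarrier V" "((\<lambda>j. J (f j)) \<longlongrightarrow> J v) F"
    using assms(1) by (auto simp: limitin_htopology)
  have "((\<lambda>j. norm (J (f j) - J v) * hnorm V z) \<longlongrightarrow> 0 * hnorm V z) F"
    by (intro tendsto_mult tendsto_const tendsto_norm_zero LIM_zero v(3))
  then have n: "((\<lambda>j. norm (J (f j) - J v) * hnorm V z) \<longlongrightarrow> 0) F" by simp
  have "((\<lambda>j. hinner V (f j) z - hinner V v z) \<longlongrightarrow> 0) F"
  proof (rule Lim_null_comparison[OF _ n])
    show "\<forall>\<^sub>F j in F. norm (hinner V (f j) z - hinner V v z) \<le> norm (J (f j) - J v) * hnorm V z"
      using v(2)
    proof eventually_elim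
      case (elim j)
      show ?case
        using Cauchy_Schwarz[OF sub_closed[OF elim v(1)] assms(2)] norm_embed[OF sub_closed[OF elim v(1)]]
        by (simp add: inner_sub elim v(1) assms(2) embed_sub)
    qed
  qed
  then show ?thesis by (simp add: LIM_zero_iff)
qed

end

lemma loc_unif_conv_subset:
  fixes F :: "('n::topological_space, 'h) hilbert_field"
  assumes "loc_unif_conv F U s \<phi>" "open V" "V \<subseteq> U" "\<And>j x. x \<in> V \<Longrightarrow> s j x = t j x"
    "\<And>x. x \<in> V \<Longrightarrow> \<phi> x = \<psi> x"
  shows "loc_unif_conv F V t \<psi>"
  unfolding loc_unif_conv_def
proof
  fix x assume x: "x \<in> V"
  then obtain W where W: "open W" "x \<in> W" "W \<subseteq> U"
    "uniform_limit W (\<lambda>j y. hdist (fibre F y) (s j y) (\<phi> y)) (\<lambda>y. 0) sequentially"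
    using assms(1,3) unfolding loc_unif_conv_def by blast
  have "uniform_limit (W \<inter> V) (\<lambda>j y. hdist (fibre F y) (s j y) (\<phi> y)) (\<lambda>y. 0) sequentially"
    by (rule uniform_limit_on_subset[OF W(4)]) simp
  then have "uniform_limit (W \<inter> V) (\<lambda>j y. hdist (fibre F y) (t j y) (\<psi> y)) (\<lambda>y. 0) sequentially"
    by (rule uniform_limit_cong'[THEN iffD1, rotated 2]) (use assms(4,5) in auto)
  then show "\<exists>W. open W \<and> x \<in> W \<and> W \<subseteq> V \<and>
      uniform_limit W (\<lambda>j y. hdist (fibre F y) (t j y) (\<psi> y)) (\<lambda>y. 0) sequentially"
    using W x assms(2) by (intro exI[of _ "W \<inter> V"]) auto
qed

locale hilbert_field_chart = chart_ball Bs M D c y0 R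
  for Bs :: "'e::real_inner set" and M :: "('n::{t2_space,second_countable_topology}, 'e) atlas"
    and D c y0 R +
  fixes F :: "('n, 'h) hilbert_field"
  assumes field: "smooth_hilbert_field M F"
begin

abbreviation H :: "'n \<Rightarrow> 'h set" where "H x \<equiv> hcarrier (fibre F x)"
abbreviation sm :: "('n \<Rightarrow> 'h) set" where "sm \<equiv> smooth_sections F"
abbreviation V :: "'n set" where "V \<equiv> nbhd R"
abbreviation dv :: "'e \<Rightarrow> ('n \<Rightarrow> 'h) \<Rightarrow> ('n \<Rightarrow> 'h)" where "dv v \<equiv> nabla F (frame v)"

lemma field_of_hilbert_spaces: "field_of_hilbert_spaces F"
  using field by (simp add: smooth_hilbert_field_def)

lemma fibre_hilbert: "complex_hilbert_space (fibre F x)"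
  using field_of_hilbert_spaces by (simp add: field_of_hilbert_spaces_def)

lemma H_proj: "H x = proj F -` {x}"
  using field_of_hilbert_spaces by (simp add: field_of_hilbert_spaces_def)

lemma sm_in: "s \<in> sm \<Longrightarrow> s x \<in> H x"
  using field unfolding smooth_hilbert_field_def sections_def by (auto simp: PiE_def Pi_def)

lemma sm_add: "s \<in> sm \<Longrightarrow> t \<in> sm \<Longrightarrow> sec_add F UNIV s t \<in> sm"
  and sm_scale: "a \<in> Cinf M UNIV \<Longrightarrow> s \<in> sm \<Longrightarrow> sec_scale F UNIV a s \<in> sm"
  and sm_nabla: "X \<in> Vect M UNIV \<Longrightarrow> s \<in> sm \<Longrightarrow> nabla F X s \<in> sm"
  and sm_inner: "s \<in> sm \<Longrightarrow> t \<in> sm \<Longrightarrow> sec_inner F s t \<in> Cinf M UNIV"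
  using field by (simp_all add: smooth_hilbert_field_def)

lemma nabla_vf_add: "X \<in> Vect M UNIV \<Longrightarrow> Y \<in> Vect M UNIV \<Longrightarrow> s \<in> sm \<Longrightarrow>
    nabla F (vf_add X Y) s = sec_add F UNIV (nabla F X s) (nabla F Y s)"
  and nabla_vf_scale: "a \<in> Cinf M UNIV \<Longrightarrow> X \<in> Vect M UNIV \<Longrightarrow> s \<in> sm \<Longrightarrow>
    nabla F (vf_scale a X) s = sec_scale F UNIV a (nabla F X s)"
  and nabla_scale: "a \<in> Cinf M UNIV \<Longrightarrow> X \<in> Vect M UNIV \<Longrightarrow> s \<in> sm \<Longrightarrow>
    nabla F X (sec_scale F UNIV a s) =
      sec_add F UNIV (sec_scale F UNIV (\<lambda>x. X x a) s) (sec_scale F UNIV a (nabla F X s))"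
  and nabla_metric: "X \<in> Vect M UNIV \<Longrightarrow> s \<in> sm \<Longrightarrow> t \<in> sm \<Longrightarrow>
    X x (sec_inner F s t) = sec_inner F (nabla F X s) t x + sec_inner F s (nabla F (vf_cnj X) t) x"
  using field by (simp_all add: smooth_hilbert_field_def)

lemma dv_sm: "s \<in> sm \<Longrightarrow> dv v s \<in> sm"
  by (rule sm_nabla[OF frame_Vect])

lemma dv_metric: "s \<in> sm \<Longrightarrow> t \<in> sm \<Longrightarrow>
    frame v x (sec_inner F s t) = sec_inner F (dv v s) t x + sec_inner F s (dv v t) x"
  using nabla_metric[OF frame_Vect, of s t v x] by (simp add: vf_cnj_frame)

text \<open>The values of smooth sections are dense, so they separate points of the fibre.\<close>

lemma dense_eqI:
  assumes u: "u \<in> H x" and w: "w \<in> H x"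
    and eq: "\<And>s. s \<in> sm \<Longrightarrow> hinner (fibre F x) u (s x) = hinner (fibre F x) w (s x)"
  shows "u = w"
proof -
  interpret complex_hilbert_space "fibre F x" by (rule fibre_hilbert)
  interpret Metric_space "H x" "hdist (fibre F x)" by (rule Metric_space_hdist)
  let ?q = "hsub (fibre F x) u w"
  have q: "?q \<in> H x" by (rule sub_closed[OF u w])
  have "?q \<in> mtopology closure_of ((\<lambda>s. s x) ` sm)"
    using field q unfolding smooth_hilbert_field_def htopology_def by blast
  then have near: "\<exists>s\<in>sm. hdist (fibre F x) ?q (s x) < e" if "e > 0" for e
    using that unfolding metric_closure_of by (auto simp: in_mball)
  have "hnorm (fibre F x) ?q \<le> e" if "e > 0" for e
  proof -
    from near[OF that] obtain s where s: "s \<in> sm" "hdist (fibre F x) ?q (s x) < e" by blast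
    have sx: "s x \<in> H x" using sm_in[OF s(1)] .
    have "hinner (fibre F x) ?q ?q = hinner (fibre F x) ?q (hsub (fibre F x) ?q (s x))"
      using eq[OF s(1)] by (simp add: inner_sub_right[OF q sx q] inner_sub[OF u w sx])
    then have "(hnorm (fibre F x) ?q)\<^sup>2 = cmod (hinner (fibre F x) ?q (hsub (fibre F x) ?q (s x)))"
      by (metis abs_power2 inner_self norm_of_real q)
    also have "\<dots> \<le> hnorm (fibre F x) ?q * hnorm (fibre F x) (hsub (fibre F x) ?q (s x))"
      by (rule Cauchy_Schwarz[OF q sub_closed[OF q sx]])
    also have "\<dots> \<le> hnorm (fibre F x) ?q * e"
      using s(2) q sx by (intro mult_left_mono hnorm_nonneg) (auto simp: hdist_def)
    finally have "hnorm (fibre F x) ?q * hnorm (fibre F x) ?q \<le> hnorm (fibre F x) ?q * e"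
      by (simp add: power2_eq_square)
    then show ?thesis using hnorm_nonneg[OF q] that
      by (cases "hnorm (fibre F x) ?q = 0") (auto simp: mult_le_cancel_left)
  qed
  then have "hnorm (fibre F x) ?q \<le> 0" by (rule field_le_epsilon[of _ 0, simplified])
  then have "hinner (fibre F x) ?q ?q = 0" using hnorm_nonneg[OF q] inner_self[OF q] by simp
  then show ?thesis using sub_eq_zero_iff[OF u w] inner_definite[OF q] by blast
qed

text \<open>Additivity of the connection in the section follows from the compatibility with the inner product,
  because smooth sections separate points.\<close>

lemma dv_add:
  assumes s: "s \<in> sm" and t: "t \<in> sm"
  shows "dv v (sec_add F UNIV s t) x = hadd (fibre F x) (dv v s x) (dv v t x)"
proof -
  interpret complex_hilbert_space "fibre F x" by (rule fibre_hilbert)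
  note in_H = sm_in[OF s] sm_in[OF t] sm_in[OF dv_sm[OF s]] sm_in[OF dv_sm[OF t]]
  show ?thesis
  proof (rule dense_eqI)
    fix u assume u: "u \<in> sm"
    have "sec_inner F (sec_add F UNIV s t) u = (\<lambda>y. sec_inner F s u y + sec_inner F t u y)"
    proof
      fix y
      interpret y: complex_hilbert_space "fibre F y" by (rule fibre_hilbert)
      show "sec_inner F (sec_add F UNIV s t) u y = sec_inner F s u y + sec_inner F t u y"
        by (simp add: sec_inner_def sec_add_def y.inner_add sm_in s t u)
    qed
    then have "frame v x (sec_inner F (sec_add F UNIV s t) u) =
        frame v x (sec_inner F s u) + frame v x (sec_inner F t u)"
      using ctangent_rules(1)[OF frame_ctangent sm_inner[OF s u] sm_inner[OF t u]] by simp
    then show "hinner (fibre F x) (dv v (sec_add F UNIV s t) x) (u x) =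
        hinner (fibre F x) (hadd (fibre F x) (dv v s x) (dv v t x)) (u x)"
      unfolding dv_metric[OF sm_add[OF s t] u] dv_metric[OF s u] dv_metric[OF t u]
      using in_H sm_in[OF u] sm_in[OF dv_sm[OF u]]
      by (simp add: sec_inner_def sec_add_def inner_add)
  qed (use in_H sm_in[OF dv_sm[OF sm_add[OF s t]]] in \<open>auto simp: add_closed\<close>)
qed

lemma frame_combination_aux:
  assumes "finite B'" and "\<And>b. b \<in> B' \<Longrightarrow> q b \<in> Cinf M UNIV" and s: "s \<in> sm"
  shows "(\<lambda>x f. \<Sum>b\<in>B'. q b x * frame b x f) \<in> Vect M UNIV \<and>
    (\<forall>z\<in>H x. hinner (fibre F x) (nabla F (\<lambda>x f. \<Sum>b\<in>B'. q b x * frame b x f) s x) z =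
      (\<Sum>b\<in>B'. q b x * hinner (fibre F x) (dv b s x) z))"
  using assms(1,2)
proof (induction B' rule: finite_induct)
  case empty
  interpret complex_hilbert_space "fibre F x" by (rule fibre_hilbert)
  have zero: "(\<lambda>x f. 0) = vf_scale (\<lambda>x. 0) (frame 0)" by (simp add: vf_scale_def)
  show ?case using vf_scale_Vect[OF Cinf_const[of 0] frame_Vect[of 0]] sm_in[OF dv_sm[OF s]]
    by (simp add: zero nabla_vf_scale[OF Cinf_const frame_Vect s] sec_scale_def inner_scale)
next
  case (insert b B')
  interpret complex_hilbert_space "fibre F x" by (rule fibre_hilbert)
  let ?Z = "\<lambda>x f. \<Sum>b\<in>B'. q b x * frame b x f"
  have eq: "(\<lambda>x f. \<Sum>b\<in>insert b B'. q b x * frame b x f) = vf_add (vf_scale (q b) (frame b)) ?Z"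
    using insert(1,2) by (simp add: vf_add_def vf_scale_def)
  have Z: "?Z \<in> Vect M UNIV" and qb: "q b \<in> Cinf M UNIV"
    and IH: "\<And>z. z \<in> H x \<Longrightarrow> hinner (fibre F x) (nabla F ?Z s x) z =
      (\<Sum>b\<in>B'. q b x * hinner (fibre F x) (dv b s x) z)"
    using insert.IH insert.prems by auto
  show ?case
    unfolding eq nabla_vf_add[OF vf_scale_Vect[OF qb frame_Vect] Z s] nabla_vf_scale[OF qb frame_Vect s]
    using insert(1,2) IH sm_in[OF dv_sm[OF s]] sm_in[OF sm_nabla[OF Z s]]
    by (auto simp: sec_add_def sec_scale_def inner_add inner_scale scale_closed
        intro!: vf_add_Vect vf_scale_Vect frame_Vect Z qb)
qed

lemma frame_combination:
  assumes "finite B'" and "\<And>b. b \<in> B' \<Longrightarrow> q b \<in> Cinf M UNIV" and "s \<in> sm"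
  shows "(\<lambda>x f. \<Sum>b\<in>B'. q b x * frame b x f) \<in> Vect M UNIV"
    and "z \<in> H x \<Longrightarrow> hinner (fibre F x) (nabla F (\<lambda>x f. \<Sum>b\<in>B'. q b x * frame b x f) s x) z =
      (\<Sum>b\<in>B'. q b x * hinner (fibre F x) (dv b s x) z)"
  using frame_combination_aux[where q=q and x=x, OF assms] by blast+

text \<open>The connection is tensorial in the vector field. For a cutoff function \<open>a\<close> with
  \<open>a x = 1\<close> the field \<open>a Y\<close> is globally a combination of the frame fields
  with smooth coefficients. The identity is tested against \<open>z\<close> to avoid sums of vectors
  in a carrier set.\<close>

lemma nabla_expansion:
  assumes x: "x \<in> V" and Y: "Y \<in> Vect M UNIV" and s: "s \<in> sm" and z: "z \<in> H x"
  shows "hinner (fibre F x) (nabla F Y s x) z = (\<Sum>b\<in>Bs. Y x (coord b) * hinner (fibre F x) (dv b s x) z)"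
proof -
  interpret complex_hilbert_space "fibre F x" by (rule fibre_hilbert)
  define a where "a = ext (bump R (2 * R))"
  have aC: "a \<in> Cinf M UNIV"
    using ext_bump_Cinf[of R "2 * R" "\<lambda>_. 1"] R by (simp add: a_def Ck_on_const)
  have ax: "a x = 1"
    using x R bump_1[of R "2 * R" "c x"] by (simp add: a_def ext_def nbhd_def dist_norm norm_minus_commute)
  have Yt: "Y y \<in> ctangent M y" and YC: "(\<lambda>y. Y y (coord b)) \<in> Cinf M UNIV" for y b
    using Y coord_Cinf unfolding Vect_def by auto
  \<comment> \<open>Where \<open>a\<close> does not vanish, the coordinate expansion of \<open>Y\<close> is available.\<close>
  have eq: "vf_scale a Y = (\<lambda>y f. \<Sum>b\<in>Bs. (a y * Y y (coord b)) * frame b y f)"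
  proof (intro HOL.ext)
    fix y f
    show "vf_scale a Y y f = (\<Sum>b\<in>Bs. (a y * Y y (coord b)) * frame b y f)"
    proof (cases "y \<in> nbhd (2 * R)")
      case True
      then show ?thesis using ctangent_expansion[OF True Yt, of f]
        by (simp add: vf_scale_def sum_distrib_left mult.assoc)
    next
      case False
      then have "a y = 0" using R bump_0[of R "2 * R" "c y"]
        by (auto simp: a_def ext_def nbhd_def dist_norm norm_minus_commute)
      then show ?thesis by (simp add: vf_scale_def)
    qed
  qed
  have "hinner (fibre F x) (nabla F Y s x) z = hinner (fibre F x) (nabla F (vf_scale a Y) s x) z"
    using ax sm_in[OF sm_nabla[OF Y s]] by (simp add: nabla_vf_scale[OF aC Y s] sec_scale_def scale_one)
  also have "\<dots> = (\<Sum>b\<in>Bs. (a x * Y x (coord b)) * hinner (fibre F x) (dv b s x) z)"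
    unfolding eq by (rule frame_combination(2)[OF finite_Bs Cinf_mult[OF aC YC] s z])
  finally show ?thesis using ax by simp
qed

text \<open>The representation of a vector field on \<open>U\<close> is 0 outside \<open>U\<close>.\<close>

definition rframe :: "'n set \<Rightarrow> 'e \<Rightarrow> 'n vfield" where
  "rframe U v = (\<lambda>x. if x \<in> U then frame v x else (\<lambda>f. 0))"

lemma rframe_Vect: "open U \<Longrightarrow> rframe U v \<in> Vect M U"
  unfolding Vect_def mem_Collect_eq
proof (intro conjI ballI allI impI)
  assume U: "open U"
  fix f assume "f \<in> Cinf M UNIV"
  then have "(\<lambda>x. frame v x f) \<in> Cinf M U" using Cinf_subset[OF frame_Cinf] by blast
  then show "(\<lambda>x. rframe U v x f) \<in> Cinf M U"
    by (rule Cinf_cong[OF U, rotated]) (simp add: rframe_def)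
qed (simp_all add: rframe_def frame_ctangent)

lemma vf_cnj_rframe: "vf_cnj (rframe U v) = rframe U v"
proof (intro HOL.ext)
  fix x f
  show "vf_cnj (rframe U v) x f = rframe U v x f"
    using fun_cong[OF fun_cong[OF vf_cnj_frame[of v], of x], of f] by (simp add: vf_cnj_def rframe_def)
qed

text \<open>A global field with the value \<open>X x\<close> at \<open>x\<close>, which
  \<^const>\<open>nabla_restr\<close> chooses, exists: a combination of frame fields with constant
  coefficients. The value of the connection then does not depend on the choice.\<close>

lemma nabla_restr_inner:
  assumes U: "x \<in> U" and x: "x \<in> V" and X: "X \<in> Vect M U" and s: "s \<in> sm"
  shows "nabla_restr M F U X s x \<in> H x"
    and "z \<in> H x \<Longrightarrow> hinner (fibre F x) (nabla_restr M F U X s x) z =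
      (\<Sum>b\<in>Bs. X x (coord b) * hinner (fibre F x) (dv b s x) z)"
proof -
  let ?Z = "\<lambda>y f. \<Sum>b\<in>Bs. X x (coord b) * frame b y f"
  have x2: "x \<in> nbhd (2 * R)" using x nbhd_mono[of R "2 * R"] R by auto
  have Xt: "X x \<in> ctangent M x" using X U by (simp add: Vect_def)
  have "?Z \<in> Vect M UNIV" by (rule frame_combination(1)[OF finite_Bs Cinf_const s])
  moreover have "?Z x = X x" by (intro HOL.ext) (rule ctangent_expansion[OF x2 Xt, symmetric])
  ultimately have ex: "\<exists>Y. Y \<in> Vect M UNIV \<and> Y x = X x" by blast
  define Y where "Y = (SOME Y. Y \<in> Vect M UNIV \<and> Y x = X x)"
  have Y: "Y \<in> Vect M UNIV" "Y x = X x" using someI_ex[OF ex] by (auto simp: Y_def)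
  have eq: "nabla_restr M F U X s x = nabla F Y s x" using U by (simp add: nabla_restr_def Y_def)
  show "nabla_restr M F U X s x \<in> H x" unfolding eq by (rule sm_in[OF sm_nabla[OF Y(1) s]])
  show "z \<in> H x \<Longrightarrow> hinner (fibre F x) (nabla_restr M F U X s x) z =
      (\<Sum>b\<in>Bs. X x (coord b) * hinner (fibre F x) (dv b s x) z)"
    unfolding eq using nabla_expansion[OF x Y(1) s] Y(2) by simp
qed

lemma nabla_restr_rframe:
  assumes U: "open U" "x \<in> U" and x: "x \<in> V" and s: "s \<in> sm"
  shows "nabla_restr M F U (rframe U v) s x = dv v s x"
proof -
  interpret complex_hilbert_space "fibre F x" by (rule fibre_hilbert)
  note r = nabla_restr_inner[OF U(2) x rframe_Vect[OF U(1)] s]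
  show ?thesis
  proof (rule inner_eqI[OF r(1)])
    fix z assume z: "z \<in> H x"
    show "hinner (fibre F x) (nabla_restr M F U (rframe U v) s x) z = hinner (fibre F x) (dv v s x) z"
      using r(2)[OF z, of v] nabla_expansion[OF x frame_Vect s z, of v] U(2) by (simp add: rframe_def)
  qed (rule sm_in[OF dv_sm[OF s]])
qed

section \<open>Limits of smooth sections\<close>

lemma V_2R: "x \<in> V \<Longrightarrow> x \<in> nbhd (2 * R)"
  using nbhd_mono[of R "2 * R"] R by auto

lemma continuous_on_inner_p:
  assumes "s \<in> sm" "t \<in> sm"
  shows "continuous_on (ball y0 R) (\<lambda>y. sec_inner F s t (p y))"
  using Ck_on_continuous[OF Cinf_in_chart[OF sm_inner[OF assms], of R 0]] R by simp

lemma has_ddir_inner: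
  assumes "s \<in> sm" "t \<in> sm" "y \<in> ball y0 R"
  shows "has_ddir (\<lambda>y. sec_inner F s t (p y)) v (sec_inner F (dv v s) t (p y) + sec_inner F s (dv v t) (p y)) y"
proof -
  have y: "y \<in> ball y0 (2 * R)" using assms(3) R by auto
  note py = p_ball[OF y]
  have "has_ddir (\<lambda>y. sec_inner F s t (p y)) v (frame v (p y) (sec_inner F s t)) (c (p y))"
    by (rule frame_at[OF sm_inner[OF assms(1,2)] py(3)]) (use R in simp_all)
  then show ?thesis using py(1) R dv_metric[OF assms(1,2)] by simp
qed

lemma open_p_vimage:
  assumes "open W" shows "open {y \<in> ball y0 R. p y \<in> W}"
proof -
  have "continuous_on (ball y0 R) p"
    by (rule continuous_on_subset[OF continuous_on_p]) (use ball_in_chart R in auto)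
  from continuous_open_preimage[OF this open_ball assms] show ?thesis
    by (simp add: vimage_def Int_def)
qed

text \<open>The limits of smooth sections are only known to lie in the fibres over the region where they were
  taken; nothing is said about the values outside \<open>V\<close>.\<close>

definition secs :: "('n \<Rightarrow> 'h) \<Rightarrow> bool" where
  "secs \<phi> \<longleftrightarrow> (\<forall>x\<in>V. \<phi> x \<in> H x)"

lemma secsD: "secs \<phi> \<Longrightarrow> x \<in> V \<Longrightarrow> \<phi> x \<in> H x"
  by (simp add: secs_def)

lemma secs_sm: "s \<in> sm \<Longrightarrow> secs s"
  by (simp add: secs_def sm_in)

lemma hnorm_triangle:
  assumes "u \<in> H x" "w \<in> H x"
  shows "hnorm (fibre F x) u \<le> hnorm (fibre F x) w + hdist (fibre F x) u w"
proof -
  interpret complex_hilbert_space "fibre F x" by (rule fibre_hilbert)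
  have "norm (J u) \<le> norm (J w) + dist (J u) (J w)"
    using norm_triangle_sub[of "J u" "J w"] by (simp add: dist_norm)
  then show ?thesis using assms by (simp add: norm_embed hdist_embed)
qed

lemma loc_unif_conv_bounded:
  assumes conv: "loc_unif_conv F V s \<phi>" and s: "\<And>j. s j \<in> sm" and \<phi>: "secs \<phi>" and x: "x \<in> V"
  obtains W b where "open W" "x \<in> W" "W \<subseteq> V"
    "uniform_limit W (\<lambda>j y. hdist (fibre F y) (s j y) (\<phi> y)) (\<lambda>y. 0) sequentially"
    "b \<ge> 0" "\<And>y. y \<in> W \<Longrightarrow> hnorm (fibre F y) (\<phi> y) \<le> b"
    "\<forall>\<^sub>F j in sequentially. \<forall>y\<in>W. hnorm (fibre F y) (s j y) \<le> b"
proof -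
  obtain W where W: "open W" "x \<in> W" "W \<subseteq> V"
    "uniform_limit W (\<lambda>j y. hdist (fibre F y) (s j y) (\<phi> y)) (\<lambda>y. 0) sequentially"
    using conv x unfolding loc_unif_conv_def by blast
  have ev: "\<forall>\<^sub>F j in sequentially. \<forall>y\<in>W. \<bar>hdist (fibre F y) (s j y) (\<phi> y)\<bar> < 1"
    using W(4) unfolding uniform_limit_iff by (auto simp: dist_norm dest: spec[of _ 1])
  then obtain k where k: "\<And>y. y \<in> W \<Longrightarrow> \<bar>hdist (fibre F y) (s k y) (\<phi> y)\<bar> < 1"
    by (auto simp: eventually_sequentially)
  let ?g = "\<lambda>y. Re (sec_inner F (s k) (s k) (p y))"
  have cx: "c x \<in> ball y0 R" "x \<in> D" using x by (auto simp: nbhd_def)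
  have "continuous_on (ball y0 R) ?g" by (intro continuous_intros continuous_on_inner_p s)
  then have "isCont ?g (c x)" using cx(1) continuous_on_eq_continuous_at by blast
  then have "(?g \<longlongrightarrow> ?g (c x)) (nhds (c x))"
    unfolding isCont_def by (rule tendsto_at_iff_tendsto_nhds[THEN iffD1])
  from tendstoD[OF this zero_less_one] obtain S where
    S': "open S" "c x \<in> S" "\<And>y. y \<in> S \<Longrightarrow> dist (?g y) (?g (c x)) < 1"
    unfolding eventually_nhds by blast
  have S: "open S" "c x \<in> S" "\<And>y. y \<in> S \<Longrightarrow> ?g y < ?g (c x) + 1"
  proof -
    fix y assume "y \<in> S"
    from S'(3)[OF this] show "?g y < ?g (c x) + 1" unfolding dist_real_def by linarith
  qed (rule S'(1), rule S'(2))
  define W' where "W' = W \<inter> (D \<inter> c -` S)"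
  have oW': "open W'" unfolding W'_def
    using continuous_open_preimage[OF continuous_on_c chart_open[OF chart] S(1)] W(1) by blast
  define b where "b = sqrt (\<bar>?g (c x)\<bar> + 1) + 2"
  have sk: "hnorm (fibre F y) (s k y) \<le> b - 2" if "y \<in> W'" for y
  proof -
    have y: "p (c y) = y" "c y \<in> S" using that p_c by (auto simp: W'_def)
    from S(3)[OF y(2)] have "Re (hinner (fibre F y) (s k y) (s k y)) < ?g (c x) + 1"
      unfolding y(1) by (simp add: sec_inner_def)
    then have "Re (hinner (fibre F y) (s k y) (s k y)) \<le> \<bar>?g (c x)\<bar> + 1" by linarith
    then show ?thesis by (simp add: hnorm_def b_def)
  qed
  have b0: "b \<ge> 2" by (simp add: b_def)
  have d_sym: "hdist (fibre F y) u w = hdist (fibre F y) w u" for y u w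
    by (rule Metric_space.commute[OF complex_hilbert_space.Metric_space_hdist[OF fibre_hilbert]])
  have phib: "hnorm (fibre F y) (\<phi> y) \<le> b - 1" if "y \<in> W'" for y
  proof -
    have yV: "y \<in> V" "y \<in> W" using that W(3) by (auto simp: W'_def)
    have "hnorm (fibre F y) (\<phi> y) \<le> hnorm (fibre F y) (s k y) + hdist (fibre F y) (\<phi> y) (s k y)"
      by (rule hnorm_triangle[OF secsD[OF \<phi> yV(1)] sm_in[OF s]])
    then show ?thesis using sk[OF that] k[OF yV(2)] d_sym[of y "\<phi> y" "s k y"] by linarith
  qed
  have "\<forall>\<^sub>F j in sequentially. \<forall>y\<in>W'. hnorm (fibre F y) (s j y) \<le> b"
    using ev
  proof eventually_elim
    case (elim j)
    show ?case
    proof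
      fix y assume y: "y \<in> W'"
      then have yV: "y \<in> V" "y \<in> W" using W(3) by (auto simp: W'_def)
      have "hnorm (fibre F y) (s j y) \<le> hnorm (fibre F y) (\<phi> y) + hdist (fibre F y) (s j y) (\<phi> y)"
        by (rule hnorm_triangle[OF sm_in[OF s] secsD[OF \<phi> yV(1)]])
      then show "hnorm (fibre F y) (s j y) \<le> b" using phib[OF y] elim yV(2) by (smt (verit))
    qed
  qed
  moreover have "uniform_limit W' (\<lambda>j y. hdist (fibre F y) (s j y) (\<phi> y)) (\<lambda>y. 0) sequentially"
    by (rule uniform_limit_on_subset[OF W(4)]) (simp add: W'_def)
  moreover have "x \<in> W'" "W' \<subseteq> V" using W cx(2) S(2) by (auto simp: W'_def)
  moreover have "0 \<le> b" "\<And>y. y \<in> W' \<Longrightarrow> hnorm (fibre F y) (\<phi> y) \<le> b"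
    using b0 phib by fastforce+
  ultimately show ?thesis using that[OF oW'] by blast
qed

lemma inner_diff_bound:
  assumes "u \<in> H x" "u' \<in> H x" "w \<in> H x" "w' \<in> H x"
  shows "cmod (hinner (fibre F x) u w - hinner (fibre F x) u' w') \<le>
    hdist (fibre F x) u u' * hnorm (fibre F x) w + hnorm (fibre F x) u' * hdist (fibre F x) w w'"
proof -
  interpret complex_hilbert_space "fibre F x" by (rule fibre_hilbert)
  have "hinner (fibre F x) u w - hinner (fibre F x) u' w' =
      hinner (fibre F x) (hsub (fibre F x) u u') w + hinner (fibre F x) u' (hsub (fibre F x) w w')"
    using assms by (simp add: inner_sub inner_sub_right)
  also have "cmod \<dots> \<le> cmod (hinner (fibre F x) (hsub (fibre F x) u u') w) +
      cmod (hinner (fibre F x) u' (hsub (fibre F x) w w'))" by (rule norm_triangle_ineq)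
  also have "\<dots> \<le> hdist (fibre F x) u u' * hnorm (fibre F x) w + hnorm (fibre F x) u' * hdist (fibre F x) w w'"
    using Cauchy_Schwarz[OF sub_closed[OF assms(1,2)] assms(3)]
      Cauchy_Schwarz[OF assms(2) sub_closed[OF assms(3,4)]] assms
    by (intro add_mono) (simp_all add: hdist_def)
  finally show ?thesis .
qed

text \<open>The inner product is jointly continuous on bounded sets, and a locally uniform limit of smooth
  sections is locally bounded.\<close>

lemma inner_limit:
  assumes s: "loc_unif_conv F V s \<phi>" "\<And>j. s j \<in> sm" "secs \<phi>"
    and t: "loc_unif_conv F V t \<psi>" "\<And>j. t j \<in> sm" "secs \<psi>" and x: "x \<in> V"
  obtains W where "open W" "x \<in> W" "W \<subseteq> V"
    "uniform_limit W (\<lambda>j. sec_inner F (s j) (t j)) (sec_inner F \<phi> \<psi>) sequentially"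
proof -
  obtain W1 b1 where W1: "open W1" "x \<in> W1" "W1 \<subseteq> V"
    "uniform_limit W1 (\<lambda>j y. hdist (fibre F y) (s j y) (\<phi> y)) (\<lambda>y. 0) sequentially"
    "b1 \<ge> 0" "\<And>y. y \<in> W1 \<Longrightarrow> hnorm (fibre F y) (\<phi> y) \<le> b1"
    "\<forall>\<^sub>F j in sequentially. \<forall>y\<in>W1. hnorm (fibre F y) (s j y) \<le> b1"
    by (rule loc_unif_conv_bounded[OF s x]) (rule that)
  obtain W2 b2 where W2: "open W2" "x \<in> W2" "W2 \<subseteq> V"
    "uniform_limit W2 (\<lambda>j y. hdist (fibre F y) (t j y) (\<psi> y)) (\<lambda>y. 0) sequentially"
    "b2 \<ge> 0" "\<And>y. y \<in> W2 \<Longrightarrow> hnorm (fibre F y) (\<psi> y) \<le> b2"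
    "\<forall>\<^sub>F j in sequentially. \<forall>y\<in>W2. hnorm (fibre F y) (t j y) \<le> b2"
    by (rule loc_unif_conv_bounded[OF t x]) (rule that)
  have "uniform_limit (W1 \<inter> W2) (\<lambda>j. sec_inner F (s j) (t j)) (sec_inner F \<phi> \<psi>) sequentially"
  proof (rule uniform_limitI)
    fix e :: real assume e: "e > 0"
    let ?e = "e / (2 * (b1 + b2 + 1))"
    have e': "?e > 0" using e W1(5) W2(5) by simp
    have 1: "\<forall>\<^sub>F j in sequentially. \<forall>y\<in>W1. dist (hdist (fibre F y) (s j y) (\<phi> y)) 0 < ?e"
      by (rule uniform_limitD[OF W1(4) e'])
    have 2: "\<forall>\<^sub>F j in sequentially. \<forall>y\<in>W2. dist (hdist (fibre F y) (t j y) (\<psi> y)) 0 < ?e"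
      by (rule uniform_limitD[OF W2(4) e'])
    show "\<forall>\<^sub>F j in sequentially. \<forall>y\<in>W1 \<inter> W2. dist (sec_inner F (s j) (t j) y) (sec_inner F \<phi> \<psi> y) < e"
      using 1 2 W2(7)
    proof eventually_elim
      case (elim j)
      show ?case
      proof
        fix y assume y: "y \<in> W1 \<inter> W2"
        then have yV: "y \<in> V" using W1(3) by auto
        interpret complex_hilbert_space "fibre F y" by (rule fibre_hilbert)
        note in_H = sm_in[OF s(2)] secsD[OF s(3) yV] sm_in[OF t(2)] secsD[OF t(3) yV]
        have d: "hdist (fibre F y) (s j y) (\<phi> y) \<le> ?e" "hdist (fibre F y) (t j y) (\<psi> y) \<le> ?e"
          using elim(1,2) y by fastforce+
        have "dist (sec_inner F (s j) (t j) y) (sec_inner F \<phi> \<psi> y) \<le>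
            hdist (fibre F y) (s j y) (\<phi> y) * hnorm (fibre F y) (t j y) +
            hnorm (fibre F y) (\<phi> y) * hdist (fibre F y) (t j y) (\<psi> y)"
          unfolding dist_norm sec_inner_def by (rule inner_diff_bound[OF in_H])
        also have "\<dots> \<le> ?e * b2 + b1 * ?e"
          using d elim(3) W1(5,6) W2(5) e' y in_H
          by (intro add_mono mult_mono hnorm_nonneg) (auto simp: hdist_def hnorm_nonneg sub_closed)
        also have "\<dots> = ?e * (b1 + b2)" by (simp only: distrib_left mult.commute[of b1] add.commute)
        also have "\<dots> < ?e * (2 * (b1 + b2 + 1))"
          using e' W1(5) W2(5) by (intro mult_strict_left_mono) auto
        also have "\<dots> = e" using W1(5) W2(5) by simp
        finally show "dist (sec_inner F (s j) (t j) y) (sec_inner F \<phi> \<psi> y) < e" .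
      qed
    qed
  qed
  then show ?thesis using that[of "W1 \<inter> W2"] W1 W2 by blast
qed

lemma uniform_limit_p:
  assumes "uniform_limit W f l sequentially"
  shows "uniform_limit {y \<in> ball y0 R. p y \<in> W} (\<lambda>j y. f j (p y)) (\<lambda>y. l (p y)) sequentially"
  using assms unfolding uniform_limit_iff by (auto elim!: eventually_mono)

lemma continuous_on_inner_limit:
  assumes s: "loc_unif_conv F V s \<phi>" "\<And>j. s j \<in> sm" "secs \<phi>"
    and t: "loc_unif_conv F V t \<psi>" "\<And>j. t j \<in> sm" "secs \<psi>"
  shows "continuous_on (ball y0 R) (\<lambda>y. sec_inner F \<phi> \<psi> (p y))"
  unfolding continuous_on_eq_continuous_at[OF open_ball]
proof
  fix y assume y: "y \<in> ball y0 R"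
  have py: "p y \<in> V" by (rule p_ball(3)[OF y]) (use R in simp)
  obtain W where W: "open W" "p y \<in> W" "W \<subseteq> V"
    "uniform_limit W (\<lambda>j. sec_inner F (s j) (t j)) (sec_inner F \<phi> \<psi>) sequentially"
    by (rule inner_limit[OF s t py]) (rule that)
  let ?S = "{y \<in> ball y0 R. p y \<in> W}"
  have "continuous_on ?S (\<lambda>y. sec_inner F \<phi> \<psi> (p y))"
    by (rule uniform_limit_theorem[OF _ uniform_limit_p[OF W(4)]])
      (auto intro!: always_eventually continuous_on_subset[OF continuous_on_inner_p[OF s(2) t(2)]])
  then show "isCont (\<lambda>y. sec_inner F \<phi> \<psi> (p y)) y"
    using open_p_vimage[OF W(1)] y W(2) by (simp add: continuous_on_eq_continuous_at)
qed

text \<open>The section \<open>\<phi>\<close> is, over \<open>V\<close>, the limit of the smooth sections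
  \<open>s\<close>, and \<open>\<omega>\<close> is the limit of their derivatives along the frame
  field \<open>v\<close>.\<close>

definition C1_lim :: "(nat \<Rightarrow> 'n \<Rightarrow> 'h) \<Rightarrow> ('n \<Rightarrow> 'h) \<Rightarrow> 'e \<Rightarrow> ('n \<Rightarrow> 'h) \<Rightarrow> bool" where
  "C1_lim s \<phi> v \<omega> \<longleftrightarrow> (\<forall>j. s j \<in> sm) \<and> secs \<phi> \<and> secs \<omega> \<and>
     loc_unif_conv F V s \<phi> \<and> loc_unif_conv F V (\<lambda>j. dv v (s j)) \<omega>"

text \<open>Compatibility of the connection with the inner product survives the passage to limits of sections,
  by termwise differentiation.\<close>

lemma has_ddir_inner_limit:
  assumes s: "C1_lim s \<phi> v \<omega>" and t: "C1_lim t \<psi> v \<omega>'" and y: "y \<in> ball y0 R"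
  shows "has_ddir (\<lambda>y. sec_inner F \<phi> \<psi> (p y)) v (sec_inner F \<omega> \<psi> (p y) + sec_inner F \<phi> \<omega>' (p y)) y"
proof -
  have py: "p y \<in> V" by (rule p_ball(3)[OF y]) (use R in simp)
  have s': "loc_unif_conv F V s \<phi>" "\<And>j. s j \<in> sm" "secs \<phi>"
    "loc_unif_conv F V (\<lambda>j. dv v (s j)) \<omega>" "\<And>j. dv v (s j) \<in> sm" "secs \<omega>"
    using s dv_sm by (auto simp: C1_lim_def)
  have t': "loc_unif_conv F V t \<psi>" "\<And>j. t j \<in> sm" "secs \<psi>"
    "loc_unif_conv F V (\<lambda>j. dv v (t j)) \<omega>'" "\<And>j. dv v (t j) \<in> sm" "secs \<omega>'"
    using t dv_sm by (auto simp: C1_lim_def)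
  obtain W0 where W0: "open W0" "p y \<in> W0" "W0 \<subseteq> V"
    "uniform_limit W0 (\<lambda>j. sec_inner F (s j) (t j)) (sec_inner F \<phi> \<psi>) sequentially"
    by (rule inner_limit[OF s'(1-3) t'(1-3) py]) (rule that)
  obtain W1 where W1: "open W1" "p y \<in> W1" "W1 \<subseteq> V"
    "uniform_limit W1 (\<lambda>j. sec_inner F (dv v (s j)) (t j)) (sec_inner F \<omega> \<psi>) sequentially"
    by (rule inner_limit[OF s'(4-6) t'(1-3) py]) (rule that)
  obtain W2 where W2: "open W2" "p y \<in> W2" "W2 \<subseteq> V"
    "uniform_limit W2 (\<lambda>j. sec_inner F (s j) (dv v (t j))) (sec_inner F \<phi> \<omega>') sequentially"
    by (rule inner_limit[OF s'(1-3) t'(4-6) py]) (rule that)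
  let ?W = "W0 \<inter> W1 \<inter> W2"
  let ?S = "{y \<in> ball y0 R. p y \<in> ?W}"
  have u0: "uniform_limit ?W (\<lambda>j. sec_inner F (s j) (t j)) (sec_inner F \<phi> \<psi>) sequentially"
    by (rule uniform_limit_on_subset[OF W0(4)]) auto
  have u1: "uniform_limit ?W (\<lambda>j. sec_inner F (dv v (s j)) (t j)) (sec_inner F \<omega> \<psi>) sequentially"
    by (rule uniform_limit_on_subset[OF W1(4)]) auto
  have u2: "uniform_limit ?W (\<lambda>j. sec_inner F (s j) (dv v (t j))) (sec_inner F \<phi> \<omega>') sequentially"
    by (rule uniform_limit_on_subset[OF W2(4)]) auto
  show ?thesis
  proof (rule has_ddir_limit[where V="?S" and f="\<lambda>j y. sec_inner F (s j) (t j) (p y)"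
        and g="\<lambda>j y. sec_inner F (dv v (s j)) (t j) (p y) + sec_inner F (s j) (dv v (t j)) (p y)"
        and G="\<lambda>y. sec_inner F \<omega> \<psi> (p y) + sec_inner F \<phi> \<omega>' (p y)"])
    show "open ?S" using W0 W1 W2 by (intro open_p_vimage) auto
    show "y \<in> ?S" using y W0 W1 W2 by auto
    show "uniform_limit ?S (\<lambda>j y. sec_inner F (dv v (s j)) (t j) (p y) + sec_inner F (s j) (dv v (t j)) (p y))
        (\<lambda>y. sec_inner F \<omega> \<psi> (p y) + sec_inner F \<phi> \<omega>' (p y)) sequentially"
      by (intro uniform_limit_add uniform_limit_p u1 u2)
    fix j x assume x: "x \<in> ?S"
    then show "has_ddir (\<lambda>y. sec_inner F (s j) (t j) (p y)) v
        (sec_inner F (dv v (s j)) (t j) (p x) + sec_inner F (s j) (dv v (t j)) (p x)) x"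
      by (intro has_ddir_inner s' t') auto
    show "(\<lambda>j. sec_inner F (s j) (t j) (p x)) \<longlonglongrightarrow> sec_inner F \<phi> \<psi> (p x)"
      using tendsto_uniform_limitI[OF uniform_limit_p[OF u0] x] .
  qed
qed

lemma hdist_self: "hdist (fibre F x) u u = 0"
proof -
  interpret complex_hilbert_space "fibre F x" by (rule fibre_hilbert)
  show ?thesis by (cases "u \<in> H x") (simp_all add: hdist_embed, simp add: hdist_def)
qed

lemma C1_lim_const:
  assumes "s \<in> sm" shows "C1_lim (\<lambda>j. s) s v (dv v s)"
  using assms dv_sm[OF assms] open_nbhd[of R]
  by (auto simp: C1_lim_def secs_sm loc_unif_conv_def hdist_self uniform_limit_iff intro!: exI[of _ V])

text \<open>Differentiating the inner product of \<open>\<phi>\<close> with a smooth section \<open>t\<close>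
  determines the inner product of \<open>\<omega>\<close> with \<open>t\<close>, and smooth sections
  separate points.\<close>

lemma C1_lim_unique:
  assumes "C1_lim s \<phi> v \<omega>" "C1_lim s' \<phi> v \<omega>'" "x \<in> V"
  shows "\<omega> x = \<omega>' x"
proof (rule dense_eqI)
  show "\<omega> x \<in> H x" "\<omega>' x \<in> H x" using assms by (auto simp: C1_lim_def secs_def)
  fix t assume t: "t \<in> sm"
  have y: "c x \<in> ball y0 R" "p (c x) = x" using assms(3) p_c by (auto simp: nbhd_def)
  have "sec_inner F \<omega> t x + sec_inner F \<phi> (dv v t) x = sec_inner F \<omega>' t x + sec_inner F \<phi> (dv v t) x"
    using has_ddir_unique[OF has_ddir_inner_limit[OF assms(1) C1_lim_const[OF t] y(1)]
        has_ddir_inner_limit[OF assms(2) C1_lim_const[OF t] y(1)]] y(2) by simp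
  then show "hinner (fibre F x) (\<omega> x) (t x) = hinner (fibre F x) (\<omega>' x) (t x)"
    by (simp add: sec_inner_def)
qed

lemma sections_secs: "\<phi> \<in> sections F U \<Longrightarrow> V \<subseteq> U \<Longrightarrow> secs \<phi>"
  by (auto simp: sections_def secs_def)

lemma C1_approx_C1_lim:
  assumes U: "open U" "V \<subseteq> U" and \<phi>: "\<phi> \<in> sections F U" and s: "C1_approx M F U s \<phi>"
  obtains \<omega> where "C1_lim s \<phi> v \<omega>"
proof -
  obtain \<omega> where w: "\<omega> \<in> sections F U" "loc_unif_conv F U (\<lambda>j. nabla_restr M F U (rframe U v) (s j)) \<omega>"
    using s rframe_Vect[OF U(1)] unfolding C1_approx_def by blast
  have sm: "\<And>j. s j \<in> sm" and conv: "loc_unif_conv F U s \<phi>" using s unfolding C1_approx_def by auto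
  have "C1_lim s \<phi> v \<omega>"
    unfolding C1_lim_def
    using sm sections_secs[OF \<phi> U(2)] sections_secs[OF w(1) U(2)]
      loc_unif_conv_subset[OF conv open_nbhd U(2), of s \<phi>]
      loc_unif_conv_subset[OF w(2) open_nbhd U(2), of "\<lambda>j. dv v (s j)" \<omega>]
      nabla_restr_rframe[OF U(1) _ _ sm] U(2) by (simp add: subset_iff)
  then show ?thesis by (rule that)
qed

lemma loc_unif_conv_inner_tendsto:
  assumes conv: "loc_unif_conv F V s \<phi>" and s: "\<And>j. s j \<in> sm" and "secs \<phi>" "x \<in> V" "z \<in> H x"
  shows "(\<lambda>j. hinner (fibre F x) (s j x) z) \<longlonglongrightarrow> hinner (fibre F x) (\<phi> x) z"
proof -
  interpret complex_hilbert_space "fibre F x" by (rule fibre_hilbert)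
  obtain W where W: "x \<in> W" "uniform_limit W (\<lambda>j y. hdist (fibre F y) (s j y) (\<phi> y)) (\<lambda>y. 0) sequentially"
    using conv assms(4) unfolding loc_unif_conv_def by blast
  have "(\<lambda>j. hdist (fibre F x) (s j x) (\<phi> x)) \<longlonglongrightarrow> 0" using tendsto_uniform_limitI[OF W(2,1)] .
  then have "limitin (htopology (fibre F x)) (\<lambda>j. s j x) (\<phi> x) sequentially"
    unfolding htopology_def Metric_space.limitin_metric_dist_null[OF Metric_space_hdist]
    using sm_in[OF s] secsD[OF assms(3,4)] by simp
  from limitin_inner[OF this assms(5)] show ?thesis .
qed

text \<open>The limit in the definition of \<^const>\<open>nabla_on\<close> is unique: for every approximating
  sequence the derivative along \<open>X\<close> is the same combination of the derivatives along
  the frame fields, whose limits are unique.\<close>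

lemma nabla_on_expansion:
  assumes U: "open U" "V \<subseteq> U" and \<phi>: "\<phi> \<in> sections F U" and s: "C1_approx M F U s \<phi>"
    and \<omega>: "\<And>b. b \<in> Bs \<Longrightarrow> C1_lim s' \<phi> b (\<omega> b)"
    and X: "X \<in> Vect M U" and x: "x \<in> V"
  shows "nabla_on M F U X \<phi> x \<in> H x"
    and "z \<in> H x \<Longrightarrow> hinner (fibre F x) (nabla_on M F U X \<phi> x) z =
      (\<Sum>b\<in>Bs. X x (coord b) * hinner (fibre F x) (\<omega> b x) z)"
proof -
  interpret complex_hilbert_space "fibre F x" by (rule fibre_hilbert)
  have xU: "x \<in> U" using x U(2) by auto
  have char: "v \<in> H x \<and> (\<forall>z\<in>H x. hinner (fibre F x) v z = (\<Sum>b\<in>Bs. X x (coord b) * hinner (fibre F x) (\<omega> b x) z))"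
    if t: "C1_approx M F U t \<phi>" and v: "limitin (htopology (fibre F x)) (\<lambda>j. nabla_restr M F U X (t j) x) v sequentially"
    for t v
  proof (intro conjI ballI)
    show vH: "v \<in> H x" using v by (simp add: limitin_htopology)
    fix z assume z: "z \<in> H x"
    have tsm: "\<And>j. t j \<in> sm" using t by (simp add: C1_approx_def)
    have 1: "(\<lambda>j. hinner (fibre F x) (nabla_restr M F U X (t j) x) z) \<longlonglongrightarrow> hinner (fibre F x) v z"
      by (rule limitin_inner[OF v z])
    have "(\<lambda>j. hinner (fibre F x) (dv b (t j) x) z) \<longlonglongrightarrow> hinner (fibre F x) (\<omega> b x) z" if b: "b \<in> Bs" for b
    proof -
      obtain \<omega>' where w': "C1_lim t \<phi> b \<omega>'" by (rule C1_approx_C1_lim[OF U \<phi> t])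
      have "\<omega>' x = \<omega> b x" by (rule C1_lim_unique[OF w' \<omega>[OF b] x])
      with loc_unif_conv_inner_tendsto[of "\<lambda>j. dv b (t j)" \<omega>' x z] w' z x show ?thesis
        by (simp add: C1_lim_def dv_sm)
    qed
    then have "(\<lambda>j. \<Sum>b\<in>Bs. X x (coord b) * hinner (fibre F x) (dv b (t j) x) z) \<longlonglongrightarrow>
        (\<Sum>b\<in>Bs. X x (coord b) * hinner (fibre F x) (\<omega> b x) z)" by (intro tendsto_intros)
    with 1 show "hinner (fibre F x) v z = (\<Sum>b\<in>Bs. X x (coord b) * hinner (fibre F x) (\<omega> b x) z)"
      unfolding nabla_restr_inner(2)[OF xU x X tsm z] by (rule LIMSEQ_unique)
  qed
  obtain \<omega>X where wX: "\<omega>X \<in> sections F U" "loc_unif_conv F U (\<lambda>j. nabla_restr M F U X (s j)) \<omega>X"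
    using s X unfolding C1_approx_def by blast
  have "limitin (htopology (fibre F x)) (\<lambda>j. nabla_restr M F U X (s j) x) (\<omega>X x) sequentially"
  proof -
    obtain W where W: "x \<in> W" "uniform_limit W
        (\<lambda>j y. hdist (fibre F y) (nabla_restr M F U X (s j) y) (\<omega>X y)) (\<lambda>y. 0) sequentially"
      using wX(2) xU unfolding loc_unif_conv_def by blast
    have "(\<lambda>j. hdist (fibre F x) (nabla_restr M F U X (s j) x) (\<omega>X x)) \<longlonglongrightarrow> 0"
      using tendsto_uniform_limitI[OF W(2,1)] .
    then show ?thesis
      unfolding htopology_def Metric_space.limitin_metric_dist_null[OF Metric_space_hdist]
      using nabla_restr_inner(1)[OF xU x X] s wX(1) xU by (auto simp: C1_approx_def sections_def)
  qed
  with s have ex: "\<exists>s. C1_approx M F U s \<phi> \<and>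
     limitin (htopology (fibre F x)) (\<lambda>j. nabla_restr M F U X (s j) x) (\<omega>X x) sequentially" by blast
  have "(THE v. \<exists>s. C1_approx M F U s \<phi> \<and>
     limitin (htopology (fibre F x)) (\<lambda>j. nabla_restr M F U X (s j) x) v sequentially) = \<omega>X x"
  proof (rule the_equality, rule ex)
    fix v assume "\<exists>s. C1_approx M F U s \<phi> \<and>
     limitin (htopology (fibre F x)) (\<lambda>j. nabla_restr M F U X (s j) x) v sequentially"
    then show "v = \<omega>X x" using char ex by (intro inner_eqI) auto
  qed
  then have eq: "nabla_on M F U X \<phi> x = \<omega>X x" using xU by (simp add: nabla_on_def)
  show "nabla_on M F U X \<phi> x \<in> H x" using ex char unfolding eq by blast
  show "z \<in> H x \<Longrightarrow> hinner (fibre F x) (nabla_on M F U X \<phi> x) z =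
      (\<Sum>b\<in>Bs. X x (coord b) * hinner (fibre F x) (\<omega> b x) z)"
    using ex char unfolding eq by blast
qed

lemma nabla_on_rframe:
  assumes U: "open U" "V \<subseteq> U" and \<phi>: "\<phi> \<in> sections F U" and s: "C1_approx M F U s \<phi>"
    and x: "x \<in> V" and \<omega>: "C1_lim s \<phi> v \<omega>"
  shows "nabla_on M F U (rframe U v) \<phi> x = \<omega> x"
proof -
  interpret complex_hilbert_space "fibre F x" by (rule fibre_hilbert)
  have "\<forall>b. \<exists>w. C1_lim s \<phi> b w" using C1_approx_C1_lim[OF U \<phi> s] by metis
  then obtain w where w: "\<And>b. C1_lim s \<phi> b (w b)" by metis
  have xU: "x \<in> U" using x U(2) by auto
  have ssm: "\<And>j. s j \<in> sm" using s by (simp add: C1_approx_def)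
  note N = nabla_on_expansion[OF U \<phi> s w rframe_Vect[OF U(1)] x]
  show ?thesis
  proof (rule inner_eqI[OF N(1)])
    show "\<omega> x \<in> H x" using \<omega> x by (auto simp: C1_lim_def secs_def)
    fix z assume z: "z \<in> H x"
    have lim: "(\<lambda>j. hinner (fibre F x) (dv b (s j) x) z) \<longlonglongrightarrow> hinner (fibre F x) (w b x) z"
      if "C1_lim s \<phi> b (w b)" for b and w :: "'e \<Rightarrow> 'n \<Rightarrow> 'h"
      using that loc_unif_conv_inner_tendsto[of "\<lambda>j. dv b (s j)" "w b" x z] z x by (simp add: C1_lim_def dv_sm)
    have "(\<lambda>j. \<Sum>b\<in>Bs. frame v x (coord b) * hinner (fibre F x) (dv b (s j) x) z) \<longlonglongrightarrow>
        (\<Sum>b\<in>Bs. frame v x (coord b) * hinner (fibre F x) (w b x) z)"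
      by (intro tendsto_intros lim w)
    moreover have "(\<lambda>j. hinner (fibre F x) (dv v (s j) x) z) \<longlonglongrightarrow> hinner (fibre F x) (\<omega> x) z"
      using lim[of v "\<lambda>_. \<omega>"] \<omega> by simp
    ultimately have "(\<Sum>b\<in>Bs. frame v x (coord b) * hinner (fibre F x) (w b x) z) = hinner (fibre F x) (\<omega> x) z"
      unfolding nabla_expansion[OF x frame_Vect[of v] ssm z] by (rule LIMSEQ_unique)
    then show "hinner (fibre F x) (nabla_on M F U (rframe U v) \<phi> x) z = hinner (fibre F x) (\<omega> x) z"
      using N(2)[OF z] xU by (simp add: rframe_def)
  qed
qed

end

section \<open>Parallel transport along horizontal sections\<close>

lemma Gamma_Suc_subset: "Gamma M F U (Suc n) \<subseteq> Gamma M F U n"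
  by (cases n) auto

lemma Gamma_subset_0: "Gamma M F U n \<subseteq> Gamma0 F U"
  by (induction n) (use Gamma_Suc_subset in fastforce)+

lemma Gamma_C1_approx: "\<phi> \<in> Gamma M F U (Suc n) \<Longrightarrow> \<exists>s. C1_approx M F U s \<phi>"
proof (induction n)
  case (Suc n)
  then show ?case using Gamma_Suc_subset by blast
qed simp

lemma Gamma_inf_Gamma: "\<phi> \<in> Gamma_inf M F U \<Longrightarrow> \<phi> \<in> Gamma M F U n"
  by (simp add: Gamma_inf_def)

lemma Gamma_inf_Gamma0: "\<phi> \<in> Gamma_inf M F U \<Longrightarrow> \<phi> \<in> Gamma0 F U"
  using Gamma_inf_Gamma[of \<phi> M F U 0] by simp

lemma Gamma_inf_sections: "\<phi> \<in> Gamma_inf M F U \<Longrightarrow> \<phi> \<in> sections F U"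
  using Gamma_inf_Gamma0[of \<phi> M F U] unfolding Gamma0_def by simp

text \<open>The operators \<open>A(X)\<close> over a neighbourhood \<open>U\<close> of the ball
  \<open>V\<close>: they are skew, and there is a horizontal section through every point of the
  field over \<open>U\<close>.\<close>

locale horizontal_field = hilbert_field_chart Bs M D c y0 R F
  for Bs :: "'e::real_inner set" and M :: "('n::{t2_space,second_countable_topology}, 'e) atlas"
    and D c y0 R and F :: "('n, 'h) hilbert_field" +
  fixes U :: "'n set" and A :: "'n vfield \<Rightarrow> 'n \<Rightarrow> 'h operator"
  assumes open_U: "open U" and V_U: "nbhd R \<subseteq> U"
    and A_field: "X \<in> Vect M U \<Longrightarrow> smooth_operator_field M F U (A X)"
    and A_skew: "X \<in> Vect M U \<Longrightarrow> \<phi> \<in> Gamma_inf M F U \<Longrightarrow> \<psi> \<in> Gamma_inf M F U \<Longrightarrow> y \<in> U \<Longrightarrow>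
         sec_inner F (op_apply U (A X) \<phi>) \<psi> y =
           sec_inner F \<phi> (sec_scale F U (\<lambda>z. - 1) (op_apply U (A (vf_cnj X)) \<psi>)) y"
    and A_horizontal: "proj F h \<in> U \<Longrightarrow> \<exists>\<phi>\<in>Gamma_inf M F U. \<phi> (proj F h) = h \<and>
         (\<forall>X\<in>Vect M U. nabla_on M F U X \<phi> = op_apply U (A X) \<phi>)"
begin

text \<open>The sections that are parallel for the connection \<open>\<nabla> - A\<close>.\<close>

definition Hor :: "('n \<Rightarrow> 'h) set" where
  "Hor = {\<phi> \<in> Gamma_inf M F U. \<forall>X\<in>Vect M U. nabla_on M F U X \<phi> = op_apply U (A X) \<phi>}"

abbreviation a :: "'e \<Rightarrow> 'n \<Rightarrow> 'h operator" where "a v \<equiv> A (rframe U v)"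

lemma rframe_U: "rframe U v \<in> Vect M U"
  by (rule rframe_Vect[OF open_U])

lemma Hor_Gamma: "\<psi> \<in> Hor \<Longrightarrow> \<psi> \<in> Gamma_inf M F U"
  by (simp add: Hor_def)

lemma Hor_through:
  assumes "x \<in> U" "u \<in> H x"
  shows "\<exists>\<psi>\<in>Hor. \<psi> x = u"
  using A_horizontal[of u] assms by (auto simp: H_proj Hor_def)

lemma Gamma_inf_in: "\<phi> \<in> Gamma_inf M F U \<Longrightarrow> x \<in> U \<Longrightarrow> \<phi> x \<in> H x"
  using Gamma_inf_sections[of \<phi> M F U] by (auto simp: sections_def)

lemma op_apply_Gamma: "X \<in> Vect M U \<Longrightarrow> \<phi> \<in> Gamma_inf M F U \<Longrightarrow> op_apply U (A X) \<phi> \<in> Gamma_inf M F U"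
  using A_field unfolding smooth_operator_field_def by blast

text \<open>The domain of each operator contains the values of smooth sections, and a horizontal section,
  which is smooth, passes through every point.\<close>

lemma A_everywhere_defined:
  assumes "x \<in> U" "u \<in> H x" "X \<in> Vect M U"
  shows "u \<in> odom (A X x)"
proof -
  obtain \<psi> where "\<psi> \<in> Hor" "\<psi> x = u" using Hor_through[OF assms(1,2)] by blast
  then show ?thesis using A_field[OF assms(3)] assms(1) Hor_Gamma unfolding smooth_operator_field_def by blast
qed

lemma oact_closed: "x \<in> U \<Longrightarrow> u \<in> H x \<Longrightarrow> X \<in> Vect M U \<Longrightarrow> oact (A X x) u \<in> H x"
  using A_field[of X] A_everywhere_defined[of x u X]
  unfolding smooth_operator_field_def linear_operator_def by blast

lemma oact_add: "x \<in> U \<Longrightarrow> u \<in> H x \<Longrightarrow> w \<in> H x \<Longrightarrow> X \<in> Vect M U \<Longrightarrow>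
    oact (A X x) (hadd (fibre F x) u w) = hadd (fibre F x) (oact (A X x) u) (oact (A X x) w)"
  using A_field[of X] A_everywhere_defined[of x u X] A_everywhere_defined[of x w X]
  unfolding smooth_operator_field_def linear_operator_def by blast

lemma oact_scale: "x \<in> U \<Longrightarrow> u \<in> H x \<Longrightarrow> X \<in> Vect M U \<Longrightarrow>
    oact (A X x) (hscale (fibre F x) q u) = hscale (fibre F x) q (oact (A X x) u)"
  using A_field[of X] A_everywhere_defined[of x u X]
  unfolding smooth_operator_field_def linear_operator_def by blast

text \<open>Skewness holds for sections in \<open>\<Gamma>\<^sup>\<infinity>(U)\<close>. It carries over to
  all vectors in the fibre at \<open>x\<close>, because these are values of horizontal sections.\<close>

lemma oact_skew:
  assumes x: "x \<in> U" and u: "u \<in> H x" and w: "w \<in> H x"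
  shows "hinner (fibre F x) (oact (a v x) u) w = - hinner (fibre F x) u (oact (a v x) w)"
proof -
  interpret complex_hilbert_space "fibre F x" by (rule fibre_hilbert)
  obtain \<phi> where \<phi>: "\<phi> \<in> Hor" "\<phi> x = u" using Hor_through[OF x u] by blast
  obtain \<psi> where \<psi>: "\<psi> \<in> Hor" "\<psi> x = w" using Hor_through[OF x w] by blast
  show ?thesis
    using A_skew[OF rframe_U Hor_Gamma[OF \<phi>(1)] Hor_Gamma[OF \<psi>(1)] x, of v] x \<phi>(2) \<psi>(2)
      oact_closed[OF x w rframe_U] u
    by (simp add: sec_inner_def op_apply_def sec_scale_def vf_cnj_rframe inner_scale_right)
qed

lemma C1_lim_cong:
  assumes "C1_lim s \<phi> v \<omega>" "\<And>x. x \<in> V \<Longrightarrow> \<omega> x = \<omega>' x" "\<And>x. x \<in> V \<Longrightarrow> \<phi> x = \<phi>' x"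
  shows "C1_lim s \<phi>' v \<omega>'"
  using assms loc_unif_conv_subset[of F V _ \<phi> V s \<phi>'] loc_unif_conv_subset[of F V "\<lambda>j. dv v (s j)" \<omega> V "\<lambda>j. dv v (s j)" \<omega>']
    open_nbhd[of R] unfolding C1_lim_def secs_def by auto

lemma Hor_C1_lim:
  assumes "\<psi> \<in> Hor"
  obtains s where "\<And>v. C1_lim s \<psi> v (op_apply U (a v) \<psi>)"
proof -
  have \<psi>: "\<psi> \<in> Gamma_inf M F U" "\<psi> \<in> sections F U"
    using Hor_Gamma[OF assms] Gamma_inf_sections by auto
  then obtain s where s: "C1_approx M F U s \<psi>"
    using Gamma_C1_approx[OF Gamma_inf_Gamma[of \<psi> M F U "Suc 0"]] by blast
  have "C1_lim s \<psi> v (op_apply U (a v) \<psi>)" for v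
  proof -
    obtain \<omega> where w: "C1_lim s \<psi> v \<omega>" by (rule C1_approx_C1_lim[OF open_U V_U \<psi>(2) s])
    show ?thesis
    proof (rule C1_lim_cong[OF w])
      fix x assume "x \<in> V"
      then show "\<omega> x = op_apply U (a v) \<psi> x"
        using nabla_on_rframe[OF open_U V_U \<psi>(2) s _ w] assms rframe_U by (simp add: Hor_def)
    qed simp
  qed
  then show ?thesis by (rule that)
qed

lemma V_inU: "x \<in> V \<Longrightarrow> x \<in> U"
  using V_U by auto

abbreviation x0 :: 'n where "x0 \<equiv> p y0"
abbreviation K :: "'h hilbert" where "K \<equiv> fibre F x0"
abbreviation B0 :: "'e set" where "B0 \<equiv> ball y0 R"

lemma pV: "y \<in> B0 \<Longrightarrow> p y \<in> V" and cp: "y \<in> B0 \<Longrightarrow> c (p y) = y"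
  using p_ball[of y R] R by auto

lemma cV: "x \<in> V \<Longrightarrow> c x \<in> B0" and pc: "x \<in> V \<Longrightarrow> p (c x) = x"
  using p_c by (auto simp: nbhd_def)

lemma y0_B0: "y0 \<in> B0" using R by simp

lemma x0_V: "x0 \<in> V" by (rule pV[OF y0_B0])

text \<open>The derivative of the inner product of two horizontal sections is
  \<open>\<langle>A \<phi>, \<psi>\<rangle> + \<langle>\<phi>, A \<psi>\<rangle> = 0\<close>, and
  the ball is connected by radial segments.\<close>

lemma Hor_inner_const:
  assumes \<phi>: "\<phi> \<in> Hor" and \<psi>: "\<psi> \<in> Hor" and x: "x \<in> V"
  shows "hinner (fibre F x) (\<phi> x) (\<psi> x) = hinner K (\<phi> x0) (\<psi> x0)"
proof -
  let ?f = "\<lambda>y. sec_inner F \<phi> \<psi> (p y)"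
  obtain s where s: "\<And>v. C1_lim s \<phi> v (op_apply U (a v) \<phi>)" by (rule Hor_C1_lim[OF \<phi>]) (rule that)
  obtain t where t: "\<And>v. C1_lim t \<psi> v (op_apply U (a v) \<psi>)" by (rule Hor_C1_lim[OF \<psi>]) (rule that)
  have d: "has_ddir ?f v 0 y" if y: "y \<in> B0" for v y
  proof -
    have u: "p y \<in> U" using pV[OF y] V_inU by blast
    have "sec_inner F (op_apply U (a v) \<phi>) \<psi> (p y) + sec_inner F \<phi> (op_apply U (a v) \<psi>) (p y) = 0"
      using oact_skew[OF u Gamma_inf_in[OF Hor_Gamma[OF \<phi>] u] Gamma_inf_in[OF Hor_Gamma[OF \<psi>] u], of v] u
      by (simp add: sec_inner_def op_apply_def)
    then show ?thesis using has_ddir_inner_limit[OF s t y, of v] by simp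
  qed
  let ?y = "c x"
  have seg: "y0 + t *\<^sub>R (?y - y0) \<in> B0" if "t \<in> {0..1}" for t
    by (rule segment_point_in_convex[OF convex_ball y0_B0 cV[OF x] that])
  have "((\<lambda>t. ?f (y0 + t *\<^sub>R (?y - y0))) has_vector_derivative 0) (at t within {0..1})" if "t \<in> {0..1}" for t
    by (rule has_ddir_line[OF d[OF seg[OF that]]])
  from has_vector_derivative_zero_constant[OF convex_real_interval(5) this]
  obtain k where "\<And>t. t \<in> {0..1} \<Longrightarrow> ?f (y0 + t *\<^sub>R (?y - y0)) = k" by blast
  from this[of 0] this[of 1] have "?f ?y = ?f y0" by simp
  then show ?thesis using pc[OF x] by (simp add: sec_inner_def)
qed

text \<open>Parallel transport from \<open>x\<close> to the centre \<open>x0\<close> along a horizontal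
  section.\<close>

definition T :: "'n \<Rightarrow> 'h \<Rightarrow> 'h" where
  "T x u = (SOME \<psi>. \<psi> \<in> Hor \<and> \<psi> x = u) x0"

lemma Hor_in: "\<psi> \<in> Hor \<Longrightarrow> x \<in> V \<Longrightarrow> \<psi> x \<in> H x"
  using Gamma_inf_in Hor_Gamma V_inU by blast

text \<open>The choice of the horizontal section does not matter: two that agree at \<open>x\<close> have the
  same constant inner products with all horizontal sections, whose values at \<open>x0\<close>
  exhaust the fibre.\<close>

lemma T_Hor:
  assumes "\<psi> \<in> Hor" "x \<in> V"
  shows "T x (\<psi> x) = \<psi> x0"
proof -
  interpret complex_hilbert_space K by (rule fibre_hilbert)
  have ex: "\<exists>\<psi>'. \<psi>' \<in> Hor \<and> \<psi>' x = \<psi> x" using assms by blast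
  define \<psi>' where "\<psi>' = (SOME \<psi>'. \<psi>' \<in> Hor \<and> \<psi>' x = \<psi> x)"
  have psi': "\<psi>' \<in> Hor" "\<psi>' x = \<psi> x" using someI_ex[OF ex] by (auto simp: \<psi>'_def)
  have "\<psi>' x0 = \<psi> x0"
  proof (rule inner_eqI)
    fix z assume "z \<in> H x0"
    then obtain \<zeta> where z: "\<zeta> \<in> Hor" "\<zeta> x0 = z" using Hor_through V_inU[OF x0_V] by blast
    show "hinner K (\<psi>' x0) z = hinner K (\<psi> x0) z"
      using Hor_inner_const[OF psi'(1) z(1) assms(2)] Hor_inner_const[OF assms(1) z(1) assms(2)] psi'(2) z(2)
      by simp
  qed (use Hor_in x0_V psi' assms in auto)
  then show ?thesis by (simp add: T_def \<psi>'_def)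
qed

lemma T_unitary:
  assumes x: "x \<in> V"
  shows "unitary_map (fibre F x) K (T x)"
proof (rule unitary_mapI[OF fibre_hilbert fibre_hilbert])
  show "T x ` H x = H x0"
  proof (intro equalityI subsetI)
    fix z assume "z \<in> T x ` H x"
    then obtain u where u: "u \<in> H x" "z = T x u" by blast
    obtain \<psi> where "\<psi> \<in> Hor" "\<psi> x = u" using Hor_through[OF V_inU[OF x] u(1)] by blast
    then show "z \<in> H x0" using T_Hor[OF _ x] u(2) Hor_in[OF _ x0_V] by metis
  next
    fix z assume "z \<in> H x0"
    then obtain \<zeta> where z: "\<zeta> \<in> Hor" "\<zeta> x0 = z" using Hor_through V_inU[OF x0_V] by blast
    then show "z \<in> T x ` H x" using T_Hor[OF z(1) x] Hor_in[OF z(1) x] by (metis imageI)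
  qed
  fix u w assume "u \<in> H x" "w \<in> H x"
  then obtain \<phi> \<psi> where "\<phi> \<in> Hor" "\<phi> x = u" "\<psi> \<in> Hor" "\<psi> x = w"
    using Hor_through[OF V_inU[OF x]] by meson
  then show "hinner K (T x u) (T x w) = hinner (fibre F x) u w"
    using T_Hor[OF _ x] Hor_inner_const[OF _ _ x] by metis
qed

sublocale KH: complex_hilbert_space K
  by (rule fibre_hilbert)

text \<open>In the trivialization, sections over \<open>V\<close> become functions from the ball into the
  Banach space of bounded functions, with values in the image \<open>S\<close> of the fibre at the
  centre.\<close>

definition tr :: "'n \<Rightarrow> 'h \<Rightarrow> 'h bfun" where
  "tr x u = embed K (T x u)"

abbreviation S :: "'h bfun set" where "S \<equiv> embed K ` H x0"

lemma T_in: "x \<in> V \<Longrightarrow> u \<in> H x \<Longrightarrow> T x u \<in> H x0"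
  using T_unitary unfolding unitary_map_def by blast

lemma tr_S: "x \<in> V \<Longrightarrow> u \<in> H x \<Longrightarrow> tr x u \<in> S"
  by (simp add: tr_def T_in)

lemma tr_add: "x \<in> V \<Longrightarrow> u \<in> H x \<Longrightarrow> w \<in> H x \<Longrightarrow> tr x (hadd (fibre F x) u w) = tr x u + tr x w"
  using T_unitary[of x] T_in by (simp add: tr_def unitary_map_def KH.embed_add)

lemma tr_scale: "x \<in> V \<Longrightarrow> u \<in> H x \<Longrightarrow> tr x (hscale (fibre F x) q u) = cscale q (tr x u)"
  using T_unitary[of x] T_in by (simp add: tr_def unitary_map_def KH.embed_scale)

lemma T_inner: "x \<in> V \<Longrightarrow> u \<in> H x \<Longrightarrow> w \<in> H x \<Longrightarrow> hinner K (T x u) (T x w) = hinner (fibre F x) u w"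
  using T_unitary[of x] by (simp add: unitary_map_def)

lemma tr_sub:
  assumes "x \<in> V" "u \<in> H x" "w \<in> H x"
  shows "tr x (hsub (fibre F x) u w) = tr x u - tr x w"
proof -
  interpret complex_hilbert_space "fibre F x" by (rule fibre_hilbert)
  have "cscale (-1) (tr x w) = - tr x w" by (rule bcontfun_eqI) (simp add: apply_cscale)
  then show ?thesis unfolding hsub_def using assms by (simp add: tr_add tr_scale scale_closed)
qed

lemma norm_tr: "x \<in> V \<Longrightarrow> u \<in> H x \<Longrightarrow> norm (tr x u) = hnorm (fibre F x) u"
  using T_inner[of x u u] by (simp add: tr_def KH.norm_embed T_in hnorm_def)

lemma hdist_tr:
  assumes "x \<in> V" "u \<in> H x" "w \<in> H x"
  shows "hdist (fibre F x) u w = norm (tr x u - tr x w)"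
proof -
  interpret complex_hilbert_space "fibre F x" by (rule fibre_hilbert)
  show ?thesis using assms norm_tr[OF assms(1) sub_closed[OF assms(2,3)]]
    by (simp add: hdist_def tr_sub)
qed

lemma tr_inj: "x \<in> V \<Longrightarrow> u \<in> H x \<Longrightarrow> w \<in> H x \<Longrightarrow> tr x u = tr x w \<Longrightarrow> u = w"
  using Metric_space.zero[OF complex_hilbert_space.Metric_space_hdist[OF fibre_hilbert], of u x w] hdist_tr[of x u w]
  by simp

lemma tr_Hor: "\<psi> \<in> Hor \<Longrightarrow> x \<in> V \<Longrightarrow> tr x (\<psi> x) = embed K (\<psi> x0)"
  by (simp add: tr_def T_Hor)

definition hor :: "'h \<Rightarrow> ('n \<Rightarrow> 'h)" where
  "hor k = (SOME \<psi>. \<psi> \<in> Hor \<and> \<psi> x0 = k)"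

lemma hor: assumes "k \<in> H x0" shows "hor k \<in> Hor" "hor k x0 = k"
proof -
  have "\<exists>\<psi>. \<psi> \<in> Hor \<and> \<psi> x0 = k" using Hor_through[OF V_inU[OF x0_V] assms] by blast
  from someI_ex[OF this] show "hor k \<in> Hor" "hor k x0 = k" by (auto simp: hor_def)
qed

lemma tr_hor: "k \<in> H x0 \<Longrightarrow> x \<in> V \<Longrightarrow> tr x (hor k x) = embed K k"
  by (simp add: tr_Hor hor)

lemma hor_T:
  assumes "x \<in> V" "u \<in> H x"
  shows "hor (T x u) x = u"
proof (rule tr_inj[OF assms(1) _ assms(2)])
  show "hor (T x u) x \<in> H x" by (rule Hor_in[OF hor(1)[OF T_in[OF assms]] assms(1)])
  show "tr x (hor (T x u) x) = tr x u"
    unfolding tr_hor[OF T_in[OF assms] assms(1)] by (simp add: tr_def)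
qed

lemma apply_tr:
  assumes "x \<in> V" "u \<in> H x"
  shows "apply_bcontfun (tr x u) z = (if of_discrete z \<in> H x0 \<and> hnorm K (of_discrete z) \<le> 1
     then hinner (fibre F x) u (hor (of_discrete z) x) else 0)"
proof -
  have "hinner K (T x u) k = hinner (fibre F x) u (hor k x)" if "k \<in> H x0" for k
    using T_inner[OF assms Hor_in[OF hor(1)[OF that] assms(1)]] T_Hor[OF hor(1)[OF that] assms(1)] hor(2)[OF that]
    by simp
  then show ?thesis unfolding tr_def by (simp add: KH.apply_embed T_in assms)
qed

sublocale ops: operator_families Bs S "KH.hip"
  by (intro operator_families.intro finite_onb_axioms KH.real_hilbert_subspace_embed)

text \<open>The operators \<open>A(v)\<close> in the trivialization; \<open>BB_tr\<close> below is the
  relation that characterizes them.\<close>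

definition BB :: "'e \<Rightarrow> 'e \<Rightarrow> 'h bfun \<Rightarrow> 'h bfun" where
  "BB v y w = tr (p y) (oact (a v (p y)) (hor (KH.unembed w) (p y)))"

lemma BB_tr: "x \<in> V \<Longrightarrow> u \<in> H x \<Longrightarrow> BB v (c x) (tr x u) = tr x (oact (a v x) u)"
  by (simp add: BB_def pc tr_def[of x u] KH.unembed T_in hor_T)

lemma BB_embed: "k \<in> H x0 \<Longrightarrow> y \<in> B0 \<Longrightarrow> BB v y (embed K k) = tr (p y) (op_apply U (a v) (hor k) (p y))"
  using V_inU[OF pV] by (simp add: BB_def KH.unembed op_apply_def)

lemma S_tr:
  assumes "w \<in> S" "y \<in> B0"
  obtains u where "u \<in> H (p y)" "w = tr (p y) u"
proof -
  obtain k where k: "k \<in> H x0" "w = embed K k" using assms(1) by blast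
  show ?thesis
    by (rule that[of "hor k (p y)"]) (use k pV[OF assms(2)] in \<open>simp_all add: tr_hor Hor_in hor\<close>)
qed

lemma hip_tr: "x \<in> V \<Longrightarrow> u \<in> H x \<Longrightarrow> w \<in> H x \<Longrightarrow> KH.hip (tr x u) (tr x w) = Re (hinner (fibre F x) u w)"
  by (simp add: tr_def KH.hip_embed T_in T_inner)

lemma BB_skew: "ops.skew_family B0 (BB v)"
  unfolding ops.skew_family_def
proof (intro ballI conjI)
  fix y w assume y: "y \<in> B0" and w: "w \<in> S"
  obtain u where u: "u \<in> H (p y)" "w = tr (p y) u" by (rule S_tr[OF w y])
  note V = pV[OF y] and V' = V_inU[OF pV[OF y]]
  have Bw: "BB v y w = tr (p y) (oact (a v (p y)) u)" using BB_tr[OF V u(1), of v] u(2) cp[OF y] by simp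
  show "BB v y w \<in> S" unfolding Bw by (intro tr_S V oact_closed V' u(1) rframe_U)
  fix w' assume w': "w' \<in> S"
  obtain u' where u': "u' \<in> H (p y)" "w' = tr (p y) u'" by (rule S_tr[OF w' y])
  have Bw': "BB v y w' = tr (p y) (oact (a v (p y)) u')" using BB_tr[OF V u'(1), of v] u'(2) cp[OF y] by simp
  show "KH.hip (BB v y w) w' = - KH.hip w (BB v y w')"
    unfolding Bw Bw' unfolding u(2) u'(2) using oact_skew[OF V' u(1) u'(1), of v]
    by (simp add: hip_tr V u(1) u'(1) oact_closed V' rframe_U)
qed

lemma BB_add:
  assumes y: "y \<in> B0" and "w \<in> S" "w' \<in> S"
  shows "BB v y (w + w') = BB v y w + BB v y w'"
proof -
  note V = pV[OF y] and V' = V_inU[OF pV[OF y]]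
  interpret complex_hilbert_space "fibre F (p y)" by (rule fibre_hilbert)
  obtain u where u: "u \<in> H (p y)" "w = tr (p y) u" by (rule S_tr[OF assms(2) y])
  obtain u' where u': "u' \<in> H (p y)" "w' = tr (p y) u'" by (rule S_tr[OF assms(3) y])
  show ?thesis
    using BB_tr[OF V u(1), of v] BB_tr[OF V u'(1), of v] BB_tr[OF V add_closed[OF u(1) u'(1)], of v]
    unfolding u(2) u'(2) cp[OF y]
    by (simp add: tr_add[OF V] u(1) u'(1) oact_add V' rframe_U oact_closed)
qed

lemma BB_cscale:
  assumes y: "y \<in> B0" and "w \<in> S"
  shows "BB v y (cscale q w) = cscale q (BB v y w)"
proof -
  note V = pV[OF y] and V' = V_inU[OF pV[OF y]]
  interpret complex_hilbert_space "fibre F (p y)" by (rule fibre_hilbert)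
  obtain u where u: "u \<in> H (p y)" "w = tr (p y) u" by (rule S_tr[OF assms(2) y])
  show ?thesis
    using BB_tr[OF V u(1), of v] BB_tr[OF V scale_closed[OF u(1)], of v q]
    unfolding u(2) cp[OF y]
    by (simp add: tr_scale[OF V] u(1) oact_scale V' rframe_U oact_closed)
qed

section \<open>Smooth sections are smooth in the trivialization\<close>

text \<open>Compare \<open>\<phi>\<close> near \<open>p y\<close> with the horizontal section
  \<open>\<psi>\<close> that has the same value there. The trivialization makes
  \<open>\<psi>\<close> constant, so the distance between the values is
  \<open>|\<phi> - \<psi>|\<close>, which is continuous as a combination of inner products and
  vanishes at \<open>p y\<close>.\<close>

lemma continuous_tr:
  assumes s: "loc_unif_conv F V s \<phi>" "\<And>j. s j \<in> sm" "secs \<phi>"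
  shows "continuous_on B0 (\<lambda>y. tr (p y) (\<phi> (p y)))"
  unfolding continuous_on_eq_continuous_at[OF open_ball]
proof
  fix y assume y: "y \<in> B0"
  note V = pV[OF y]
  obtain \<psi> where \<psi>: "\<psi> \<in> Hor" "\<psi> (p y) = \<phi> (p y)"
    using Hor_through[OF V_inU[OF V] secsD[OF s(3) V]] by blast
  obtain t where t: "\<And>v. C1_lim t \<psi> v (op_apply U (a v) \<psi>)" by (rule Hor_C1_lim[OF \<psi>(1)]) (rule that)
  have t': "loc_unif_conv F V t \<psi>" "\<And>j. t j \<in> sm" "secs \<psi>" using t by (auto simp: C1_lim_def)
  let ?g = "\<lambda>z. Re (sec_inner F \<phi> \<phi> (p z)) - 2 * Re (sec_inner F \<phi> \<psi> (p z)) + Re (sec_inner F \<psi> \<psi> (p z))"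
  have g: "(norm (tr (p z) (\<phi> (p z)) - tr (p y) (\<phi> (p y))))\<^sup>2 = ?g z" if z: "z \<in> B0" for z
  proof -
    note Vz = pV[OF z]
    interpret complex_hilbert_space "fibre F (p z)" by (rule fibre_hilbert)
    have in_H: "\<phi> (p z) \<in> H (p z)" "\<psi> (p z) \<in> H (p z)" using secsD s(3) t'(3) Vz by auto
    let ?d = "hsub (fibre F (p z)) (\<phi> (p z)) (\<psi> (p z))"
    have "tr (p y) (\<phi> (p y)) = tr (p z) (\<psi> (p z))" using tr_Hor[OF \<psi>(1) V] tr_Hor[OF \<psi>(1) Vz] \<psi>(2) by simp
    then have "(norm (tr (p z) (\<phi> (p z)) - tr (p y) (\<phi> (p y))))\<^sup>2 = (hnorm (fibre F (p z)) ?d)\<^sup>2"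
      using tr_sub[OF Vz in_H] norm_tr[OF Vz sub_closed[OF in_H]] by simp
    also have "\<dots> = Re (hinner (fibre F (p z)) ?d ?d)"
      using inner_self[OF sub_closed[OF in_H]] by simp
    also have "\<dots> = ?g z"
      using in_H inner_cnj[OF in_H] by (simp add: inner_sub inner_sub_right sub_closed sec_inner_def)
    finally show ?thesis .
  qed
  have "continuous_on B0 ?g"
    by (intro continuous_intros continuous_on_inner_limit[OF s s] continuous_on_inner_limit[OF s t']
        continuous_on_inner_limit[OF t' t'])
  then have "isCont ?g y" using y by (simp add: continuous_on_eq_continuous_at)
  moreover have "?g y = 0" using g[OF y] by simp
  ultimately have "(?g \<longlongrightarrow> 0) (at y)" by (simp add: isCont_def)
  then have "((\<lambda>z. sqrt (?g z)) \<longlongrightarrow> sqrt 0) (at y)" by (rule tendsto_real_sqrt)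
  then have "((\<lambda>z. sqrt (?g z)) \<longlongrightarrow> 0) (at y)" by simp
  then have "((\<lambda>z. norm (tr (p z) (\<phi> (p z)) - tr (p y) (\<phi> (p y)))) \<longlongrightarrow> 0) (at y)"
  proof (rule Lim_transform_eventually)
    have "\<forall>\<^sub>F z in at y. z \<in> B0" using y eventually_at_in_open'[OF open_ball] by blast
    then show "\<forall>\<^sub>F z in at y. sqrt (?g z) = norm (tr (p z) (\<phi> (p z)) - tr (p y) (\<phi> (p y)))"
      by eventually_elim (simp only: g[symmetric] real_sqrt_abs abs_norm_cancel)
  qed
  then show "isCont (\<lambda>y. tr (p y) (\<phi> (p y))) y"
    unfolding isCont_def using tendsto_norm_zero_iff LIM_zero_iff by blast
qed

lemma Gamma0_V:
  assumes "\<phi> \<in> Gamma0 F Q" "V \<subseteq> Q"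
  obtains s where "loc_unif_conv F V s \<phi>" "\<And>j. s j \<in> sm" "secs \<phi>"
proof -
  obtain s where "\<And>j. s j \<in> sm" "loc_unif_conv F Q s \<phi>" using assms(1) by (auto simp: Gamma0_def)
  then show ?thesis
    using that loc_unif_conv_subset[OF _ open_nbhd assms(2)] sections_secs[OF _ assms(2)] assms(1)
    unfolding Gamma0_def by blast
qed

lemma BB_continuous: "w \<in> S \<Longrightarrow> continuous_on B0 (\<lambda>y. BB v y w)"
proof -
  assume "w \<in> S"
  then obtain k where k: "k \<in> H x0" "w = embed K k" by blast
  let ?\<phi> = "op_apply U (a v) (hor k)"
  have "?\<phi> \<in> Gamma_inf M F U" by (rule op_apply_Gamma[OF rframe_U Hor_Gamma[OF hor(1)[OF k(1)]]])
  then have "?\<phi> \<in> Gamma0 F U" by (rule Gamma_inf_Gamma0)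
  then obtain s where s: "loc_unif_conv F V s ?\<phi>" "\<And>j. s j \<in> sm" "secs ?\<phi>" by (rule Gamma0_V[OF _ V_U]) (rule that)
  have "continuous_on B0 (\<lambda>y. tr (p y) (?\<phi> (p y)))" by (rule continuous_tr[OF s])
  then show ?thesis by (rule continuous_on_eq) (simp add: k BB_embed)
qed

text \<open>In the trivialization the connection becomes \<open>\<partial>\<^sub>v + A(v)\<close>. Tested
  against a horizontal section \<open>\<psi>\<close> this is the product rule
  \<open>\<partial>\<^sub>v\<langle>\<phi>, \<psi>\<rangle> = \<langle>\<nabla>\<^sub>v\<phi>, \<psi>\<rangle> + \<langle>\<phi>, A \<psi>\<rangle>\<close>.
  The passage from these scalar derivatives to a derivative in norm uses that the right-hand side is
  continuous.\<close>

lemma has_ddir_tr: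
  assumes s: "C1_lim s \<phi> v \<omega>" and y: "y \<in> B0"
  shows "has_ddir (\<lambda>y. tr (p y) (\<phi> (p y))) v (tr (p y) (\<omega> (p y)) - BB v y (tr (p y) (\<phi> (p y)))) y"
proof (rule has_ddir_bcontfun[where V=B0 and g="\<lambda>y. tr (p y) (\<omega> (p y)) - BB v y (tr (p y) (\<phi> (p y)))"])
  have s': "loc_unif_conv F V s \<phi>" "\<And>j. s j \<in> sm" "secs \<phi>"
    "loc_unif_conv F V (\<lambda>j. dv v (s j)) \<omega>" "\<And>j. dv v (s j) \<in> sm" "secs \<omega>"
    using s dv_sm by (auto simp: C1_lim_def)
  have "Ck_on 0 B0 (\<lambda>y. BB v y (tr (p y) (\<phi> (p y))))"
    by (rule ops.Ck_on_apply_family[OF open_ball BB_skew])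
      (auto simp: BB_continuous continuous_tr[OF s'(1-3)] intro!: tr_S pV secsD[OF s'(3)])
  then show "continuous_on B0 (\<lambda>y. tr (p y) (\<omega> (p y)) - BB v y (tr (p y) (\<phi> (p y))))"
    by (intro continuous_intros continuous_tr[OF s'(4-6)]) simp
  fix y and z :: "'h discrete" assume y: "y \<in> B0"
  note V = pV[OF y] and V' = V_inU[OF pV[OF y]]
  let ?k = "of_discrete z"
  show "has_ddir (\<lambda>y. apply_bcontfun (tr (p y) (\<phi> (p y))) z) v
      (apply_bcontfun (tr (p y) (\<omega> (p y)) - BB v y (tr (p y) (\<phi> (p y)))) z) y"
  proof (cases "?k \<in> H x0 \<and> hnorm K ?k \<le> 1")
    case False
    have "has_ddir (\<lambda>_. 0) v 0 y" by simp
    moreover have "apply_bcontfun (tr (p y) (\<phi> (p y))) z = 0" if "y \<in> B0" for y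
      unfolding apply_tr[OF pV[OF that] secsD[OF s'(3) pV[OF that]]] using False by auto
    moreover have "apply_bcontfun (tr (p y) (\<omega> (p y)) - BB v y (tr (p y) (\<phi> (p y)))) z = 0"
      using False BB_tr[OF V secsD[OF s'(3) V], of v] cp[OF y]
        apply_tr[OF V secsD[OF s'(6) V]] apply_tr[OF V oact_closed[OF V' secsD[OF s'(3) V] rframe_U]] by auto
    ultimately show ?thesis using has_ddir_cong[OF open_ball y, of "\<lambda>_. 0" "\<lambda>y. apply_bcontfun (tr (p y) (\<phi> (p y))) z"] by simp
  next
    case True
    let ?h = "hor ?k"
    have h: "?h \<in> Hor" using hor(1) True by blast
    obtain t where t: "\<And>v. C1_lim t ?h v (op_apply U (a v) ?h)" by (rule Hor_C1_lim[OF h]) (rule that)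
    have d: "has_ddir (\<lambda>y. sec_inner F \<phi> ?h (p y)) v
        (sec_inner F \<omega> ?h (p y) + sec_inner F \<phi> (op_apply U (a v) ?h) (p y)) y"
      by (rule has_ddir_inner_limit[OF s t y])
    have "apply_bcontfun (tr (p y) (\<omega> (p y)) - BB v y (tr (p y) (\<phi> (p y)))) z =
        sec_inner F \<omega> ?h (p y) + sec_inner F \<phi> (op_apply U (a v) ?h) (p y)"
      using True BB_tr[OF V secsD[OF s'(3) V], of v] cp[OF y]
        apply_tr[OF V secsD[OF s'(6) V], of z] apply_tr[OF V oact_closed[OF V' secsD[OF s'(3) V] rframe_U[of v]], of z]
        oact_skew[OF V' secsD[OF s'(3) V] Hor_in[OF h V], of v] V'
      by (simp add: sec_inner_def op_apply_def)
    then have d': "has_ddir (\<lambda>y. sec_inner F \<phi> ?h (p y)) v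
        (apply_bcontfun (tr (p y) (\<omega> (p y)) - BB v y (tr (p y) (\<phi> (p y)))) z) y" using d by simp
    have "sec_inner F \<phi> ?h (p y) = apply_bcontfun (tr (p y) (\<phi> (p y))) z" if "y \<in> B0" for y
      unfolding apply_tr[OF pV[OF that] secsD[OF s'(3) pV[OF that]]] using True by (simp add: sec_inner_def)
    with d' show ?thesis
      using has_ddir_cong[OF open_ball y, of "\<lambda>y. sec_inner F \<phi> ?h (p y)" "\<lambda>y. apply_bcontfun (tr (p y) (\<phi> (p y))) z"]
      by blast
  qed
qed (use y in auto)

text \<open>The induction runs simultaneously over sections and operators. The sections
  \<open>A(v)\<psi>\<close> with \<open>\<psi>\<close> horizontal are in
  \<open>\<Gamma>\<^sup>n(U)\<close>, so by the induction hypothesis the operators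
  \<open>BB v\<close> are strongly \<open>n\<close> times continuously differentiable. Hence so is
  \<open>BB v\<close> applied to \<open>\<phi>\<close>, and
  \<open>\<partial>\<^sub>v\<phi> = \<nabla>\<^sub>v\<phi> - BB v \<phi>\<close> gives one more
  derivative. The open set \<open>Q\<close> is both \<open>U\<close>, for the sections
  \<open>A(v)\<psi>\<close>, and \<open>V\<close>, for the sections to be trivialized.\<close>

lemma Gamma_tr_Ck:
  assumes "open Q" "V \<subseteq> Q" "\<phi> \<in> Gamma M F Q n"
  shows "Ck_on n B0 (\<lambda>y. tr (p y) (\<phi> (p y)))"
  using assms
proof (induction n arbitrary: Q \<phi>)
  case 0
  then have "\<phi> \<in> Gamma0 F Q" by simp
  then obtain s where s: "loc_unif_conv F V s \<phi>" "\<And>j. s j \<in> sm" "secs \<phi>"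
    by (rule Gamma0_V[OF _ 0(2)]) (rule that)
  show ?case using continuous_tr[OF s] by simp
next
  case (Suc n)
  have BBn: "Ck_on n B0 (\<lambda>y. BB v y w)" if "w \<in> S" for v w
  proof -
    from that obtain k where k: "k \<in> H x0" "w = embed K k" by blast
    let ?\<phi> = "op_apply U (a v) (hor k)"
    have "?\<phi> \<in> Gamma M F U n"
      by (intro Gamma_inf_Gamma op_apply_Gamma[OF rframe_U Hor_Gamma[OF hor(1)[OF k(1)]]])
    then have "Ck_on n B0 (\<lambda>y. tr (p y) (?\<phi> (p y)))" by (rule Suc.IH[OF open_U V_U])
    then show ?thesis
      using Ck_on_cong[OF open_ball, of y0 R "\<lambda>y. BB v y w" "\<lambda>y. tr (p y) (?\<phi> (p y))" n] k
      by (simp add: BB_embed)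
  qed
  have \<phi>n: "\<phi> \<in> Gamma M F Q n" using Suc.prems(3) Gamma_Suc_subset by blast
  have \<phi>sec: "\<phi> \<in> sections F Q" using Suc.prems(3) Gamma_subset_0 unfolding Gamma0_def by blast
  obtain s where s: "C1_approx M F Q s \<phi>" using Gamma_C1_approx[OF Suc.prems(3)] by blast
  have "\<forall>v. \<exists>w. C1_lim s \<phi> v w" using C1_approx_C1_lim[OF Suc.prems(1,2) \<phi>sec s] by metis
  then obtain \<omega> where \<omega>: "\<And>v. C1_lim s \<phi> v (\<omega> v)" by metis
  have \<omega>n: "Ck_on n B0 (\<lambda>y. tr (p y) (\<omega> v (p y)))" for v
  proof (cases n)
    case 0
    have "loc_unif_conv F V (\<lambda>j. dv v (s j)) (\<omega> v)" "\<And>j. dv v (s j) \<in> sm" "secs (\<omega> v)"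
      using \<omega>[of v] dv_sm by (auto simp: C1_lim_def)
    from continuous_tr[OF this] show ?thesis using 0 by simp
  next
    case (Suc m)
    have "nabla_on M F Q (rframe Q v) \<phi> \<in> Gamma M F Q n"
      using Suc.prems(3) rframe_Vect[OF Suc.prems(1)] Suc by simp
    from Suc.IH[OF Suc.prems(1,2) this] 
    have "Ck_on n B0 (\<lambda>y. tr (p y) (nabla_on M F Q (rframe Q v) \<phi> (p y)))" .
    then show ?thesis
      using Ck_on_cong[OF open_ball, of y0 R "\<lambda>y. tr (p y) (\<omega> v (p y))"
          "\<lambda>y. tr (p y) (nabla_on M F Q (rframe Q v) \<phi> (p y))" n]
        nabla_on_rframe[OF Suc.prems(1,2) \<phi>sec s pV \<omega>] by simp
  qed
  have \<phi>S: "tr (p y) (\<phi> (p y)) \<in> S" if "y \<in> B0" for y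
    using sections_secs[OF \<phi>sec Suc.prems(2)] that by (intro tr_S pV secsD)
  have c: "continuous_on B0 (\<lambda>y. tr (p y) (\<phi> (p y)))"
    by (rule Ck_on_continuous[OF Suc.IH[OF Suc.prems(1,2) \<phi>n]])
  have 1: "Ck_on n B0 (\<lambda>y. tr (p y) (\<omega> v (p y)) + (-1) *\<^sub>R BB v y (tr (p y) (\<phi> (p y))))" for v
    by (rule Ck_on_add[OF \<omega>n Ck_on_scale[OF Ck_on_const
            ops.Ck_on_apply_family[OF open_ball BB_skew BBn Suc.IH[OF Suc.prems(1,2) \<phi>n] \<phi>S]]])
  have 2: "has_ddir (\<lambda>y. tr (p y) (\<phi> (p y))) v (tr (p y) (\<omega> v (p y)) + (-1) *\<^sub>R BB v y (tr (p y) (\<phi> (p y)))) y"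
    if "y \<in> B0" for v y
    using has_ddir_tr[OF \<omega> that, of v] by simp
  show ?case by (rule Ck_on_SucI[OF c 1 2])
qed

lemma BB_smooth: "w \<in> S \<Longrightarrow> Ck_on k B0 (\<lambda>y. BB v y w)"
proof -
  assume "w \<in> S"
  then obtain h where h: "h \<in> H x0" "w = embed K h" by blast
  let ?\<phi> = "op_apply U (a v) (hor h)"
  have "?\<phi> \<in> Gamma M F U k"
    by (intro Gamma_inf_Gamma op_apply_Gamma[OF rframe_U Hor_Gamma[OF hor(1)[OF h(1)]]])
  then have "Ck_on k B0 (\<lambda>y. tr (p y) (?\<phi> (p y)))" by (rule Gamma_tr_Ck[OF open_U V_U])
  then show ?thesis
    using Ck_on_cong[OF open_ball, of y0 R "\<lambda>y. BB v y w" "\<lambda>y. tr (p y) (?\<phi> (p y))" k] h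
    by (simp add: BB_embed)
qed

lemma hilbert_CinfI:
  assumes f: "f \<in> V \<rightarrow>\<^sub>E H x0" and s: "\<And>k. Ck_on k B0 (\<lambda>y. embed K (f (p y)))"
  shows "f \<in> hilbert_Cinf M V K"
  unfolding hilbert_Cinf_def
proof (intro CollectI conjI f, clarify)
  fix D' c' k assume C': "(D', c') \<in> M"
  have "Ck_on k (c ` V) (\<lambda>y. embed K (f (p y)))" using s c_nbhd[of R] R by simp
  then have "Ck_on k (c' ` (D' \<inter> V)) (\<lambda>y. embed K (f (inv_into D' c' y)))"
    by (intro Ck_on_change_of_chart[OF chart C' open_nbhd, where f="\<lambda>x. embed K (f x)"]) (auto simp: nbhd_def)
  moreover have "(f \<circ> inv_into D' c') ` (c' ` (D' \<inter> V)) \<subseteq> H x0"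
    using chart_inverse(1)[OF C'] f by auto
  ultimately show "hilbert_Ck_on k (c' ` (D' \<inter> V)) K (f \<circ> inv_into D' c')"
    by (simp add: KH.hilbert_Ck_on_iff[OF chart_image_open_Int[OF C' open_nbhd]])
qed

lemma hilbert_CinfD:
  assumes "f \<in> hilbert_Cinf M V K"
  shows "f \<in> V \<rightarrow>\<^sub>E H x0" "Ck_on k B0 (\<lambda>y. embed K (f (p y)))"
proof -
  show "f \<in> V \<rightarrow>\<^sub>E H x0" using assms by (simp add: hilbert_Cinf_def)
  have "hilbert_Ck_on k (c ` (D \<inter> V)) K (f \<circ> p)" using assms chart by (auto simp: hilbert_Cinf_def)
  moreover have "D \<inter> V = V" by (auto simp: nbhd_def)
  ultimately have "hilbert_Ck_on k B0 K (f \<circ> p)" using c_nbhd[of R] R by simp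
  then show "Ck_on k B0 (\<lambda>y. embed K (f (p y)))" by (simp add: KH.hilbert_Ck_on_iff)
qed

lemma Gamma_inf_to_Cinf:
  assumes "\<phi> \<in> Gamma_inf M F V"
  shows "(\<lambda>x\<in>V. T x (\<phi> x)) \<in> hilbert_Cinf M V K"
proof (rule hilbert_CinfI)
  show "(\<lambda>x\<in>V. T x (\<phi> x)) \<in> V \<rightarrow>\<^sub>E H x0"
    using Gamma_inf_sections[OF assms] by (auto simp: sections_def intro!: T_in)
  fix k
  have "Ck_on k B0 (\<lambda>y. tr (p y) (\<phi> (p y)))"
    by (rule Gamma_tr_Ck[OF open_nbhd subset_refl Gamma_inf_Gamma[OF assms]])
  then show "Ck_on k B0 (\<lambda>y. embed K ((\<lambda>x\<in>V. T x (\<phi> x)) (p y)))"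
    using Ck_on_cong[OF open_ball, of y0 R "\<lambda>y. embed K ((\<lambda>x\<in>V. T x (\<phi> x)) (p y))" "\<lambda>y. tr (p y) (\<phi> (p y))" k]
    by (simp add: pV tr_def)
qed

end

context horizontal_field
begin

lemma S_closed_cscale: "w \<in> S \<Longrightarrow> cscale q w \<in> S"
  by (auto simp: KH.embed_scale[symmetric] KH.scale_closed)

lemma S_closed_add: "w \<in> S \<Longrightarrow> w' \<in> S \<Longrightarrow> w + w' \<in> S"
  by (auto simp: KH.embed_add[symmetric] KH.add_closed)

lemma S_closed_0: "0 \<in> S"
  by (rule subspace_0[OF ops.subspace_S])

lemma S_closed_sum: "finite I \<Longrightarrow> (\<And>i. i \<in> I \<Longrightarrow> f i \<in> S) \<Longrightarrow> (\<Sum>i\<in>I. f i) \<in> S"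
  by (rule subspace_sum[OF ops.subspace_S])

lemma BB_0: "y \<in> B0 \<Longrightarrow> BB v y 0 = 0"
  using ops.skew_family_diff[OF BB_skew _ S_closed_0 S_closed_0] by simp

lemma BB_sum:
  assumes y: "y \<in> B0" and "finite I" "\<And>i. i \<in> I \<Longrightarrow> f i \<in> S"
  shows "BB v y (\<Sum>i\<in>I. f i) = (\<Sum>i\<in>I. BB v y (f i))"
  using assms(2,3)
  by (induction I rule: finite_induct) (simp_all add: BB_0[OF y] BB_add[OF y] S_closed_sum)

lemma BB_S: "y \<in> B0 \<Longrightarrow> w \<in> S \<Longrightarrow> BB v y w \<in> S"
  by (rule ops.skew_family_in[OF BB_skew])

lemma BB_bounded_on_cball:
  assumes "r < R"
  obtains C where "C \<ge> 0" "\<And>y w. y \<in> cball y0 r \<Longrightarrow> w \<in> S \<Longrightarrow> norm (BB v y w) \<le> C * norm w"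
proof -
  have sub: "cball y0 r \<subseteq> B0" using assms by auto
  have "\<exists>C\<ge>0. \<forall>y\<in>cball y0 r. \<forall>w\<in>S. norm (BB v y w) \<le> C * norm w"
  proof (rule ops.skew_uniformly_bounded)
    fix w assume w: "w \<in> S"
    have "compact ((\<lambda>y. BB v y w) ` cball y0 r)"
      by (rule compact_continuous_image[OF continuous_on_subset[OF BB_continuous[OF w] sub] compact_cball])
    from compact_imp_bounded[OF this] show "\<exists>C. \<forall>y\<in>cball y0 r. norm (BB v y w) \<le> C"
      by (auto simp: bounded_iff)
  qed (use sub ops.skew_family_in[OF BB_skew] ops.skew_family_ip[OF BB_skew] in blast)+
  then show ?thesis using that by blast
qed

section \<open>Approximation by global smooth sections\<close>

text \<open>\<open>\<Phi>\<close> with prescribed covariant derivatives \<open>\<Phi>'\<close> along the frame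
  is, uniformly on smaller balls, a limit of global smooth sections together with their covariant
  derivatives.\<close>

definition approximable :: "('e \<Rightarrow> 'h bfun) \<Rightarrow> ('e \<Rightarrow> 'e \<Rightarrow> 'h bfun) \<Rightarrow> bool" where
  "approximable \<Phi> \<Phi>' \<longleftrightarrow> (\<forall>r<R. \<forall>\<epsilon>>0. \<exists>s\<in>sm. \<forall>x\<in>nbhd r. norm (tr x (s x) - \<Phi> (c x)) \<le> \<epsilon> \<and>
     (\<forall>b\<in>Bs. norm (tr x (dv b s x) - \<Phi>' b (c x)) \<le> \<epsilon>))"

lemma nbhd_V: "x \<in> nbhd r \<Longrightarrow> r < R \<Longrightarrow> x \<in> V"
  using nbhd_mono[of r R] by auto

lemma approximable_add:
  assumes "approximable \<Phi> \<Phi>'" "approximable \<Psi> \<Psi>'"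
  shows "approximable (\<lambda>y. \<Phi> y + \<Psi> y) (\<lambda>b y. \<Phi>' b y + \<Psi>' b y)"
  unfolding approximable_def
proof (intro allI impI)
  fix r \<epsilon> :: real assume r: "r < R" and \<epsilon>: "\<epsilon> > 0"
  obtain s where s: "s \<in> sm" "\<And>x. x \<in> nbhd r \<Longrightarrow> norm (tr x (s x) - \<Phi> (c x)) \<le> \<epsilon> / 2"
    "\<And>x b. x \<in> nbhd r \<Longrightarrow> b \<in> Bs \<Longrightarrow> norm (tr x (dv b s x) - \<Phi>' b (c x)) \<le> \<epsilon> / 2"
    using assms(1) r half_gt_zero[OF \<epsilon>] unfolding approximable_def by meson
  obtain t where t: "t \<in> sm" "\<And>x. x \<in> nbhd r \<Longrightarrow> norm (tr x (t x) - \<Psi> (c x)) \<le> \<epsilon> / 2"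
    "\<And>x b. x \<in> nbhd r \<Longrightarrow> b \<in> Bs \<Longrightarrow> norm (tr x (dv b t x) - \<Psi>' b (c x)) \<le> \<epsilon> / 2"
    using assms(2) r half_gt_zero[OF \<epsilon>] unfolding approximable_def by meson
  have est: "norm (p1 + p2 - (q1 + q2)) \<le> \<epsilon>" if "norm (p1 - q1) \<le> \<epsilon> / 2" "norm (p2 - q2) \<le> \<epsilon> / 2"
    for p1 p2 q1 q2 :: "'h bfun"
    using norm_diff_triangle_ineq[of p1 p2 q1 q2] that by linarith
  show "\<exists>s\<in>sm. \<forall>x\<in>nbhd r. norm (tr x (s x) - (\<Phi> (c x) + \<Psi> (c x))) \<le> \<epsilon> \<and>
     (\<forall>b\<in>Bs. norm (tr x (dv b s x) - (\<Phi>' b (c x) + \<Psi>' b (c x))) \<le> \<epsilon>)"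
  proof (intro bexI[OF _ sm_add[OF s(1) t(1)]] ballI conjI)
    fix x assume x: "x \<in> nbhd r"
    note xV = nbhd_V[OF x r]
    show "norm (tr x (sec_add F UNIV s t x) - (\<Phi> (c x) + \<Psi> (c x))) \<le> \<epsilon>"
      using est[OF s(2)[OF x] t(2)[OF x]] by (simp add: sec_add_def tr_add xV sm_in s(1) t(1))
    fix b assume b: "b \<in> Bs"
    show "norm (tr x (dv b (sec_add F UNIV s t) x) - (\<Phi>' b (c x) + \<Psi>' b (c x))) \<le> \<epsilon>"
      using est[OF s(3)[OF x b] t(3)[OF x b]]
      by (simp add: dv_add tr_add xV sm_in dv_sm s(1) t(1))
  qed
qed

lemma ex_sm: "\<exists>s. s \<in> sm"
proof (rule ccontr)
  assume "\<not> ?thesis"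
  then have "sm = {}" by blast
  moreover have "htopology K closure_of ((\<lambda>s. s x0) ` sm) = H x0"
    using field by (simp add: smooth_hilbert_field_def)
  ultimately show False using KH.zero_closed by simp
qed

lemma approximable_limit:
  assumes "\<And>r \<epsilon>. r < R \<Longrightarrow> \<epsilon> > 0 \<Longrightarrow> \<exists>\<Psi> \<Psi>'. approximable \<Psi> \<Psi>' \<and>
     (\<forall>y\<in>cball y0 r. norm (\<Psi> y - \<Phi> y) \<le> \<epsilon> \<and> (\<forall>b\<in>Bs. norm (\<Psi>' b y - \<Phi>' b y) \<le> \<epsilon>))"
  shows "approximable \<Phi> \<Phi>'"
  unfolding approximable_def
proof (intro allI impI)
  fix r \<epsilon> :: real assume r: "r < R" and \<epsilon>: "\<epsilon> > 0"
  obtain \<Psi> \<Psi>' where P: "approximable \<Psi> \<Psi>'" "\<And>y. y \<in> cball y0 r \<Longrightarrow> norm (\<Psi> y - \<Phi> y) \<le> \<epsilon> / 2"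
    "\<And>y b. y \<in> cball y0 r \<Longrightarrow> b \<in> Bs \<Longrightarrow> norm (\<Psi>' b y - \<Phi>' b y) \<le> \<epsilon> / 2"
    using assms[OF r half_gt_zero[OF \<epsilon>]] by blast
  obtain s where s: "s \<in> sm" "\<And>x. x \<in> nbhd r \<Longrightarrow> norm (tr x (s x) - \<Psi> (c x)) \<le> \<epsilon> / 2"
    "\<And>x b. x \<in> nbhd r \<Longrightarrow> b \<in> Bs \<Longrightarrow> norm (tr x (dv b s x) - \<Psi>' b (c x)) \<le> \<epsilon> / 2"
    using P(1) r half_gt_zero[OF \<epsilon>] unfolding approximable_def by meson
  have est: "norm (u - w) \<le> \<epsilon>" if "norm (u - v) \<le> \<epsilon> / 2" "norm (v - w) \<le> \<epsilon> / 2" for u v w :: "'h bfun"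
    using norm_diff_triangle_ineq[of u v v w] that by simp
  have cx: "c x \<in> cball y0 r" if "x \<in> nbhd r" for x using that by (simp add: nbhd_def less_imp_le)
  show "\<exists>s\<in>sm. \<forall>x\<in>nbhd r. norm (tr x (s x) - \<Phi> (c x)) \<le> \<epsilon> \<and>
     (\<forall>b\<in>Bs. norm (tr x (dv b s x) - \<Phi>' b (c x)) \<le> \<epsilon>)"
    using s(1) est[OF s(2) P(2)[OF cx]] est[OF s(3) P(3)[OF cx]] by blast
qed

lemma loc_unif_conv_compact:
  assumes conv: "loc_unif_conv F V s \<phi>" and "r < R"
  shows "uniform_limit (p ` cball y0 r) (\<lambda>j y. hdist (fibre F y) (s j y) (\<phi> y)) (\<lambda>y. 0) sequentially"
proof -
  let ?C = "p ` cball y0 r"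
  have sub: "cball y0 r \<subseteq> B0" using assms(2) by auto
  have "cball y0 r \<subseteq> c ` D" using sub ball_in_chart R by fastforce
  then have "compact ?C"
    by (intro compact_continuous_image[OF continuous_on_subset[OF continuous_on_p] compact_cball])
  have "?C \<subseteq> V" using pV sub by blast
  then have "\<forall>x\<in>?C. \<exists>W. open W \<and> x \<in> W \<and>
      uniform_limit W (\<lambda>j y. hdist (fibre F y) (s j y) (\<phi> y)) (\<lambda>y. 0) sequentially"
    using conv unfolding loc_unif_conv_def by blast
  then obtain W where W: "\<forall>x\<in>?C. open (W x) \<and> x \<in> W x \<and>
      uniform_limit (W x) (\<lambda>j y. hdist (fibre F y) (s j y) (\<phi> y)) (\<lambda>y. 0) sequentially"
    using bchoice by meson
  have "?C \<subseteq> (\<Union>x\<in>?C. W x)" using W by fast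
  then obtain X where X: "X \<subseteq> ?C" "finite X" "?C \<subseteq> (\<Union>x\<in>X. W x)"
    using compactE_image[OF \<open>compact ?C\<close>, of ?C W] W by metis
  have "uniform_limit (\<Union>x\<in>X. W x) (\<lambda>j y. hdist (fibre F y) (s j y) (\<phi> y)) (\<lambda>y. 0) sequentially"
    by (rule uniform_limit_on_UNION[OF X(2)]) (use W X(1) in blast)
  then show ?thesis by (rule uniform_limit_on_subset[OF _ X(3)])
qed

text \<open>A function with values in the line of \<open>k\<close> is a smooth multiple of the horizontal
  section through \<open>k\<close>. That section is by definition a \<open>C\<^sup>1\<close> limit
  of global smooth sections, which are multiplied by the function, cut off near the boundary of the
  ball.\<close>

lemma approximable_elementary:
  assumes q: "\<And>k. Ck_on k B0 q" and k: "k \<in> H x0"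
  shows "approximable (\<lambda>y. cscale (q y) (embed K k))
    (\<lambda>b y. cscale (ddir q b y) (embed K k) + cscale (q y) (BB b y (embed K k)))"
  unfolding approximable_def
proof (intro allI impI)
  fix r \<epsilon> :: real assume r: "r < R" and \<epsilon>: "\<epsilon> > 0"
  let ?\<psi> = "hor k"
  let ?C = "p ` cball y0 r"
  obtain s where s: "\<And>v. C1_lim s ?\<psi> v (op_apply U (a v) ?\<psi>)" by (rule Hor_C1_lim[OF hor(1)[OF k]]) (rule that)
  have ssm: "s j \<in> sm" for j using s by (simp add: C1_lim_def)
  show "\<exists>s\<in>sm. \<forall>x\<in>nbhd r. norm (tr x (s x) - cscale (q (c x)) (embed K k)) \<le> \<epsilon> \<and>
     (\<forall>b\<in>Bs. norm (tr x (dv b s x) - (cscale (ddir q b (c x)) (embed K k) + cscale (q (c x)) (BB b (c x) (embed K k)))) \<le> \<epsilon>)"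
  proof (cases "r > 0")
    case False
    then have "nbhd r = {}" by (auto simp: nbhd_def) (smt (verit) zero_le_dist)
    then show ?thesis using ex_sm by auto
  next
    case True
    define r' where "r' = (r + R) / 2"
    have r': "r < r'" "r' < R" using r by (auto simp: r'_def)
    define g where "g y = (if y \<in> B0 then q y else 0)" for y
    define Q where "Q = ext (\<lambda>y. bump r r' y * g y)"
    have QC: "Q \<in> Cinf M UNIV"
      unfolding Q_def
    proof (rule ext_Cinf)
      fix m
      show "Ck_on m (ball y0 (4 * R)) (\<lambda>y. bump r r' y * g y)"
      proof (rule Ck_on_local[OF open_ball])
        fix y assume "y \<in> ball y0 (4 * R)"
        show "\<exists>W. open W \<and> y \<in> W \<and> Ck_on m (W \<inter> ball y0 (4 * R)) (\<lambda>y. bump r r' y * g y)"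
        proof (cases "y \<in> B0")
          case True
          have "Ck_on m B0 g" using q Ck_on_cong[OF open_ball, of y0 R g q m] by (simp add: g_def)
          then have "Ck_on m B0 (\<lambda>y. bump r r' y * g y)"
            using \<open>r > 0\<close> r' by (intro Ck_on_mult Ck_on_bump) auto
          then show ?thesis using True by (intro exI[of _ B0] conjI open_ball) (auto intro: Ck_on_subset)
        next
          case False
          let ?W = "- cball y0 r'"
          have o: "open (?W \<inter> ball y0 (4 * R))" by auto
          have "bump r r' z * g z = 0" if "z \<in> ?W \<inter> ball y0 (4 * R)" for z
            using that \<open>r > 0\<close> r' bump_0[of r r' z] by (simp add: dist_norm norm_minus_commute)
          then have "Ck_on m (?W \<inter> ball y0 (4 * R)) (\<lambda>y. bump r r' y * g y)"
            using Ck_on_cong[OF o, of "\<lambda>y. bump r r' y * g y" "\<lambda>_. 0" m] Ck_on_const by blast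
          moreover have "y \<in> ?W" using False r' by auto
          ultimately show ?thesis by (intro exI[of _ ?W]) auto
        qed
      qed
    next
      fix y assume "3 * R \<le> norm (y - y0)"
      then show "bump r r' y * g y = 0" using bump_0[of r r' y] \<open>r > 0\<close> r' R by simp
    qed
    have Qval: "Q (p y) = q y" if "y \<in> ball y0 r" for y
    proof -
      have yB: "y \<in> B0" using that r by auto
      have "norm (y - y0) \<le> r" using that by (simp add: dist_norm norm_minus_commute)
      then show ?thesis using \<open>r > 0\<close> r' yB cp[OF yB] pV[OF yB]
        by (simp add: Q_def ext_def bump_1 g_def nbhd_def)
    qed
    have Qfr: "frame b x Q = ddir q b (c x)" if x: "x \<in> nbhd r" for x b
    proof -
      have cx: "c x \<in> ball y0 r" using x by (simp add: nbhd_def)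
      have "has_ddir (\<lambda>y. Q (p y)) b (frame b x Q) (c x)"
        by (rule frame_at[OF QC V_2R[OF nbhd_V[OF x r]]])
      then have "has_ddir q b (frame b x Q) (c x)"
        using has_ddir_cong[OF open_ball cx, of "\<lambda>y. Q (p y)" q] Qval by blast
      then show ?thesis by (simp add: has_ddir_imp_ddir)
    qed
    have sub: "cball y0 r \<subseteq> B0" using r by auto
    have cont: "continuous_on B0 q" "\<And>b. continuous_on B0 (ddir q b)"
      using q[of "Suc 0"] unfolding Ck_on_Suc_iff[OF open_ball] by auto
    have bd: "\<exists>L. \<forall>y\<in>cball y0 r. cmod (h y) \<le> L" if "continuous_on B0 h" for h
      using compact_imp_bounded[OF compact_continuous_image[OF continuous_on_subset[OF that sub] compact_cball]]
      by (auto simp: bounded_iff)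
    obtain L0 where L0: "\<And>y. y \<in> cball y0 r \<Longrightarrow> cmod (q y) \<le> L0" using bd[OF cont(1)] by blast
    have "\<forall>b. \<exists>L. \<forall>y\<in>cball y0 r. cmod (ddir q b y) \<le> L" using bd[OF cont(2)] by blast
    then obtain L1 where L1: "\<And>b y. y \<in> cball y0 r \<Longrightarrow> cmod (ddir q b y) \<le> L1 b" by metis
    define L where "L = \<bar>L0\<bar> + (\<Sum>b\<in>Bs. \<bar>L1 b\<bar>) + 1"
    have Lpos: "L > 0" by (simp add: L_def add_nonneg_pos sum_nonneg)
    have L: "cmod (q y) \<le> L" "b \<in> Bs \<Longrightarrow> cmod (ddir q b y) \<le> L" if "y \<in> cball y0 r" for y b
    proof -
      have "0 \<le> (\<Sum>b\<in>Bs. \<bar>L1 b\<bar>)" by (simp add: sum_nonneg)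
      then show "cmod (q y) \<le> L" unfolding L_def using L0[OF that] by linarith
      assume "b \<in> Bs"
      then have "\<bar>L1 b\<bar> \<le> (\<Sum>b\<in>Bs. \<bar>L1 b\<bar>)" by (intro member_le_sum finite_Bs) auto
      then show "cmod (ddir q b y) \<le> L" using L1[OF that, of b] by (simp add: L_def)
    qed
    let ?e = "\<epsilon> / (2 * L)"
    have e: "?e > 0" using \<epsilon> Lpos by simp
    have "\<forall>\<^sub>F j in sequentially. \<forall>x\<in>?C. dist (hdist (fibre F x) (s j x) (?\<psi> x)) 0 < ?e"
      by (rule uniform_limitD[OF loc_unif_conv_compact[OF _ r] e]) (use s in \<open>simp add: C1_lim_def\<close>)
    moreover have "\<forall>\<^sub>F j in sequentially. \<forall>b\<in>Bs. \<forall>x\<in>?C. dist (hdist (fibre F x) (dv b (s j) x) (op_apply U (a b) ?\<psi> x)) 0 < ?e"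
    proof (rule eventually_ball_finite[OF finite_Bs], rule ballI)
      fix b
      show "\<forall>\<^sub>F j in sequentially. \<forall>x\<in>?C. dist (hdist (fibre F x) (dv b (s j) x) (op_apply U (a b) ?\<psi> x)) 0 < ?e"
        by (rule uniform_limitD[OF loc_unif_conv_compact[OF _ r] e]) (use s[of b] in \<open>simp add: C1_lim_def\<close>)
    qed
    ultimately have "\<forall>\<^sub>F j in sequentially. (\<forall>x\<in>?C. dist (hdist (fibre F x) (s j x) (?\<psi> x)) 0 < ?e) \<and>
      (\<forall>b\<in>Bs. \<forall>x\<in>?C. dist (hdist (fibre F x) (dv b (s j) x) (op_apply U (a b) ?\<psi> x)) 0 < ?e)"
      by (rule eventually_conj)
    then have "\<exists>j. (\<forall>x\<in>?C. dist (hdist (fibre F x) (s j x) (?\<psi> x)) 0 < ?e) \<and>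
      (\<forall>b\<in>Bs. \<forall>x\<in>?C. dist (hdist (fibre F x) (dv b (s j) x) (op_apply U (a b) ?\<psi> x)) 0 < ?e)"
      by (rule eventually_happens'[OF sequentially_bot])
    then obtain j where j': "\<forall>x\<in>?C. dist (hdist (fibre F x) (s j x) (?\<psi> x)) 0 < ?e"
      "\<forall>b\<in>Bs. \<forall>x\<in>?C. dist (hdist (fibre F x) (dv b (s j) x) (op_apply U (a b) ?\<psi> x)) 0 < ?e"
      by (elim exE conjE) (rule that)
    have j: "dist (hdist (fibre F x) (s j x) (?\<psi> x)) 0 < ?e" if "x \<in> ?C" for x
      by (rule bspec[OF j'(1) that])
    have j2: "dist (hdist (fibre F x) (dv b (s j) x) (op_apply U (a b) ?\<psi> x)) 0 < ?e"
      if "b \<in> Bs" "x \<in> ?C" for b x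
      by (rule bspec[OF bspec[OF j'(2) that(1)] that(2)])
    let ?s = "sec_scale F UNIV Q (s j)"
    have sc: "norm (cscale z w) \<le> \<epsilon> / 2" if "cmod z \<le> L" "norm w \<le> ?e" for z and w :: "'h bfun"
    proof -
      have "norm (cscale z w) \<le> cmod z * norm w" by (rule norm_cscale_le)
      also have "\<dots> \<le> L * ?e" using that Lpos by (intro mult_mono) auto
      also have "\<dots> = \<epsilon> / 2" using Lpos by simp
      finally show ?thesis .
    qed
    show ?thesis
    proof (intro bexI[OF _ sm_scale[OF QC ssm]] ballI conjI)
      fix x assume x: "x \<in> nbhd r"
      note xV = nbhd_V[OF x r]
      have cx: "c x \<in> ball y0 r" "c x \<in> cball y0 r" using x by (auto simp: nbhd_def)
      have xC: "x \<in> ?C" using cx(2) pc[OF xV] by (metis imageI)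
      have Qx: "Q x = q (c x)" using Qval[OF cx(1)] pc[OF xV] by simp
      note hx = Hor_in[OF hor(1)[OF k] xV]
      interpret complex_hilbert_space "fibre F x" by (rule fibre_hilbert)
      have d0: "norm (tr x (s j x) - embed K k) \<le> ?e"
        using j[OF xC] hdist_tr[OF xV sm_in[OF ssm] hx] tr_hor[OF k xV] by simp
      have "tr x (?s x) - cscale (q (c x)) (embed K k) = cscale (q (c x)) (tr x (s j x) - embed K k)"
        by (simp add: sec_scale_def tr_scale xV sm_in ssm Qx bounded_bilinear.diff_right[OF bounded_bilinear_cscale])
      then show "norm (tr x (?s x) - cscale (q (c x)) (embed K k)) \<le> \<epsilon>"
        using sc[OF L(1)[OF cx(2)] d0] \<epsilon> by simp
      fix b assume b: "b \<in> Bs"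
      have xU: "x \<in> U" using V_inU xV .
      have oin: "op_apply U (a b) ?\<psi> x \<in> H x"
        using xU oact_closed[OF xU hx rframe_U] by (simp add: op_apply_def)
      have BBx: "BB b (c x) (embed K k) = tr x (op_apply U (a b) ?\<psi> x)"
        using BB_embed[OF k cV[OF xV]] pc[OF xV] by simp
      have d1: "norm (tr x (dv b (s j) x) - BB b (c x) (embed K k)) \<le> ?e"
        using j2[OF b xC] hdist_tr[OF xV sm_in[OF dv_sm[OF ssm]] oin] BBx by simp
      have "tr x (dv b ?s x) = cscale (ddir q b (c x)) (tr x (s j x)) + cscale (q (c x)) (tr x (dv b (s j) x))"
        unfolding nabla_scale[OF QC frame_Vect ssm]
        by (simp add: sec_add_def sec_scale_def tr_add tr_scale xV sm_in ssm dv_sm scale_closed Qfr[OF x] Qx)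
      then have eq: "tr x (dv b ?s x) - (cscale (ddir q b (c x)) (embed K k) + cscale (q (c x)) (BB b (c x) (embed K k))) =
          cscale (ddir q b (c x)) (tr x (s j x) - embed K k) +
          cscale (q (c x)) (tr x (dv b (s j) x) - BB b (c x) (embed K k))"
        by (simp add: bounded_bilinear.diff_right[OF bounded_bilinear_cscale])
      show "norm (tr x (dv b ?s x) - (cscale (ddir q b (c x)) (embed K k) + cscale (q (c x)) (BB b (c x) (embed K k)))) \<le> \<epsilon>"
        unfolding eq using norm_triangle_ineq sc[OF L(2)[OF cx(2) b] d0] sc[OF L(1)[OF cx(2)] d1]
        by (smt (verit) field_sum_of_halves)
    qed
  qed
qed

lemma approximable_sum:
  assumes "finite E" "\<And>e. e \<in> E \<Longrightarrow> approximable (\<Phi> e) (\<Phi>' e)"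
  shows "approximable (\<lambda>y. \<Sum>e\<in>E. \<Phi> e y) (\<lambda>b y. \<Sum>e\<in>E. \<Phi>' e b y)"
  using assms
proof (induction E rule: finite_induct)
  case empty
  have "approximable (\<lambda>y. cscale 0 (embed K (hzero K)))
    (\<lambda>b y. cscale (ddir (\<lambda>_. 0) b y) (embed K (hzero K)) + cscale 0 (BB b y (embed K (hzero K))))"
    by (rule approximable_elementary[OF Ck_on_const KH.zero_closed])
  moreover have "cscale q (0::'h bfun) = 0" "cscale 0 (w::'h bfun) = 0" for q w
    by (auto intro!: bcontfun_eqI simp: apply_cscale)
  ultimately show ?case by (simp add: KH.embed_zero)
next
  case (insert e E)
  then show ?case using approximable_add[of "\<Phi> e" "\<Phi>' e"] by simp
qed

text \<open>The smooth maps from the ball into the fibre at the centre.\<close>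

definition smooth_S :: "('e \<Rightarrow> 'h bfun) \<Rightarrow> bool" where
  "smooth_S \<Phi> \<longleftrightarrow> (\<forall>k. Ck_on k B0 \<Phi>) \<and> (\<forall>y\<in>B0. \<Phi> y \<in> S)"

lemma smooth_S_ddir:
  assumes "smooth_S \<Phi>"
  shows "smooth_S (ddir \<Phi> v)" "y \<in> B0 \<Longrightarrow> has_ddir \<Phi> v (ddir \<Phi> v y) y"
proof -
  have 1: "Ck_on k B0 (ddir \<Phi> v)" "\<And>y. y \<in> B0 \<Longrightarrow> has_ddir \<Phi> v (ddir \<Phi> v y) y" for k
    using assms Ck_on_Suc_iff[OF open_ball, of k y0 R \<Phi>] unfolding smooth_S_def by blast+
  then show "smooth_S (ddir \<Phi> v)" "y \<in> B0 \<Longrightarrow> has_ddir \<Phi> v (ddir \<Phi> v y) y"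
    using ops.ddir_in_S(1)[OF open_ball _ _ 1(2), of _ y0 R] assms unfolding smooth_S_def by blast+
qed

lemma smooth_S_BB: "smooth_S \<Phi> \<Longrightarrow> smooth_S (\<lambda>y. BB v y (\<Phi> y))"
  unfolding smooth_S_def
  using ops.Ck_on_apply_family[OF open_ball BB_skew BB_smooth] BB_S by blast

lemma smooth_S_add: "smooth_S \<Phi> \<Longrightarrow> smooth_S \<Psi> \<Longrightarrow> smooth_S (\<lambda>y. \<Phi> y + \<Psi> y)"
  unfolding smooth_S_def using Ck_on_add S_closed_add by blast

lemma smooth_S_cscale: "(\<And>k. Ck_on k B0 q) \<Longrightarrow> smooth_S \<Phi> \<Longrightarrow> smooth_S (\<lambda>y. cscale (q y) (\<Phi> y))"
  unfolding smooth_S_def using Ck_on_bilinear[OF bounded_bilinear_cscale] S_closed_cscale by blast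

lemma smooth_S_sum: "finite I \<Longrightarrow> (\<And>i. i \<in> I \<Longrightarrow> smooth_S (\<Phi> i)) \<Longrightarrow> smooth_S (\<lambda>y. \<Sum>i\<in>I. \<Phi> i y)"
  unfolding smooth_S_def by (auto intro!: Ck_on_sum S_closed_sum)

text \<open>The connection along the frame field \<open>v\<close> in the trivialization.\<close>

definition conn :: "'e \<Rightarrow> ('e \<Rightarrow> 'h bfun) \<Rightarrow> 'e \<Rightarrow> 'h bfun" where
  "conn v \<Phi> y = ddir \<Phi> v y + BB v y (\<Phi> y)"

lemma smooth_S_conn: "smooth_S \<Phi> \<Longrightarrow> smooth_S (conn v \<Phi>)"
  unfolding conn_def[abs_def] by (intro smooth_S_add smooth_S_ddir smooth_S_BB)

text \<open>On a compact ball the values of \<open>\<Phi>\<close> and of its partial derivatives form a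
  compact set, on which an orthogonal projection \<open>pr\<close> of finite rank is uniformly close
  to the identity. The map \<open>pr \<circ> \<Phi>\<close> is a finite sum of the maps treated
  before, its partial derivatives are the projections of those of \<open>\<Phi>\<close>, and the
  operators \<open>BB b\<close> are uniformly bounded there. So \<open>\<Phi>\<close> is a limit of
  approximable maps in the \<open>C\<^sup>1\<close> sense, which is all that
  \<open>\<Gamma>\<^sup>1(V)\<close> asks for.\<close>

lemma approximable_smooth:
  assumes \<Phi>: "smooth_S \<Phi>"
  shows "approximable \<Phi> (\<lambda>b. conn b \<Phi>)"
proof (rule approximable_limit)
  fix r \<epsilon> :: real assume r: "r < R" and \<epsilon>: "\<epsilon> > 0"
  have sub: "cball y0 r \<subseteq> B0" using r by auto
  have "\<forall>b. \<exists>C\<ge>0. \<forall>y\<in>cball y0 r. \<forall>w\<in>S. norm (BB b y w) \<le> C * norm w"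
    using BB_bounded_on_cball[OF r] by metis
  then obtain C where C: "\<And>b. C b \<ge> 0" "\<And>b y w. y \<in> cball y0 r \<Longrightarrow> w \<in> S \<Longrightarrow> norm (BB b y w) \<le> C b * norm w"
    by metis
  \<comment> \<open>\<open>L\<close> absorbs both the error of the projection and that error magnified by the operators \<open>BB b\<close>.\<close>
  define L where "L = 1 + (\<Sum>b\<in>Bs. C b)"
  have L: "L \<ge> 1" "\<And>b. b \<in> Bs \<Longrightarrow> 1 + C b \<le> L"
    using C(1) finite_Bs member_le_sum[of _ Bs C] by (auto simp: L_def sum_nonneg)
  define \<delta> where "\<delta> = \<epsilon> / L"
  have \<delta>: "\<delta> > 0" "L * \<delta> = \<epsilon>" using \<epsilon> L(1) by (auto simp: \<delta>_def)
  define Z where "Z = \<Phi> ` cball y0 r \<union> (\<Union>b\<in>Bs. ddir \<Phi> b ` cball y0 r)"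
  have cont: "continuous_on (cball y0 r) \<Psi>" if "smooth_S \<Psi>" for \<Psi>
    using that Ck_on_continuous[of 0 B0 \<Psi>] continuous_on_subset[OF _ sub] unfolding smooth_S_def by blast
  have "compact Z" unfolding Z_def
    by (intro compact_Un compact_UN finite_Bs compact_continuous_image compact_cball cont \<Phi> smooth_S_ddir)
  have ZS: "Z \<subseteq> S" using \<Phi> smooth_S_ddir(1)[OF \<Phi>] sub unfolding Z_def smooth_S_def by blast
  have "Z \<subseteq> (\<Union>z\<in>Z. ball z \<delta>)" using \<delta> by auto
  then obtain Z' where Z': "Z' \<subseteq> Z" "finite Z'" "Z \<subseteq> (\<Union>z\<in>Z'. ball z \<delta>)"
    using compactE_image[OF \<open>compact Z\<close>, of Z "\<lambda>z. ball z \<delta>"] by blast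
  let ?A = "KH.unembed ` Z'"
  have un: "KH.unembed z \<in> H x0" "embed K (KH.unembed z) = z" if "z \<in> S" for z
    using that by (auto simp: KH.unembed)
  have A: "finite ?A" "?A \<subseteq> H x0" using Z' ZS un by blast+
  obtain E where E: "KH.orthonormal_set E"
    "\<And>w h. w \<in> H x0 \<Longrightarrow> h \<in> ?A \<Longrightarrow>
      norm (embed K w - (\<Sum>e\<in>E. cscale (hinner K w e) (embed K e))) \<le> norm (embed K w - embed K h)"
    "\<And>w. w \<in> H x0 \<Longrightarrow> (\<Sum>e\<in>E. cscale (hinner K w e) (embed K e)) \<in> embed K ` H x0"
    by (rule KH.finite_rank_approximation[OF A]) (rule that)
  have E': "finite E" "\<And>e. e \<in> E \<Longrightarrow> e \<in> H x0" "\<And>e. e \<in> E \<Longrightarrow> hnorm K e \<le> 1"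
    using E(1) by (auto simp: KH.orthonormal_set_def hnorm_def)
  define pr where "pr w = (\<Sum>e\<in>E. cscale (apply_bcontfun w (discrete e)) (embed K e))" for w
  have pr_S: "pr w \<in> S" for w
    unfolding pr_def using E' by (intro S_closed_sum S_closed_cscale) auto
  have near: "norm (pr w - w) \<le> \<delta>" if "w \<in> Z" for w
  proof -
    from that obtain z where z: "z \<in> Z'" "w \<in> ball z \<delta>" using Z'(3) by blast
    have wS: "w \<in> S" and zS: "z \<in> S" using that z(1) Z'(1) ZS by blast+
    have "apply_bcontfun w (discrete e) = hinner K (KH.unembed w) e" if "e \<in> E" for e
      using KH.apply_embed_discrete[OF un(1)[OF wS] E'(2,3)[OF that]] un(2)[OF wS] by simp
    then have "pr w = (\<Sum>e\<in>E. cscale (hinner K (KH.unembed w) e) (embed K e))"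
      unfolding pr_def by (intro sum.cong) auto
    then have "norm (w - pr w) \<le> norm (w - z)"
      using E(2)[OF un(1)[OF wS] imageI[OF z(1)]] un(2)[OF wS] un(2)[OF zS] by simp
    also have "\<dots> \<le> \<delta>" using z(2) by (simp add: dist_norm norm_minus_commute)
    finally show ?thesis by (simp add: norm_minus_commute)
  qed
  let ?q = "\<lambda>e y. apply_bcontfun (\<Phi> y) (discrete e)"
  have ev: "bounded_linear (\<lambda>w::'h bfun. apply_bcontfun w z)" for z
    by (rule bounded_linear_intro[where K=1]) (auto simp: norm_bounded)
  have qC: "Ck_on k B0 (?q e)" for k e
    using Ck_on_linear[OF ev] \<Phi> unfolding smooth_S_def by blast
  have dq: "ddir (?q e) b y = apply_bcontfun (ddir \<Phi> b y) (discrete e)" if "y \<in> B0" for e b y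
    by (rule has_ddir_imp_ddir[OF has_ddir_linear[OF ev smooth_S_ddir(2)[OF \<Phi> that]]])
  define \<Psi> where "\<Psi> y = (\<Sum>e\<in>E. cscale (?q e y) (embed K e))" for y
  define \<Psi>' where "\<Psi>' b y = (\<Sum>e\<in>E. cscale (ddir (?q e) b y) (embed K e) + cscale (?q e y) (BB b y (embed K e)))" for b y
  have "approximable \<Psi> \<Psi>'"
    unfolding \<Psi>_def[abs_def] \<Psi>'_def[abs_def]
    by (rule approximable_sum[OF E'(1) approximable_elementary[OF qC E'(2)]])
  moreover have "norm (\<Psi> y - \<Phi> y) \<le> \<epsilon> \<and> (\<forall>b\<in>Bs. norm (\<Psi>' b y - conn b \<Phi> y) \<le> \<epsilon>)" if y: "y \<in> cball y0 r" for y
  proof (intro conjI ballI)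
    have yB: "y \<in> B0" using y sub by blast
    have PS: "\<Phi> y \<in> S" using \<Phi> yB by (simp add: smooth_S_def)
    have Psi: "\<Psi> y = pr (\<Phi> y)" by (simp add: \<Psi>_def pr_def)
    have n0: "norm (\<Psi> y - \<Phi> y) \<le> \<delta>" unfolding Psi by (rule near) (use y in \<open>simp add: Z_def\<close>)
    have "\<delta> * 1 \<le> \<delta> * L" using L(1) \<delta>(1) by (intro mult_left_mono) auto
    then have "\<delta> \<le> \<epsilon>" using \<delta>(2) by (simp add: mult.commute)
    with n0 show "norm (\<Psi> y - \<Phi> y) \<le> \<epsilon>" by simp
    fix b assume b: "b \<in> Bs"
    have "\<Psi>' b y = pr (ddir \<Phi> b y) + (\<Sum>e\<in>E. BB b y (cscale (?q e y) (embed K e)))"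
      using E'(2) by (simp add: \<Psi>'_def pr_def sum.distrib dq[OF yB] BB_cscale[OF yB])
    also have "(\<Sum>e\<in>E. BB b y (cscale (?q e y) (embed K e))) = BB b y (\<Psi> y)"
      unfolding \<Psi>_def using E' by (intro BB_sum[OF yB, symmetric] S_closed_cscale) auto
    finally have "\<Psi>' b y - conn b \<Phi> y = (pr (ddir \<Phi> b y) - ddir \<Phi> b y) + BB b y (\<Psi> y - \<Phi> y)"
      using ops.skew_family_diff[OF BB_skew yB pr_S[of "\<Phi> y"] PS] by (simp add: conn_def Psi)
    also have "norm \<dots> \<le> norm (pr (ddir \<Phi> b y) - ddir \<Phi> b y) + norm (BB b y (\<Psi> y - \<Phi> y))"
      by (rule norm_triangle_ineq)
    also have "\<dots> \<le> \<delta> + C b * \<delta>"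
    proof (rule add_mono)
      show "norm (pr (ddir \<Phi> b y) - ddir \<Phi> b y) \<le> \<delta>"
      proof (rule near)
        show "ddir \<Phi> b y \<in> Z" unfolding Z_def using y b by blast
      qed
      have "\<Psi> y - \<Phi> y \<in> S" unfolding Psi using pr_S PS by (intro subspace_diff[OF ops.subspace_S])
      then have "norm (BB b y (\<Psi> y - \<Phi> y)) \<le> C b * norm (\<Psi> y - \<Phi> y)" by (rule C(2)[OF y])
      also have "\<dots> \<le> C b * \<delta>" using n0 C(1) by (intro mult_left_mono)
      finally show "norm (BB b y (\<Psi> y - \<Phi> y)) \<le> C b * \<delta>" .
    qed
    also have "\<dots> = (1 + C b) * \<delta>" by (simp add: algebra_simps)
    also have "\<dots> \<le> L * \<delta>" using L(2)[OF b] \<delta>(1) by (intro mult_right_mono) auto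
    finally show "norm (\<Psi>' b y - conn b \<Phi> y) \<le> \<epsilon>" using \<delta>(2) by simp
  qed
  ultimately show "\<exists>\<Psi> \<Psi>'. approximable \<Psi> \<Psi>' \<and>
     (\<forall>y\<in>cball y0 r. norm (\<Psi> y - \<Phi> y) \<le> \<epsilon> \<and> (\<forall>b\<in>Bs. norm (\<Psi>' b y - conn b \<Phi> y) \<le> \<epsilon>))" by blast
qed

section \<open>Smooth maps come from smooth sections\<close>

text \<open>The section over \<open>V\<close> that the trivialization maps to \<open>\<Phi>\<close>.\<close>

definition lift :: "('e \<Rightarrow> 'h bfun) \<Rightarrow> 'n \<Rightarrow> 'h" where
  "lift \<Phi> = (\<lambda>x\<in>V. hor (KH.unembed (\<Phi> (c x))) x)"

lemma lift_in:
  assumes "smooth_S \<Phi>" "x \<in> V"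
  shows "lift \<Phi> x \<in> H x" "tr x (lift \<Phi> x) = \<Phi> (c x)"
proof -
  have "\<Phi> (c x) \<in> S" using assms cV by (simp add: smooth_S_def)
  then obtain k where k: "k \<in> H x0" "\<Phi> (c x) = embed K k" by blast
  then have "lift \<Phi> x = hor k x" using assms(2) by (simp add: lift_def KH.unembed)
  then show "lift \<Phi> x \<in> H x" "tr x (lift \<Phi> x) = \<Phi> (c x)"
    using k assms(2) by (simp_all add: tr_hor Hor_in hor)
qed

lemma lift_sections: "smooth_S \<Phi> \<Longrightarrow> lift \<Phi> \<in> sections F V"
  using lift_in(1) by (auto simp: sections_def lift_def)

lemma lift_unique:
  assumes "smooth_S \<Phi>" "x \<in> V" "u \<in> H x" "tr x u = \<Phi> (c x)"
  shows "u = lift \<Phi> x"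
  by (rule tr_inj[OF assms(2,3)]) (use assms lift_in in auto)

lemma loc_unif_convI:
  assumes \<phi>: "\<And>x. x \<in> V \<Longrightarrow> \<phi> x \<in> H x" and s: "\<And>j x. x \<in> V \<Longrightarrow> s j x \<in> H x"
    and lim: "\<And>r. 0 < r \<Longrightarrow> r < R \<Longrightarrow> uniform_limit (nbhd r) (\<lambda>j x. norm (tr x (s j x) - tr x (\<phi> x))) (\<lambda>_. 0) sequentially"
  shows "loc_unif_conv F V s \<phi>"
  unfolding loc_unif_conv_def
proof
  fix x assume x: "x \<in> V"
  define r where "r = (dist y0 (c x) + R) / 2"
  have r: "0 < r" "r < R" "dist y0 (c x) < r" using cV[OF x] R by (auto simp: r_def add_nonneg_pos)
  have "uniform_limit (nbhd r) (\<lambda>j x. hdist (fibre F x) (s j x) (\<phi> x)) (\<lambda>_. 0) sequentially"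
    using lim[OF r(1,2)] nbhd_V[OF _ r(2)] \<phi> s
    by (subst uniform_limit_cong'[where g="\<lambda>j x. norm (tr x (s j x) - tr x (\<phi> x))" and i="\<lambda>_. 0"])
      (auto simp: hdist_tr)
  moreover have "x \<in> nbhd r" using x r(3) by (simp add: nbhd_def)
  moreover have "nbhd r \<subseteq> V" using nbhd_V r(2) by blast
  ultimately show "\<exists>W. open W \<and> x \<in> W \<and> W \<subseteq> V \<and>
      uniform_limit W (\<lambda>j y. hdist (fibre F y) (s j y) (\<phi> y)) (\<lambda>y. 0) sequentially"
    using open_nbhd by blast
qed

text \<open>The component of \<open>X\<close> along \<open>b\<close>, as a function on the ball.\<close>

definition Xc :: "'n vfield \<Rightarrow> 'e \<Rightarrow> 'e \<Rightarrow> complex" where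
  "Xc X b y = X (p y) (coord b)"

lemma Xc_smooth: "X \<in> Vect M V \<Longrightarrow> Ck_on k B0 (Xc X b)"
  unfolding Xc_def[abs_def]
  by (rule Cinf_in_chart[OF _ subset_refl]) (use coord_Cinf R in \<open>auto simp: Vect_def\<close>)

definition connX :: "'n vfield \<Rightarrow> ('e \<Rightarrow> 'h bfun) \<Rightarrow> 'e \<Rightarrow> 'h bfun" where
  "connX X \<Phi> y = (\<Sum>b\<in>Bs. cscale (Xc X b y) (conn b \<Phi> y))"

lemma smooth_S_connX: "X \<in> Vect M V \<Longrightarrow> smooth_S \<Phi> \<Longrightarrow> smooth_S (connX X \<Phi>)"
  unfolding connX_def[abs_def]
  by (intro smooth_S_sum finite_Bs smooth_S_cscale Xc_smooth smooth_S_conn)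

lemma tr_expansion:
  assumes x: "x \<in> V" and u: "u \<in> H x" and w: "\<And>b. b \<in> Bs \<Longrightarrow> w b \<in> H x"
    and eq: "\<And>z. z \<in> H x \<Longrightarrow> hinner (fibre F x) u z = (\<Sum>b\<in>Bs. q b * hinner (fibre F x) (w b) z)"
  shows "tr x u = (\<Sum>b\<in>Bs. cscale (q b) (tr x (w b)))"
proof (rule bcontfun_eqI)
  fix z
  have sum: "apply_bcontfun (\<Sum>b\<in>B. f b) z = (\<Sum>b\<in>B. apply_bcontfun (f b) z)" if "finite B" for B and f :: "'e \<Rightarrow> 'h bfun"
    using that by (induction B rule: finite_induct) auto
  show "apply_bcontfun (tr x u) z = apply_bcontfun (\<Sum>b\<in>Bs. cscale (q b) (tr x (w b))) z"
  proof (cases "of_discrete z \<in> H x0 \<and> hnorm K (of_discrete z) \<le> 1")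
    case True
    then show ?thesis
      using eq[OF Hor_in[OF hor(1) x, of "of_discrete z"]]
      by (simp add: sum finite_Bs apply_cscale apply_tr x u w)
  next
    case False
    then have "apply_bcontfun (tr x u') z = 0" if "u' \<in> H x" for u'
      using apply_tr[OF x that, of z] by auto
    then show ?thesis by (simp add: sum finite_Bs apply_cscale u w)
  qed
qed

text \<open>A sequence of smooth sections that approximates with error \<open>1/(j+1)\<close> on balls
  exhausting \<open>V\<close>. Along an arbitrary field \<open>X\<close> the derivatives converge
  because its components along the frame are bounded on smaller balls.\<close>

lemma smooth_approximation:
  assumes \<Phi>: "smooth_S \<Phi>"
  obtains s where "C1_approx M F V s (lift \<Phi>)" "\<And>b. b \<in> Bs \<Longrightarrow> C1_lim s (lift \<Phi>) b (lift (conn b \<Phi>))"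
proof -
  \<comment> \<open>Radii in the open interval from 0 to \<open>R\<close> that increase to \<open>R\<close>.\<close>
  define R' where "R' j = R - R / real (j + 2)" for j
  have R'R: "R' j < R" for j using R by (simp add: R'_def)
  have "\<exists>s\<in>sm. \<forall>x\<in>nbhd (R' j). norm (tr x (s x) - \<Phi> (c x)) \<le> 1 / real (Suc j) \<and>
     (\<forall>b\<in>Bs. norm (tr x (dv b s x) - conn b \<Phi> (c x)) \<le> 1 / real (Suc j))" for j
    using approximable_smooth[OF \<Phi>] R'R[of j] unfolding approximable_def by simp
  then obtain s where s: "\<And>j. s j \<in> sm"
    "\<And>j x. x \<in> nbhd (R' j) \<Longrightarrow> norm (tr x (s j x) - \<Phi> (c x)) \<le> 1 / real (Suc j)"
    "\<And>j x b. x \<in> nbhd (R' j) \<Longrightarrow> b \<in> Bs \<Longrightarrow> norm (tr x (dv b (s j) x) - conn b \<Phi> (c x)) \<le> 1 / real (Suc j)"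
    by metis
  have inv0: "(\<lambda>j. 1 / real (Suc j)) \<longlonglongrightarrow> 0" using LIMSEQ_inverse_real_of_nat by (simp add: inverse_eq_divide)
  have evr: "\<forall>\<^sub>F j in sequentially. r \<le> R' j" if "r < R" for r
  proof -
    have "(\<lambda>j. R * (1 / real (Suc j))) \<longlonglongrightarrow> R * 0" by (intro tendsto_mult tendsto_const inv0)
    then have "(\<lambda>j. R * (1 / real (Suc (Suc j)))) \<longlonglongrightarrow> R * 0" by (rule LIMSEQ_Suc)
    then have "(\<lambda>j. R - R * (1 / real (Suc (Suc j)))) \<longlonglongrightarrow> R - R * 0" by (intro tendsto_diff tendsto_const)
    moreover have "R - R * (1 / real (Suc (Suc j))) = R' j" for j by (simp add: R'_def)
    ultimately have "R' \<longlonglongrightarrow> R" by simp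
    from order_tendstoD(1)[OF this that] show ?thesis by eventually_elim simp
  qed
  have unif: "uniform_limit (nbhd r) (\<lambda>j x. norm (t j x)) (\<lambda>_. 0) sequentially"
    if r: "r < R" and t: "\<And>j x. x \<in> nbhd (R' j) \<Longrightarrow> x \<in> nbhd r \<Longrightarrow> norm (t j x) \<le> L * (1 / real (Suc j))" for r L and t :: "nat \<Rightarrow> 'n \<Rightarrow> 'h bfun"
  proof (rule uniform_limitI)
    fix e :: real assume "e > 0"
    have "(\<lambda>j. L * (1 / real (Suc j))) \<longlonglongrightarrow> L * 0" by (intro tendsto_mult tendsto_const inv0)
    then have "\<forall>\<^sub>F j in sequentially. L * (1 / real (Suc j)) < e" using \<open>e > 0\<close> order_tendstoD(2) by fastforce
    then show "\<forall>\<^sub>F j in sequentially. \<forall>x\<in>nbhd r. dist (norm (t j x)) 0 < e"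
      using evr[OF r]
    proof eventually_elim
      case (elim j)
      show ?case
      proof
        fix x assume x: "x \<in> nbhd r"
        then have "x \<in> nbhd (R' j)" using nbhd_mono[OF elim(2)] by blast
        from t[OF this x] elim(1) show "dist (norm (t j x)) 0 < e" by simp
      qed
    qed
  qed
  note lin = lift_in[OF \<Phi>] lift_in[OF smooth_S_conn[OF \<Phi>]]
  have conv0: "loc_unif_conv F V s (lift \<Phi>)"
  proof (rule loc_unif_convI)
    fix r assume "0 < r" "r < R"
    show "uniform_limit (nbhd r) (\<lambda>j x. norm (tr x (s j x) - tr x (lift \<Phi> x))) (\<lambda>_. 0) sequentially"
      by (rule unif[OF \<open>r < R\<close>, where L=1]) (use s(2) lin nbhd_V[OF _ \<open>r < R\<close>] in simp)
  qed (use s sm_in lin in auto)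
  have conv1: "loc_unif_conv F V (\<lambda>j. dv b (s j)) (lift (conn b \<Phi>))" if b: "b \<in> Bs" for b
  proof (rule loc_unif_convI)
    fix r assume "0 < r" "r < R"
    show "uniform_limit (nbhd r) (\<lambda>j x. norm (tr x (dv b (s j) x) - tr x (lift (conn b \<Phi>) x))) (\<lambda>_. 0) sequentially"
      by (rule unif[OF \<open>r < R\<close>, where L=1]) (use s(3) b lin nbhd_V[OF _ \<open>r < R\<close>] in simp)
  qed (use s sm_in dv_sm lin in auto)
  have C1: "C1_lim s (lift \<Phi>) b (lift (conn b \<Phi>))" if "b \<in> Bs" for b
    unfolding C1_lim_def secs_def using s conv0 conv1[OF that] lin by auto
  have convX: "loc_unif_conv F V (\<lambda>j. nabla_restr M F V X (s j)) (lift (connX X \<Phi>))" if X: "X \<in> Vect M V" for X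
  proof (rule loc_unif_convI)
    note linX = lift_in[OF smooth_S_connX[OF X \<Phi>]]
    show "\<And>x. x \<in> V \<Longrightarrow> lift (connX X \<Phi>) x \<in> H x" by (rule linX(1))
    show nin: "\<And>j x. x \<in> V \<Longrightarrow> nabla_restr M F V X (s j) x \<in> H x" by (rule nabla_restr_inner(1)[OF _ _ X s(1)])
    fix r assume r0: "0 < r" and r: "r < R"
    have sub: "cball y0 r \<subseteq> B0" using r by auto
    have "\<forall>b. \<exists>L. \<forall>y\<in>cball y0 r. cmod (Xc X b y) \<le> L"
      using compact_imp_bounded[OF compact_continuous_image[OF continuous_on_subset[OF
          Ck_on_continuous[OF Xc_smooth[OF X]] sub] compact_cball]] by (auto simp: bounded_iff)
    then obtain L where L: "\<And>b y. y \<in> cball y0 r \<Longrightarrow> cmod (Xc X b y) \<le> L b" by metis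
    show "uniform_limit (nbhd r) (\<lambda>j x. norm (tr x (nabla_restr M F V X (s j) x) - tr x (lift (connX X \<Phi>) x))) (\<lambda>_. 0) sequentially"
    proof (rule unif[OF r, where L="\<Sum>b\<in>Bs. L b"])
      fix j x assume xj: "x \<in> nbhd (R' j)" and xr: "x \<in> nbhd r"
      have x: "x \<in> V" using nbhd_V[OF xr r] .
      have cx: "c x \<in> cball y0 r" using xr by (simp add: nbhd_def)
      have "tr x (nabla_restr M F V X (s j) x) = (\<Sum>b\<in>Bs. cscale (X x (coord b)) (tr x (dv b (s j) x)))"
        by (rule tr_expansion[OF x nin[OF x] sm_in[OF dv_sm[OF s(1)]]])
          (rule nabla_restr_inner(2)[OF x x X s(1)])
      then have "tr x (nabla_restr M F V X (s j) x) - tr x (lift (connX X \<Phi>) x) =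
          (\<Sum>b\<in>Bs. cscale (Xc X b (c x)) (tr x (dv b (s j) x) - conn b \<Phi> (c x)))"
        using linX(2)[OF x] pc[OF x]
        by (simp add: connX_def Xc_def sum_subtractf bounded_bilinear.diff_right[OF bounded_bilinear_cscale])
      also have "norm \<dots> \<le> (\<Sum>b\<in>Bs. L b * (1 / real (Suc j)))"
      proof (rule sum_norm_le)
        fix b assume b: "b \<in> Bs"
        have "norm (cscale (Xc X b (c x)) (tr x (dv b (s j) x) - conn b \<Phi> (c x))) \<le>
            cmod (Xc X b (c x)) * norm (tr x (dv b (s j) x) - conn b \<Phi> (c x))" by (rule norm_cscale_le)
        also have "\<dots> \<le> L b * (1 / real (Suc j))"
          by (intro mult_mono L[OF cx] s(3)[OF xj b]) (use L[OF cx, of b] in \<open>auto intro: order_trans[OF norm_ge_zero]\<close>)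
        finally show "norm (cscale (Xc X b (c x)) (tr x (dv b (s j) x) - conn b \<Phi> (c x))) \<le> L b * (1 / real (Suc j))" .
      qed
      finally show "norm (tr x (nabla_restr M F V X (s j) x) - tr x (lift (connX X \<Phi>) x)) \<le> (\<Sum>b\<in>Bs. L b) * (1 / real (Suc j))"
        by (simp only: sum_distrib_right)
    qed
  qed
  have "C1_approx M F V s (lift \<Phi>)"
    unfolding C1_approx_def
    using s(1) conv0 convX lift_sections[OF smooth_S_connX[OF _ \<Phi>]] by blast
  then show ?thesis using C1 by (rule that)
qed

lemma nabla_on_lift:
  assumes \<Phi>: "smooth_S \<Phi>" and X: "X \<in> Vect M V"
  shows "nabla_on M F V X (lift \<Phi>) = lift (connX X \<Phi>)"
proof
  fix x
  obtain s where s: "C1_approx M F V s (lift \<Phi>)" "\<And>b. b \<in> Bs \<Longrightarrow> C1_lim s (lift \<Phi>) b (lift (conn b \<Phi>))"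
    by (rule smooth_approximation[OF \<Phi>]) (rule that)
  show "nabla_on M F V X (lift \<Phi>) x = lift (connX X \<Phi>) x"
  proof (cases "x \<in> V")
    case True
    note N = nabla_on_expansion[OF open_nbhd subset_refl lift_sections[OF \<Phi>] s(1) s(2) X True]
    have "tr x (nabla_on M F V X (lift \<Phi>) x) = (\<Sum>b\<in>Bs. cscale (X x (coord b)) (tr x (lift (conn b \<Phi>) x)))"
      by (rule tr_expansion[OF True N(1) lift_in(1)[OF smooth_S_conn[OF \<Phi>] True] N(2)]) assumption+
    also have "\<dots> = connX X \<Phi> (c x)"
      using pc[OF True] by (simp add: connX_def Xc_def lift_in(2)[OF smooth_S_conn[OF \<Phi>] True])
    finally show ?thesis using lift_unique[OF smooth_S_connX[OF X \<Phi>] True N(1)] by simp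
  qed (simp add: nabla_on_def lift_def)
qed

text \<open>The covariant derivative of the section given by \<open>\<Phi>\<close> is the section given by the
  smooth map \<open>connX X \<Phi>\<close>, so the induction needs approximation only to first
  order.\<close>

lemma lift_Gamma: "smooth_S \<Phi> \<Longrightarrow> lift \<Phi> \<in> Gamma M F V n"
proof (induction n arbitrary: \<Phi>)
  case 0
  obtain s where s: "C1_approx M F V s (lift \<Phi>)" by (rule smooth_approximation[OF 0]) (rule that)
  then show ?case using lift_sections[OF 0] by (auto simp: Gamma0_def C1_approx_def)
next
  case (Suc n)
  show ?case
  proof (cases n)
    case 0
    obtain s where s: "C1_approx M F V s (lift \<Phi>)" by (rule smooth_approximation[OF Suc.prems]) (rule that)
    then show ?thesis using Suc.IH[OF Suc.prems] 0 by auto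
  next
    case (Suc m)
    have "nabla_on M F V X (lift \<Phi>) \<in> Gamma M F V n" if "X \<in> Vect M V" for X
      unfolding nabla_on_lift[OF Suc.prems that] by (rule Suc.IH[OF smooth_S_connX[OF that Suc.prems]])
    then show ?thesis using Suc.IH[OF Suc.prems] Suc by auto
  qed
qed

lemma trivializes:
  "(\<lambda>\<phi>. \<lambda>x\<in>V. T x (\<phi> x)) ` Gamma_inf M F V = hilbert_Cinf M V K"
proof (intro equalityI subsetI)
  fix f assume "f \<in> (\<lambda>\<phi>. \<lambda>x\<in>V. T x (\<phi> x)) ` Gamma_inf M F V"
  then show "f \<in> hilbert_Cinf M V K" using Gamma_inf_to_Cinf by blast
next
  fix f assume f: "f \<in> hilbert_Cinf M V K"
  note f' = hilbert_CinfD[OF f]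
  define \<Phi> where "\<Phi> y = embed K (f (p y))" for y
  have \<Phi>: "smooth_S \<Phi>" unfolding smooth_S_def \<Phi>_def[abs_def] using f' pV by auto
  have mem: "lift \<Phi> \<in> Gamma_inf M F V" unfolding Gamma_inf_def using lift_Gamma[OF \<Phi>] by blast
  have eq: "(\<lambda>x\<in>V. T x (lift \<Phi> x)) = f"
  proof
    fix x
    show "(\<lambda>x\<in>V. T x (lift \<Phi> x)) x = f x"
    proof (cases "x \<in> V")
      case True
      have "embed K (T x (lift \<Phi> x)) = embed K (f x)"
        using lift_in(2)[OF \<Phi> True] pc[OF True] by (simp add: tr_def \<Phi>_def)
      then show ?thesis
        using True KH.embed_inj[OF T_in[OF True lift_in(1)[OF \<Phi> True]]] f'(1) by (auto simp: PiE_def Pi_def)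
    qed (use f'(1) in \<open>auto simp: PiE_def extensional_def\<close>)
  qed
  show "f \<in> (\<lambda>\<phi>. \<lambda>x\<in>V. T x (\<phi> x)) ` Gamma_inf M F V"
  proof (rule image_eqI)
    show "f = (\<lambda>x\<in>V. T x (lift \<Phi> x))" by (rule eq[symmetric])
  qed (rule mem)
qed

end

section \<open>The local trivialization\<close>

theorem theorem2p11:
  fixes M :: "('n::{t2_space,second_countable_topology}, 'e::real_inner) atlas"
    and F :: "('n, 'h) hilbert_field"
  assumes "smooth_manifold M"
    and "connected (UNIV :: 'n set)"
    and "smooth_hilbert_field M F"
    and "\<forall>x. \<exists>U A. open U \<and> x \<in> U \<and>
      (\<forall>X\<in>Vect M U. smooth_operator_field M F U (A X)) \<and>
      (\<forall>X\<in>Vect M U. \<forall>Y\<in>Vect M U. \<forall>\<phi>\<in>Gamma_inf M F U.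
         op_apply U (A (vf_add X Y)) \<phi> = sec_add F U (op_apply U (A X) \<phi>) (op_apply U (A Y) \<phi>)) \<and>
      (\<forall>a\<in>Cinf M U. \<forall>X\<in>Vect M U. \<forall>\<phi>\<in>Gamma_inf M F U.
         op_apply U (A (vf_scale a X)) \<phi> = sec_scale F U a (op_apply U (A X) \<phi>)) \<and>
      (\<forall>X\<in>Vect M U. \<forall>\<phi>\<in>Gamma_inf M F U. \<forall>\<psi>\<in>Gamma_inf M F U. \<forall>y\<in>U.
         sec_inner F (op_apply U (A X) \<phi>) \<psi> y =
           sec_inner F \<phi> (sec_scale F U (\<lambda>z. - 1) (op_apply U (A (vf_cnj X)) \<psi>)) y) \<and>
      (\<forall>X\<in>Vect M U. \<forall>n.
         continuous_map (subtopology (Gamma_topology M F U n) (Gamma_inf M F U))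
           (subtopology (Gamma_topology M F U n) (Gamma_inf M F U)) (op_apply U (A X))) \<and>
      (\<forall>h. proj F h \<in> U \<longrightarrow> (\<exists>\<phi>\<in>Gamma_inf M F U. \<phi> (proj F h) = h \<and>
         (\<forall>X\<in>Vect M U. nabla_on M F U X \<phi> = op_apply U (A X) \<phi>)))"
  shows "admits_smooth_local_trivialization M F"
proof -
  have "\<exists>B::'e set. finite B \<and> span B = UNIV" using assms(1) unfolding smooth_manifold_def by (rule conjunct1)
  then obtain Bs :: "'e set" where Bs: "finite_onb Bs" using finite_onb_exists by blast
  interpret finite_onb Bs by (rule Bs)
  interpret smooth_mfd Bs M by unfold_locales (rule assms(1))
  have local: "\<exists>V T. open V \<and> x \<in> V \<and> (\<forall>y\<in>V. unitary_map (fibre F y) (fibre F x) (T y)) \<and>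
      (\<lambda>\<phi>. \<lambda>y\<in>V. T y (\<phi> y)) ` Gamma_inf M F V = hilbert_Cinf M V (fibre F x)" for x
  proof -
    obtain U A where UA: "open U" "x \<in> U"
      "\<forall>X\<in>Vect M U. smooth_operator_field M F U (A X)"
      "\<forall>X\<in>Vect M U. \<forall>\<phi>\<in>Gamma_inf M F U. \<forall>\<psi>\<in>Gamma_inf M F U. \<forall>y\<in>U.
         sec_inner F (op_apply U (A X) \<phi>) \<psi> y =
           sec_inner F \<phi> (sec_scale F U (\<lambda>z. - 1) (op_apply U (A (vf_cnj X)) \<psi>)) y"
      "\<forall>h. proj F h \<in> U \<longrightarrow> (\<exists>\<phi>\<in>Gamma_inf M F U. \<phi> (proj F h) = h \<and>
         (\<forall>X\<in>Vect M U. nabla_on M F U X \<phi> = op_apply U (A X) \<phi>))"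
      using spec[OF assms(4), of x] by (elim exE conjE) (rule that)
    obtain D c where C: "(D, c) \<in> M" "x \<in> D" using chart_cover[of x] by blast
    have "open (c ` (D \<inter> U))" by (rule chart_image_open_Int[OF C(1) UA(1)])
    moreover have "c x \<in> c ` (D \<inter> U)" using C(2) UA(2) by blast
    ultimately obtain r where r: "r > 0" "cball (c x) r \<subseteq> c ` (D \<inter> U)" using open_contains_cball by blast
    \<comment> \<open>The trivialization lives over a ball four times smaller than one that fits into the chart and into \<open>U\<close>.\<close>
    define R where "R = r / 4"
    interpret chart_ball Bs M D c "c x" R
      by unfold_locales (use C r in \<open>auto simp: R_def\<close>)
    have VU: "nbhd R \<subseteq> U"
    proof
      fix z assume z: "z \<in> nbhd R"
      then have "c z \<in> cball (c x) r" using r(1) by (simp add: nbhd_def R_def)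
      then obtain w where w: "w \<in> D" "w \<in> U" "c z = c w" using r(2) by blast
      have "z = p (c z)" by (rule p_c[OF nbhd_D(1)[OF z], symmetric])
      also have "\<dots> = w" unfolding w(3) by (rule p_c[OF w(1)])
      finally have "z = w" .
      with w(2) show "z \<in> U" by simp
    qed
    interpret horizontal_field Bs M D c "c x" R F U A
    proof unfold_locales
      show "smooth_hilbert_field M F" "open U" "nbhd R \<subseteq> U" by (fact assms(3) UA(1) VU)+
      show "smooth_operator_field M F U (A X)" if "X \<in> Vect M U" for X
        using UA(3) that by (rule bspec)
      show "sec_inner F (op_apply U (A X) \<phi>) \<psi> y =
          sec_inner F \<phi> (sec_scale F U (\<lambda>z. - 1) (op_apply U (A (vf_cnj X)) \<psi>)) y"
        if "X \<in> Vect M U" "\<phi> \<in> Gamma_inf M F U" "\<psi> \<in> Gamma_inf M F U" "y \<in> U" for X \<phi> \<psi> y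
        using UA(4) that by simp
      show "\<exists>\<phi>\<in>Gamma_inf M F U. \<phi> (proj F h) = h \<and>
          (\<forall>X\<in>Vect M U. nabla_on M F U X \<phi> = op_apply U (A X) \<phi>)" if "proj F h \<in> U" for h
        using UA(5) that by simp
    qed
    have x0: "p (c x) = x" by (rule p_c[OF C(2)])
    show ?thesis
    proof (intro exI conjI ballI)
      show "open (nbhd R)" by (rule open_nbhd)
      show "x \<in> nbhd R" using x0_V unfolding x0 .
      show "unitary_map (fibre F y) (fibre F x) (T y)" if "y \<in> nbhd R" for y
        using T_unitary[OF that] unfolding x0 .
      show "(\<lambda>\<phi>. \<lambda>y\<in>nbhd R. T y (\<phi> y)) ` Gamma_inf M F (nbhd R) = hilbert_Cinf M (nbhd R) (fibre F x)"
        using trivializes unfolding x0 .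
    qed
  qed
  let ?P = "\<lambda>x (V, T). open V \<and> x \<in> V \<and> (\<forall>y\<in>V. unitary_map (fibre F y) (fibre F x) (T y)) \<and>
      (\<lambda>\<phi>. \<lambda>y\<in>V. T y (\<phi> y)) ` Gamma_inf M F V = hilbert_Cinf M V (fibre F x)"
  from local have "\<forall>x. \<exists>VT. ?P x VT" by simp
  from choice[OF this] obtain VT where P: "\<forall>x. ?P x (VT x)" by (rule exE)
  let ?V = "\<lambda>x. fst (VT x)" and ?T = "\<lambda>x. snd (VT x)"
  have VT: "open (?V x)" "x \<in> ?V x" "\<forall>y\<in>?V x. unitary_map (fibre F y) (fibre F x) (?T x y)"
    "(\<lambda>\<phi>. \<lambda>y\<in>?V x. ?T x y (\<phi> y)) ` Gamma_inf M F (?V x) = hilbert_Cinf M (?V x) (fibre F x)" for x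
    using spec[OF P, of x] by (simp_all add: split_beta)
  have "complex_hilbert_space (fibre F x)" for x
    using assms(3) by (simp add: smooth_hilbert_field_def field_of_hilbert_spaces_def)
  moreover have "(\<Union>x. ?V x) = UNIV" using VT(2) by blast
  ultimately have "smooth_local_trivialization M F UNIV ?V (fibre F) ?T"
    unfolding smooth_local_trivialization_def using VT by simp
  then show ?thesis unfolding admits_smooth_local_trivialization_def by blast
qed

end
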